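(* Under the standing assumptions, let $u\in C^2(\mathbb R^d)$ with $u>0$ and $\mathfrak L^\sharp u\le0$ on $\mathbb R^d$, and let $A\subset\mathbb R^d$ be compact. Then the process $$t\mapsto\int_{X_t(A)}u(y)\,\mathrm{d}y$$ is a positive supermartingale with respect to the Brownian filtration $(\mathcal F_t)$.
   Context: Standing assumptions: $d\ge 2$; $b$ is a standard $d$-dimensional Brownian motion with natural filtration $(\mathcal F_t)$; $\sigma$ is a constant $d\times d$ positive-definite matrix and $a:=\sigma\sigma^{T}$; the drift $m:\mathbb R^d\to\mathbb R^d$ belongs to $C^{1,1}(\mathbb R^d)$; there is a potential $\psi:\mathbb R^d\to(0,\infty)$ with $m=-a\nabla\ln\psi$ and $\int_{\mathbb R^d}\psi^{-2}\,\mathrm{d}x=1$; and there is $\lambda_c>0$ with $\nabla\cdot m\le-\lambda_c$ everywhere. $X_t(x,b)$ is the stochastic flow of global diffeomorphisms solving $X_t=x+\sigma b(t)+\int_0^t m(X_s)\,\mathrm{d}s$, and $X_t(A)$ is the image of $A$ under $x\mapsto X_t(x,b)$. The operator $\mathfrak L^\sharp$ acts on $f\in C^2$ by $\mathfrak L^\sharp f=\tfrac12\nabla\cdot(a\nabla f)+m\cdot\nabla f+(\nabla\cdot m)f$. *)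

theory Defs
  imports "HOL-Analysis.Analysis" "HOL-Probability.Probability"
begin

definition grad :: "(real^'n \<Rightarrow> real) \<Rightarrow> real^'n \<Rightarrow> real^'n" where
  "grad f x = (\<chi> i. frechet_derivative f (at x) (axis i 1))"

definition divergence :: "(real^'n \<Rightarrow> real^'n) \<Rightarrow> real^'n \<Rightarrow> real" where
  "divergence F x = (\<Sum>i\<in>UNIV. frechet_derivative F (at x) (axis i 1) $ i)"

definition L_sharp :: "real^'n^'n \<Rightarrow> (real^'n \<Rightarrow> real^'n) \<Rightarrow> (real^'n \<Rightarrow> real) \<Rightarrow> real^'n \<Rightarrow> real" where
  "L_sharp a m f x = 1/2 * divergence (\<lambda>y. a *v grad f y) x + m x \<bullet> grad f x + divergence m x * f x"

definition C2 :: "(real^'n \<Rightarrow> real) \<Rightarrow> bool" where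
  "C2 f \<longleftrightarrow> (\<exists>Df D2f. (\<forall>x. (f has_derivative blinfun_apply (Df x)) (at x)) \<and>
                    (\<forall>x. (Df has_derivative blinfun_apply (D2f x)) (at x)) \<and>
                    continuous_on UNIV D2f)"

definition C11 :: "(real^'n \<Rightarrow> real^'n) \<Rightarrow> bool" where
  "C11 F \<longleftrightarrow> (\<exists>DF L. (\<forall>x. (F has_derivative blinfun_apply (DF x)) (at x)) \<and> lipschitz_on L UNIV DF)"

definition natural_filtration :: "'w measure \<Rightarrow> (real \<Rightarrow> 'w \<Rightarrow> 'b::topological_space) \<Rightarrow> real \<Rightarrow> 'w measure" where
  "natural_filtration M b t = sigma (space M)
      (\<Union>s\<in>{0..t}. {(b s) -` B \<inter> space M | B. B \<in> sets borel})"

definition standard_BM :: "'w measure \<Rightarrow> (real \<Rightarrow> 'w \<Rightarrow> real^'n) \<Rightarrow> bool" where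
  "standard_BM M b \<longleftrightarrow> prob_space M \<and>
     (\<forall>t\<ge>0. b t \<in> borel_measurable M) \<and>
     (\<forall>\<omega>\<in>space M. b 0 \<omega> = 0 \<and> continuous_on {0..} (\<lambda>t. b t \<omega>)) \<and>
     (\<forall>s t. 0 \<le> s \<and> s < t \<longrightarrow>
        distributed M lborel (\<lambda>\<omega>. b t \<omega> - b s \<omega>)
          (\<lambda>x. ennreal (\<Prod>i\<in>UNIV. normal_density 0 (sqrt (t - s)) (x $ i))) \<and>
        (\<forall>A\<in>sets (natural_filtration M b s). \<forall>B\<in>sets borel.
           measure M (A \<inter> ((\<lambda>\<omega>. b t \<omega> - b s \<omega>) -` B \<inter> space M)) =
           measure M A * measure M ((\<lambda>\<omega>. b t \<omega> - b s \<omega>) -` B \<inter> space M)))"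

definition supermartingale :: "'w measure \<Rightarrow> (real \<Rightarrow> 'w measure) \<Rightarrow> (real \<Rightarrow> 'w \<Rightarrow> real) \<Rightarrow> bool" where
  "supermartingale M F Y \<longleftrightarrow>
     (\<forall>t\<ge>0. Y t \<in> borel_measurable (F t) \<and> integrable M (Y t)) \<and>
     (\<forall>s t. 0 \<le> s \<and> s \<le> t \<longrightarrow> (AE \<omega> in M. real_cond_exp M (F s) (Y t) \<omega> \<le> Y s \<omega>))"

end

theory Submission
  imports Defs
begin

text \<open>
  Since the noise is additive, the flow is a family of pathwise ordinary differential equations, and
  Liouville's formula gives the Jacobian \<open>J t x = exp (\<integral>\<^sub>0\<^sup>t div m (X s x) ds)\<close>. The change of variables
  formula turns the volume integral into \<open>\<integral>\<^sub>A Z t x dx\<close> with \<open>Z t x = J t x * u (X t x)\<close>, so by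
  Tonelli it suffices to treat \<open>Z\<close> for a fixed starting point.

  Stochastic calculus is avoided by killing \<open>Z\<close> when the path leaves a ball. On the ball all
  coefficients are bounded, and a second-order Taylor expansion over a time step \<open>h\<close> has, by
  independence of the Brownian increment, conditional mean at most \<open>Z + h * J * L\<^sup>\<sharp>u + o(h)\<close>. Killing only
  lowers a positive process, which makes stopping times unnecessary: \<open>u\<close> is bounded away from zero on
  the ball, hence the Taylor polynomial is negative only for increments of order one, whose
  contribution is \<open>O(h\<^sup>2)\<close>. Summing over the steps, letting \<open>h\<close> tend to zero and then the radius to
  infinity (Fatou) gives the supermartingale inequality for \<open>Z\<close>.
\<close>

subsection \<open>Gronwall inequality, Riemann sums and the Euler scheme\<close>

text \<open>Three obstacles fix the form of the estimates. The Hessian of \<open>u\<close> is merely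
  continuous, so a time step has no explicit rate: its error is kept as
  \<open>e * (h + |v|^2) + C * (h^2 + |v|^4 + S)\<close>, where \<open>v\<close> is the Brownian
  increment and \<open>e\<close> is arbitrarily small. The path inside a step is measured by the
  time integral \<open>S\<close> of squared increments, whose mean is of order \<open>h^2\<close> by
  second moments alone. The steps are added up, so the admissible \<open>h\<close> must not depend
  on the time or on the past event against which the inequality is tested; this is why every
  constant is attached to a ball. Since the divergence is nonpositive, the Jacobian stays in
  \<open>(0, 1]\<close> and never amplifies an error. Two points cost work outside probability:
  spatial differentiability of the flow is given time by time, so the equation for its derivative
  has to be derived; and exchanging the integrals over space and samples needs measurability of the
  flow jointly in starting point and sample, relative to the past at time \<open>t\<close>, which
  comes from Euler approximations.\<close>

lemma gronwall:
  fixes g :: "real \<Rightarrow> real"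
  assumes g: "continuous_on {0..T} g" and L: "L \<ge> 0"
    and le: "\<And>t. t \<in> {0..T} \<Longrightarrow> g t \<le> a + L * integral {0..t} g"
    and t: "t \<in> {0..T}"
  shows "g t \<le> a * exp (L * t)"
proof -
  \<comment> \<open>\<open>G\<close> is the right-hand side of the hypothesis. Since
    \<open>G' = L * g \<le> L * G\<close>, the product with the integrating factor
    \<open>exp (- (L * s))\<close> is nonincreasing, which the mean value theorem turns into a
    comparison with time 0.\<close>
  define G where "G t = a + L * integral {0..t} g" for t
  have dG: "(G has_real_derivative L * g s) (at s within {0..T})" if "s \<in> {0..T}" for s
    unfolding G_def using integral_has_real_derivative[OF g that]
    by (auto intro!: derivative_eq_intros)
  have dH: "((\<lambda>s. G s * exp (- (L * s))) has_real_derivative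
      (L * g s - L * G s) * exp (- (L * s))) (at s within {0..T})" if "s \<in> {0..T}" for s
    by (rule derivative_eq_intros dG[OF that] refl)+ (simp add: algebra_simps)
  have "G t * exp (- (L * t)) \<le> G 0 * exp (- (L * 0))"
  proof (cases "t = 0")
    case False
    then have "0 < t" using t by simp
    obtain z where z: "0 < z" "z < t"
      "G t * exp (- (L * t)) - G 0 * exp (- (L * 0)) = (t - 0) * ((L * g z - L * G z) * exp (- (L * z)))"
    proof -
      have "continuous_on {0..t} (\<lambda>s. G s * exp (- (L * s)))"
        using t by (intro DERIV_continuous_on[where D="\<lambda>s. (L * g s - L * G s) * exp (- (L * s))"]
          DERIV_subset[OF dH]) auto
      moreover have "((\<lambda>s. G s * exp (- (L * s))) has_derivative
          (\<lambda>x. x * ((L * g s - L * G s) * exp (- (L * s))))) (at s)" if "0 < s" "s < t" for s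
        using dH[of s] that t at_within_Icc_at[of 0 s T]
        by (auto simp: has_field_derivative_def mult.commute mult_commute_abs)
      ultimately show ?thesis
        using mvt[OF \<open>0 < t\<close>, of "\<lambda>s. G s * exp (- (L * s))"
            "\<lambda>s x. x * ((L * g s - L * G s) * exp (- (L * s)))"] that
        by (auto simp: mult.commute)
    qed
    have "L * g z - L * G z \<le> 0"
      using le[of z] z t L by (auto simp: G_def intro: mult_left_mono)
    then have "(t - 0) * ((L * g z - L * G z) * exp (- (L * z))) \<le> 0"
      using \<open>0 < t\<close> by (simp add: mult_nonneg_nonpos mult_nonpos_nonneg)
    then show ?thesis using z by linarith
  qed simp
  then have "G t \<le> a * exp (L * t)"
    by (simp add: G_def exp_minus field_simps)
  then show ?thesis using le[OF t] by (simp add: G_def)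
qed

text \<open>Uniform continuity on the compact interval yields one threshold \<open>N\<close> that
  serves every cell of every finer grid. This is the consistency error of both the Riemann sums and
  the Euler scheme.\<close>

lemma uniform_grid_modulus:
  fixes f :: "real \<Rightarrow> 'a::real_normed_vector"
  assumes f: "continuous_on {0..t} f" and t: "t \<ge> 0" and e: "e > 0"
  obtains N where "\<And>n k r. \<lbrakk>n \<ge> N; k < n; r \<in> {t * real k / real n..t * real (Suc k) / real n}\<rbrakk>
     \<Longrightarrow> norm (f r - f (t * real k / real n)) \<le> e"
proof -
  have "uniformly_continuous_on {0..t} f"
    using f by (intro compact_uniformly_continuous) auto
  then obtain d where d: "d > 0" "\<And>x y. \<lbrakk>x \<in> {0..t}; y \<in> {0..t}; dist y x < d\<rbrakk> \<Longrightarrow> dist (f y) (f x) < e"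
    using e unfolding uniformly_continuous_on_def by metis
  obtain N where N: "real N > t / d" using reals_Archimedean2 by blast
  have "norm (f r - f (t * real k / real n)) \<le> e"
    if "n \<ge> Suc N" "k < n" "r \<in> {t * real k / real n..t * real (Suc k) / real n}" for n k r
  proof -
    have n: "real n > t / d" "n > 0" using N that by linarith+
    have *: "t * real (Suc k) / real n \<le> t"
      using that t n by (simp add: divide_le_eq mult_left_mono)
    have **: "t * real (Suc k) / real n - t * real k / real n = t / real n"
      by (simp add: diff_divide_distrib[symmetric] algebra_simps)
    have "t / real n < d" using n d by (simp add: field_simps)
    moreover have "0 \<le> t * real k / real n" using t by simp
    ultimately have "r \<in> {0..t}" "t * real k / real n \<in> {0..t}" "dist r (t * real k / real n) < d"
      using that * ** by (auto simp: dist_real_def)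
    then show ?thesis using d(2) by (fastforce simp: dist_norm)
  qed
  then show ?thesis using that by blast
qed

lemma integral_grid_cell:
  fixes f :: "real \<Rightarrow> 'a::banach"
  assumes f: "continuous_on {0..t} f" and t: "t \<ge> 0" and k: "k < n"
  shows "integral {0..t * real (Suc k) / real n} f =
    integral {0..t * real k / real n} f + integral {t * real k / real n..t * real (Suc k) / real n} f"
    and "{t * real k / real n..t * real (Suc k) / real n} \<subseteq> {0..t}"
proof -
  have le: "t * real (Suc k) / real n \<le> t"
    using k t by (simp add: divide_le_eq mult_left_mono)
  have ge: "0 \<le> t * real k / real n" using t by simp
  have mid: "t * real k / real n \<le> t * real (Suc k) / real n"
    using t by (intro divide_right_mono mult_left_mono) auto
  show "{t * real k / real n..t * real (Suc k) / real n} \<subseteq> {0..t}" using le ge by auto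
  have "f integrable_on {0..t * real (Suc k) / real n}"
    by (intro integrable_continuous_real continuous_on_subset[OF f]) (use le in auto)
  from Henstock_Kurzweil_Integration.integral_combine[OF ge mid this]
  show "integral {0..t * real (Suc k) / real n} f =
    integral {0..t * real k / real n} f + integral {t * real k / real n..t * real (Suc k) / real n} f"
    by simp
qed

lemma integral_deviation_le:
  fixes f :: "real \<Rightarrow> 'a::euclidean_space"
  assumes "continuous_on {a..b} f" "a \<le> b" "\<And>r. r \<in> {a..b} \<Longrightarrow> norm (f r - c) \<le> e"
  shows "norm (integral {a..b} f - (b - a) *\<^sub>R c) \<le> e * (b - a)"
proof -
  have "integral {a..b} f - (b - a) *\<^sub>R c = integral {a..b} (\<lambda>r. f r - c)"
    using assms by (subst Henstock_Kurzweil_Integration.integral_diff)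
      (auto intro: integrable_continuous_real)
  also have "norm \<dots> \<le> e * (b - a)"
    using assms by (intro integral_bound) (auto intro!: continuous_intros)
  finally show ?thesis .
qed

text \<open>Serves mainly as a measurability device: time integrals along a path become pointwise
  limits of finite sums. The cell errors are accumulated by induction over the number
  \<open>j\<close> of cells already covered.\<close>

lemma riemann_sum_tendsto:
  fixes f :: "real \<Rightarrow> 'a::euclidean_space"
  assumes f: "continuous_on {0..t} f" and t: "t \<ge> 0"
  shows "(\<lambda>n. \<Sum>k<n. (t / real n) *\<^sub>R f (t * real k / real n)) \<longlonglongrightarrow> integral {0..t} f"
proof (rule LIMSEQ_I)
  fix e :: real assume "e > 0"
  define e' where "e' = e / (2 * (t + 1))"
  have e': "e' > 0" using \<open>e > 0\<close> t unfolding e'_def by (intro divide_pos_pos) auto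
  obtain N where N: "\<And>n k r. \<lbrakk>n \<ge> N; k < n; r \<in> {t * real k / real n..t * real (Suc k) / real n}\<rbrakk>
     \<Longrightarrow> norm (f r - f (t * real k / real n)) \<le> e'"
    using uniform_grid_modulus[OF f t e'] by metis
  \<comment> \<open>\<open>Suc N\<close> makes \<open>n\<close> positive, so that the last grid
    point \<open>t * real n / real n\<close> is \<open>t\<close>.\<close>
  have "norm ((\<Sum>k<n. (t / real n) *\<^sub>R f (t * real k / real n)) - integral {0..t} f) < e" if n: "n \<ge> Suc N" for n
  proof -
    have "norm ((\<Sum>k<j. (t / real n) *\<^sub>R f (t * real k / real n)) - integral {0..t * real j / real n} f)
        \<le> real j * (e' * (t / real n))" if "j \<le> n" for j
      using that
    proof (induction j)
      case (Suc j)
      let ?a = "t * real j / real n" and ?b = "t * real (Suc j) / real n"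
      have ab: "?b - ?a = t / real n" by (simp add: diff_divide_distrib[symmetric] algebra_simps)
      have c: "norm (integral {?a..?b} f - (?b - ?a) *\<^sub>R f ?a) \<le> e' * (?b - ?a)"
        using Suc.prems integral_grid_cell(2)[OF f t, of j n] n t
        by (intro integral_deviation_le N continuous_on_subset[OF f])
           (auto intro!: divide_right_mono mult_left_mono)
      have "norm ((\<Sum>k<Suc j. (t / real n) *\<^sub>R f (t * real k / real n)) - integral {0..?b} f)
        = norm (((\<Sum>k<j. (t / real n) *\<^sub>R f (t * real k / real n)) - integral {0..?a} f)
           - (integral {?a..?b} f - (?b - ?a) *\<^sub>R f ?a))"
        using integral_grid_cell(1)[OF f t, of j n] Suc.prems by (simp add: ab algebra_simps del: of_nat_Suc)
      also have "\<dots> \<le> real j * (e' * (t / real n)) + e' * (t / real n)"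
        using norm_triangle_ineq4 Suc.IH Suc.prems c unfolding ab
        by (smt (verit, best) Suc_leD)
      finally show ?case by (simp add: algebra_simps add_divide_distrib)
    qed simp
    from this[of n] have "norm ((\<Sum>k<n. (t / real n) *\<^sub>R f (t * real k / real n)) - integral {0..t} f) \<le> e' * t"
      using n by simp
    also have "\<dots> < e"
    proof -
      have "e' * t < e' * (2 * (t + 1))" using e' t by (intro mult_strict_left_mono) auto
      also have "\<dots> = e" using t unfolding e'_def by (intro nonzero_eq_divide_eq[THEN iffD1]) auto
      finally show ?thesis .
    qed
    finally show ?thesis .
  qed
  then show "\<exists>no. \<forall>n\<ge>no. norm ((\<Sum>k<n. (t / real n) *\<^sub>R f (t * real k / real n)) - integral {0..t} f) < e"
    by blast
qed

text \<open>Here \<open>n\<close> is the number of steps on \<open>[0, t]\<close> and the last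
  argument is the current step. The forcing enters only through its values at grid points, so an
  iterate depends on finitely many values of the driving path.\<close>

fun euler :: "('a \<Rightarrow> 'a) \<Rightarrow> (real \<Rightarrow> 'a) \<Rightarrow> 'a \<Rightarrow> real \<Rightarrow> nat \<Rightarrow> nat \<Rightarrow> 'a::real_vector" where
  "euler F w x t n 0 = x"
| "euler F w x t n (Suc k) = euler F w x t n k + (w (t * real (Suc k) / real n) - w (t * real k / real n))
     + (t / real n) *\<^sub>R F (euler F w x t n k)"

text \<open>The forcing is additive and cancels exactly between scheme and solution. Each step
  therefore multiplies the old error by at most \<open>1 + L * h\<close> and adds only the
  oscillation of the drift along \<open>Y\<close> within one cell; this is a discrete Gronwall
  argument.\<close>

lemma euler_tendsto:
  fixes Y :: "real \<Rightarrow> 'a::euclidean_space"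
  assumes F: "L-lipschitz_on UNIV F" and Y: "continuous_on {0..t} Y" and t: "t \<ge> 0"
    and eq: "\<And>r. r \<in> {0..t} \<Longrightarrow> Y r = x + w r + integral {0..r} (\<lambda>s. F (Y s))" and w0: "w 0 = 0"
  shows "(\<lambda>n. euler F w x t n n) \<longlonglongrightarrow> Y t"
proof (rule LIMSEQ_I)
  fix e :: real assume "e > 0"
  have L: "L \<ge> 0" using F by (rule lipschitz_on_nonneg)
  \<comment> \<open>The final error is at most \<open>e' * (K - 1)\<close>; the added 1 keeps
    \<open>K\<close> positive when \<open>L * t = 0\<close>.\<close>
  define K where "K = exp (L * t) * L * t + 1"
  have K: "K > 0" using L t by (simp add: K_def add_nonneg_pos)
  define e' where "e' = e / K / 2"
  have e': "e' > 0" using \<open>e > 0\<close> K by (simp add: e'_def)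
  obtain N where N: "\<And>n k r. \<lbrakk>n \<ge> N; k < n; r \<in> {t * real k / real n..t * real (Suc k) / real n}\<rbrakk>
     \<Longrightarrow> norm (Y r - Y (t * real k / real n)) \<le> e'"
    using uniform_grid_modulus[OF Y t e'] by metis
  have cF: "continuous_on {0..t} (\<lambda>s. F (Y s))"
    by (rule continuous_on_compose2[OF lipschitz_on_continuous_on[OF F] Y]) auto
  have "norm (euler F w x t n n - Y t) < e" if n: "n \<ge> Suc N" for n
  proof -
    \<comment> \<open>A cruder form than the geometric sum: all \<open>j\<close> local errors are
      charged with the largest power. It survives the induction because the powers of
      \<open>1 + L * h\<close> are at least 1.\<close>
    have "norm (euler F w x t n j - Y (t * real j / real n))
        \<le> (1 + L * (t / real n)) ^ j * (real j * (L * e' * (t / real n)))" if "j \<le> n" for j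
      using that
    proof (induction j)
      case 0
      then show ?case using eq[of 0] w0 t by simp
    next
      case (Suc j)
      let ?a = "t * real j / real n" and ?b = "t * real (Suc j) / real n" and ?h = "t / real n"
      let ?E = "euler F w x t n j" and ?q = "1 + L * (t / real n)" and ?c = "L * e' * (t / real n)"
      have ab: "?b - ?a = ?h" by (simp add: diff_divide_distrib[symmetric] algebra_simps)
      have sub: "{?a..?b} \<subseteq> {0..t}" using integral_grid_cell(2)[OF Y t, of j n] Suc.prems by simp
      have aleb: "?a \<le> ?b" using t by (auto intro!: divide_right_mono mult_left_mono)
      have c: "norm (integral {?a..?b} (\<lambda>s. F (Y s)) - (?b - ?a) *\<^sub>R F (Y ?a)) \<le> L * e' * (?b - ?a)"
      proof (intro integral_deviation_le continuous_on_subset[OF cF] sub aleb)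
        fix r assume "r \<in> {?a..?b}"
        then have "norm (Y r - Y ?a) \<le> e'" using N[of n j r] n Suc.prems by simp
        then have "L * norm (Y r - Y ?a) \<le> L * e'" using L by (intro mult_left_mono) auto
        then show "norm (F (Y r) - F (Y ?a)) \<le> L * e'"
          using lipschitz_onD[OF F, of "Y r" "Y ?a"] by (simp add: dist_norm)
      qed
      have Yb: "Y ?b = Y ?a + (w ?b - w ?a) + integral {?a..?b} (\<lambda>s. F (Y s))"
        using eq[of ?a] eq[of ?b] sub aleb integral_grid_cell(1)[OF cF t, of j n] Suc.prems
        by (simp del: of_nat_Suc)
      have F1: "norm (F ?E - F (Y ?a)) \<le> L * norm (?E - Y ?a)"
        using lipschitz_onD[OF F, of ?E "Y ?a"] by (simp add: dist_norm)
      have h0: "0 \<le> ?h" using t by simp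
      have dE: "euler F w x t n (Suc j) - Y ?b = (?E - Y ?a) + ?h *\<^sub>R (F ?E - F (Y ?a))
         - (integral {?a..?b} (\<lambda>s. F (Y s)) - (?b - ?a) *\<^sub>R F (Y ?a))"
        unfolding Yb ab by (simp add: algebra_simps del: of_nat_Suc)
      have "norm (euler F w x t n (Suc j) - Y ?b) \<le> norm (?E - Y ?a) + norm (?h *\<^sub>R (F ?E - F (Y ?a)))
          + norm (integral {?a..?b} (\<lambda>s. F (Y s)) - (?b - ?a) *\<^sub>R F (Y ?a))"
        unfolding dE by (rule order.trans[OF norm_triangle_ineq4 add_right_mono[OF norm_triangle_ineq]])
      also have "\<dots> \<le> norm (?E - Y ?a) + ?h * norm (F ?E - F (Y ?a)) + ?c"
        using c t unfolding ab by simp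
      also have "\<dots> \<le> norm (?E - Y ?a) + ?h * (L * norm (?E - Y ?a)) + ?c"
        using mult_left_mono[OF F1 h0] by simp
      also have "\<dots> = ?q * norm (?E - Y ?a) + ?c" by (simp add: algebra_simps)
      also have "\<dots> \<le> ?q * (?q ^ j * (real j * ?c)) + ?q ^ Suc j * ?c"
      proof (intro add_mono mult_left_mono)
        show "norm (?E - Y ?a) \<le> ?q ^ j * (real j * ?c)" using Suc by simp
        have "0 \<le> L * ?h" using L h0 by (rule mult_nonneg_nonneg)
        then show "0 \<le> ?q" by linarith
        have "1 \<le> ?q ^ Suc j" using \<open>0 \<le> L * ?h\<close> by (intro one_le_power) linarith
        moreover have "0 \<le> ?c" using L h0 e' by (intro mult_nonneg_nonneg) auto
        ultimately show "?c \<le> ?q ^ Suc j * ?c" by (metis mult_le_cancel_right1 linorder_not_less)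
      qed
      also have "\<dots> = ?q ^ Suc j * (real (Suc j) * ?c)"
      proof -
        have "q * (q ^ j * (real j * c)) + q ^ Suc j * c = q ^ Suc j * (real (Suc j) * c)" for q c :: real
          by (simp add: algebra_simps)
        then show ?thesis .
      qed
      finally show ?case by simp
    qed
    from this[of n] have "norm (euler F w x t n n - Y t) \<le> (1 + L * t / real n) ^ n * (L * e' * t)"
      using n by simp
    also have "\<dots> \<le> exp (L * t) * (L * e' * t)"
    proof (intro mult_right_mono mult_nonneg_nonneg)
      have "- real n \<le> L * t" using mult_nonneg_nonneg[OF L t] by linarith
      then show "(1 + L * t / real n) ^ n \<le> exp (L * t)"
        using exp_ge_one_plus_x_over_n_power_n[of n "L * t"] n by simp
    qed (use L t e' in auto)
    also have "\<dots> = e' * (K - 1)" by (simp add: K_def algebra_simps)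
    also have "\<dots> < e' * (2 * K)" using e' K by (intro mult_strict_left_mono) auto
    also have "\<dots> = e" using K by (simp add: e'_def)
    finally show ?thesis .
  qed
  then show "\<exists>no. \<forall>n\<ge>no. norm (euler F w x t n n - Y t) < e" by blast
qed

subsection \<open>Liouville's formula for flows with additive forcing\<close>

text \<open>Difference quotients along a sequence are the form in which derivatives can be passed
  through an integral by dominated convergence.\<close>

lemma directional_derivative_sequentially:
  fixes f :: "'a::real_normed_vector \<Rightarrow> 'b::real_normed_vector"
  assumes f: "(f has_derivative f') (at x)" and e: "e \<longlonglongrightarrow> 0" "\<And>k. e k \<noteq> (0::real)"
  shows "(\<lambda>k. (f (x + e k *\<^sub>R v) - f x) /\<^sub>R e k) \<longlonglongrightarrow> f' v"
proof -
  have "((\<lambda>s. x + s *\<^sub>R v) has_derivative (\<lambda>s. s *\<^sub>R v)) (at 0)"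
    by (auto intro!: derivative_eq_intros)
  from diff_chain_at[OF this, of f f'] f
  have "((\<lambda>s. f (x + s *\<^sub>R v)) has_vector_derivative f' v) (at 0)"
    by (simp add: o_def has_vector_derivative_def linear_cmul[OF has_derivative_linear])
  then have "((\<lambda>h. (f (x + h *\<^sub>R v) - f x - h *\<^sub>R f' v) /\<^sub>R \<bar>h\<bar>) \<longlongrightarrow> 0) (at 0)"
    by (auto simp: has_vector_derivative_def has_derivative_at_within)
  then have "((\<lambda>h. norm ((f (x + h *\<^sub>R v) - f x - h *\<^sub>R f' v) /\<^sub>R \<bar>h\<bar>)) \<longlongrightarrow> 0) (at 0)"
    by (rule tendsto_norm_zero)
  moreover have "\<forall>\<^sub>F h in at 0. norm ((f (x + h *\<^sub>R v) - f x - h *\<^sub>R f' v) /\<^sub>R \<bar>h\<bar>)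
      = norm ((f (x + h *\<^sub>R v) - f x) /\<^sub>R h - f' v)"
    unfolding eventually_at_filter
  proof (intro always_eventually allI impI)
    fix h :: real assume "h \<noteq> 0"
    then have "(f (x + h *\<^sub>R v) - f x) /\<^sub>R h - f' v = (f (x + h *\<^sub>R v) - f x - h *\<^sub>R f' v) /\<^sub>R h"
      by (simp add: scaleR_diff_right)
    then show "norm ((f (x + h *\<^sub>R v) - f x - h *\<^sub>R f' v) /\<^sub>R \<bar>h\<bar>)
      = norm ((f (x + h *\<^sub>R v) - f x) /\<^sub>R h - f' v)"
      by simp
  qed
  ultimately have "((\<lambda>h. norm ((f (x + h *\<^sub>R v) - f x) /\<^sub>R h - f' v)) \<longlongrightarrow> 0) (at 0)"
    by (simp cong: tendsto_cong)
  then have "((\<lambda>h. (f (x + h *\<^sub>R v) - f x) /\<^sub>R h) \<longlongrightarrow> f' v) (at 0)"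
    by (simp add: LIM_zero_iff tendsto_norm_zero_iff)
  moreover have "filterlim e (at 0) sequentially"
    using e by (auto simp: filterlim_at)
  ultimately show ?thesis by (rule filterlim_compose)
qed

text \<open>In the Leibniz expansion a permutation other than the identity moves at least two
  indices. After one factor has been differentiated, an off-diagonal entry of the identity matrix is
  still left and kills the term, so only the diagonal product contributes.\<close>

lemma det_has_derivative_at_identity:
  fixes W :: "real \<Rightarrow> real^'n^'n"
  assumes W: "\<And>i j. ((\<lambda>r. W r $ i $ j) has_real_derivative D $ i $ j) (at s within S)"
    and 1: "W s = mat 1"
  shows "((\<lambda>r. det (W r)) has_real_derivative trace D) (at s within S)"
proof -
  let ?P = "{p. p permutes (UNIV :: 'n set)}"
  let ?d = "\<lambda>p. of_int (sign p) * (\<Sum>i\<in>UNIV. D $ i $ p i * (\<Prod>j\<in>UNIV - {i}. W s $ j $ p j))"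
  have *: "((\<lambda>r. \<Prod>i\<in>UNIV. W r $ i $ p i) has_real_derivative
      (\<Sum>i\<in>UNIV. D $ i $ p i * (\<Prod>j\<in>UNIV - {i}. W s $ j $ p j))) (at s within S)" for p :: "'n \<Rightarrow> 'n"
  proof -
    have "((\<lambda>r. \<Prod>i\<in>UNIV. W r $ i $ p i) has_derivative
      (\<lambda>y. \<Sum>i\<in>UNIV. (D $ i $ p i * y) * (\<Prod>j\<in>UNIV - {i}. W s $ j $ p j))) (at s within S)"
      using W by (intro has_derivative_prod) (simp add: has_field_derivative_def)
    then show ?thesis
      unfolding has_field_derivative_def
      by (rule has_derivative_eq_rhs) (auto simp: sum_distrib_left mult_ac intro!: ext sum.cong)
  qed
  have "((\<lambda>r. det (W r)) has_real_derivative (\<Sum>p\<in>?P. ?d p)) (at s within S)"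
    unfolding det_def by (intro DERIV_sum DERIV_cmult *)
  also have "(\<Sum>p\<in>?P. ?d p) = (\<Sum>p\<in>{id}. ?d p)"
  proof (rule sum.mono_neutral_right)
    show "\<forall>p\<in>?P - {id}. ?d p = 0"
    proof
      fix p assume p: "p \<in> ?P - {id}"
      have *: "(\<Prod>j\<in>UNIV - {i}. W s $ j $ p j) = 0" for i
      proof -
        have "\<exists>j. j \<noteq> i \<and> p j \<noteq> j"
        proof (rule ccontr)
          assume a: "\<nexists>j. j \<noteq> i \<and> p j \<noteq> j"
          have inj: "inj p" using p permutes_inj by blast
          have "p i = i" using a injD[OF inj, of "p i" i] by metis
          then have "p = id" using a by fastforce
          then show False using p by simp
        qed
        then show ?thesis by (intro prod_zero) (force simp: 1 mat_def)+
      qed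
      show "?d p = 0" by (simp only: * mult_zero_right sum.neutral_const)
    qed
  qed (auto simp: permutes_id finite_permutations)
  also have "\<dots> = trace D" by (simp add: trace_def 1 mat_def sign_id)
  finally show ?thesis .
qed

text \<open>One frozen noise path \<open>w\<close>. Differentiability is purely spatial, separately
  at each time; how the spatial derivative evolves in time is a consequence still to be
  proved.\<close>

locale additive_flow =
  fixes m :: "real^'n \<Rightarrow> real^'n" and Dm :: "real^'n \<Rightarrow> (real^'n) \<Rightarrow>\<^sub>L (real^'n)"
    and w :: "real \<Rightarrow> real^'n" and X :: "real \<Rightarrow> real^'n \<Rightarrow> real^'n"
  assumes Dm: "\<And>x. (m has_derivative blinfun_apply (Dm x)) (at x)"
    and cont_Dm: "continuous_on UNIV Dm"
    and cont_X: "\<And>x. continuous_on {0..} (\<lambda>t. X t x)"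
    and X_eq: "\<And>t x. t \<ge> 0 \<Longrightarrow> X t x = x + w t + integral {0..t} (\<lambda>s. m (X s x))"
    and X_bij: "\<And>t. t \<ge> 0 \<Longrightarrow> bij (X t)"
    and X_diff: "\<And>t x. t \<ge> 0 \<Longrightarrow> X t differentiable (at x)"
    and X_inv_diff: "\<And>t x. t \<ge> 0 \<Longrightarrow> inv (X t) differentiable (at x)"
begin

definition divm :: "real^'n \<Rightarrow> real" where
  "divm x = (\<Sum>i\<in>UNIV. Dm x (axis i 1) $ i)"

lemma cont_m: "continuous_on S m"
  using Dm by (meson continuous_at_imp_continuous_on has_derivative_continuous)

lemma cont_divm: "continuous_on S divm"
  unfolding divm_def using continuous_on_subset[OF cont_Dm, of S]
  by (auto intro!: continuous_intros continuous_on_component)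

lemma cont_X_Icc: "a \<ge> 0 \<Longrightarrow> continuous_on {a..t} (\<lambda>s. X s x)"
  by (rule continuous_on_subset[OF cont_X]) auto

lemma cont_m_X: "a \<ge> 0 \<Longrightarrow> continuous_on {a..t} (\<lambda>s. m (X s x))"
  by (rule continuous_on_compose2[OF cont_m cont_X_Icc]) auto

lemma cont_divm_X: "a \<ge> 0 \<Longrightarrow> continuous_on {a..t} (\<lambda>s. divm (X s x))"
  by (rule continuous_on_compose2[OF cont_divm cont_X_Icc]) auto

lemma m_lipschitz_on_cball: obtains L where "L-lipschitz_on (cball 0 R) m"
proof -
  have "bounded (Dm ` cball 0 R)"
    by (intro compact_imp_bounded compact_continuous_image continuous_on_subset[OF cont_Dm]) auto
  then obtain B where B: "\<And>x. x \<in> cball 0 R \<Longrightarrow> norm (Dm x) \<le> B" unfolding bounded_iff by blast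
  have "(max B 0)-lipschitz_on (cball 0 R) m"
  proof (rule lipschitz_onI)
    fix x y :: "real^'n" assume xy: "x \<in> cball 0 R" "y \<in> cball 0 R"
    show "dist (m x) (m y) \<le> max B 0 * dist x y"
      unfolding dist_norm
      by (rule differentiable_bound[where S="cball 0 R" and f'="\<lambda>x. blinfun_apply (Dm x)"])
        (use Dm B xy in \<open>auto simp: norm_blinfun.rep_eq[symmetric] le_max_iff_disj intro: has_derivative_at_withinI\<close>)
  qed simp
  then show ?thesis using that by blast
qed

lemma path_bounded: obtains C where "\<And>r. r \<in> {0..t} \<Longrightarrow> norm (X r x) \<le> C"
proof -
  have "bounded ((\<lambda>s. X s x) ` {0..t})"
    by (intro compact_imp_bounded compact_continuous_image cont_X_Icc) auto
  then show ?thesis using that unfolding bounded_iff by blast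
qed

text \<open>A continuation argument. The Lipschitz constant is valid only near the reference path,
  so Gronwall applies as long as the two trajectories are within distance 1; starting close enough,
  the Gronwall bound itself stays below 1 and the distance 1 is never reached.\<close>

lemma flow_lipschitz_locally:
  assumes t: "t \<ge> 0"
  obtains L d where "L \<ge> 0" "d > 0"
    "\<And>x' r. norm (x' - x) < d \<Longrightarrow> r \<in> {0..t} \<Longrightarrow>
       norm (X r x' - X r x) \<le> norm (x' - x) * exp (L * r) \<and>
       norm (m (X r x') - m (X r x)) \<le> L * norm (X r x' - X r x)"
proof -
  obtain C where C: "\<And>r. r \<in> {0..t} \<Longrightarrow> norm (X r x) \<le> C" using path_bounded by blast
  \<comment> \<open>The radius \<open>C + 1\<close> leaves room for all trajectories within distance
    1 of the reference path.\<close>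
  obtain L where L: "L-lipschitz_on (cball 0 (C + 1)) m" using m_lipschitz_on_cball by blast
  have L0: "L \<ge> 0" using L lipschitz_on_nonneg by blast
  have lip: "norm (m (X r x') - m (X r x)) \<le> L * norm (X r x' - X r x)"
    if "r \<in> {0..t}" "norm (X r x' - X r x) \<le> 1" for r x'
  proof -
    have "norm (X r x') \<le> C + 1"
      using C[OF that(1)] that(2) norm_triangle_sub[of "X r x'" "X r x"] by linarith
    then show ?thesis using lipschitz_onD[OF L, of "X r x'" "X r x"] C[OF that(1)] by (auto simp: dist_norm)
  qed
  have A: "norm (X \<tau> x' - X \<tau> x) \<le> norm (x' - x) * exp (L * \<tau>)"
    if \<tau>: "\<tau> \<in> {0..t}" and le: "\<And>r. r \<in> {0..\<tau>} \<Longrightarrow> norm (X r x' - X r x) \<le> 1" for \<tau> x'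
  proof (rule gronwall[where T=\<tau>])
    show cont: "continuous_on {0..\<tau>} (\<lambda>r. norm (X r x' - X r x))"
      by (intro continuous_intros cont_X_Icc) auto
    fix r assume r: "r \<in> {0..\<tau>}"
    have "X r x' - X r x = (x' - x) + integral {0..r} (\<lambda>s. m (X s x') - m (X s x))"
      using r by (simp add: X_eq[of r] Henstock_Kurzweil_Integration.integral_diff
          integrable_continuous_real cont_m_X)
    then have "norm (X r x' - X r x) \<le> norm (x' - x) + norm (integral {0..r} (\<lambda>s. m (X s x') - m (X s x)))"
      by (simp add: norm_triangle_ineq)
    also have "norm (integral {0..r} (\<lambda>s. m (X s x') - m (X s x))) \<le> integral {0..r} (\<lambda>s. L * norm (X s x' - X s x))"
    proof (rule Henstock_Kurzweil_Integration.integral_norm_bound_integral)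
      show "(\<lambda>s. m (X s x') - m (X s x)) integrable_on {0..r}"
        by (intro integrable_continuous_real continuous_intros cont_m_X) auto
      show "(\<lambda>s. L * norm (X s x' - X s x)) integrable_on {0..r}"
        by (intro integrable_continuous_real continuous_intros cont_X_Icc) auto
      show "norm (m (X s x') - m (X s x)) \<le> L * norm (X s x' - X s x)" if "s \<in> {0..r}" for s
        using that r \<tau> le by (intro lip) auto
    qed
    finally show "norm (X r x' - X r x) \<le> norm (x' - x) + L * integral {0..r} (\<lambda>s. norm (X s x' - X s x))"
      by simp
  qed (use L0 \<tau> in auto)
  \<comment> \<open>Chosen so that an initial distance below \<open>d\<close>, multiplied by the
    Gronwall factor up to time \<open>t\<close>, remains below 1.\<close>
  define d where "d = exp (- (L * t))"
  have d1: "d \<le> 1" using L0 t by (simp add: d_def)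
  have B: "norm (X r x' - X r x) \<le> 1" if x': "norm (x' - x) < d" and r: "r \<in> {0..t}" for r x'
  proof (rule ccontr)
    let ?f = "\<lambda>r. norm (X r x' - X r x)"
    assume gt: "\<not> ?f r \<le> 1"
    have f0: "?f 0 < 1" using x' d1 by (simp add: X_eq)
    have cont: "continuous_on {0..t} ?f" by (intro continuous_intros cont_X_Icc) auto
    \<comment> \<open>The times at which the distance equals 1. The infimum belongs to the closed
      set \<open>S\<close> and is the first such time; up to it the local estimate applies and
      contradicts the value 1.\<close>
    define S where "S = {0..t} \<inter> ?f -` {1}"
    have "closed S" unfolding S_def by (intro continuous_closed_preimage cont) auto
    have cross: "\<exists>s\<in>S. s \<le> q" if q: "q \<in> {0..t}" "?f q \<ge> 1" for q
      using IVT'[of ?f 0 1 q] f0 q continuous_on_subset[OF cont, of "{0..q}"] by (auto simp: S_def)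
    have "S \<noteq> {}" using cross[of r] r gt by auto
    moreover have "bdd_below S" unfolding S_def by (auto intro!: bdd_belowI[of _ 0])
    ultimately have InfS: "Inf S \<in> S" using \<open>closed S\<close> closed_contains_Inf by blast
    have "?f q \<le> 1" if "q \<in> {0..Inf S}" for q
    proof (rule ccontr)
      assume gt: "\<not> ?f q \<le> 1"
      have "q \<in> {0..t}" using that InfS by (auto simp: S_def)
      then obtain s where s: "s \<in> S" "s \<le> q" using gt cross[of q] by auto
      then have "Inf S \<le> s" using \<open>bdd_below S\<close> by (simp add: cInf_lower)
      then have "q = Inf S" using that s by auto
      then show False using InfS gt by (auto simp: S_def)
    qed
    then have "?f (Inf S) \<le> norm (x' - x) * exp (L * Inf S)"
      using A[of "Inf S" x'] InfS by (auto simp: S_def)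
    also have "\<dots> \<le> norm (x' - x) * exp (L * t)"
      using InfS L0 by (auto simp: S_def intro!: mult_left_mono)
    also have "\<dots> < d * exp (L * t)" using x' by simp
    also have "\<dots> = 1" by (simp add: d_def exp_minus)
    finally show False using InfS by (simp add: S_def)
  qed
  show ?thesis
  proof (rule that[of L d])
    show "d > 0" by (simp add: d_def)
    show "norm (X r x' - X r x) \<le> norm (x' - x) * exp (L * r) \<and>
       norm (m (X r x') - m (X r x)) \<le> L * norm (X r x' - X r x)"
      if "norm (x' - x) < d" "r \<in> {0..t}" for x' r
      using A[of r x'] B[OF that(1)] lip[of r x'] that by auto
  qed (rule L0)
qed

lemma X_has_derivative:
  "t \<ge> 0 \<Longrightarrow> (X t has_derivative frechet_derivative (X t) (at x)) (at x)"
  using X_diff frechet_derivative_works by blast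

text \<open>The integral equation is differentiated through difference quotients in direction
  \<open>v\<close>; the local Lipschitz estimate supplies the dominating constant. Integrability is
  part of the claim because the time regularity of \<open>V\<close> is still unknown here.\<close>

lemma variational_equation:
  fixes x v :: "real^'n"
  defines "V \<equiv> \<lambda>s. frechet_derivative (X s) (at x) v"
  assumes t: "t \<ge> 0"
  shows "(\<lambda>r. Dm (X r x) (V r)) integrable_on {0..t}"
    and "V t = v + integral {0..t} (\<lambda>r. Dm (X r x) (V r))"
proof -
  obtain L d where L: "L \<ge> 0" and d: "d > 0" and est:
    "\<And>x' r. norm (x' - x) < d \<Longrightarrow> r \<in> {0..t} \<Longrightarrow>
       norm (X r x' - X r x) \<le> norm (x' - x) * exp (L * r) \<and>
       norm (m (X r x') - m (X r x)) \<le> L * norm (X r x' - X r x)"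
    using flow_lipschitz_locally[OF t, of x] by metis
  \<comment> \<open>Makes every shifted starting point \<open>x + e k *\<^sub>R v\<close> lie within
    distance \<open>d\<close> of \<open>x\<close>; the 1 in the denominator covers
    \<open>v = 0\<close>.\<close>
  define c where "c = d / 2 / (norm v + 1)"
  define e where "e k = c * inverse (real (Suc k))" for k
  have nv: "norm v + 1 > 0" by (simp add: add_nonneg_pos)
  then have c0: "c > 0" using d by (simp add: c_def)
  then have e0: "e k > 0" for k by (simp add: e_def)
  have elim: "e \<longlonglongrightarrow> 0"
    unfolding e_def by (rule tendsto_mult_right_zero[OF LIMSEQ_inverse_real_of_nat])
  have ev: "e k * norm v < d" for k
  proof -
    have "e k \<le> c * 1" unfolding e_def using c0 by (intro mult_left_mono) (auto simp: inverse_le_1_iff)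
    then have "e k * norm v \<le> c * norm v" by (intro mult_right_mono) auto
    also have "\<dots> \<le> c * (norm v + 1)" using c0 by (intro mult_left_mono) auto
    also have "\<dots> = d / 2" unfolding c_def
      by (intro nonzero_eq_divide_eq[THEN iffD1]) (use nv in auto)
    finally show ?thesis using d by linarith
  qed
  define f where "f k r = (m (X r (x + e k *\<^sub>R v)) - m (X r x)) /\<^sub>R e k" for k r
  have f_int: "f k integrable_on {0..t}" for k
    unfolding f_def by (intro integrable_continuous_real continuous_intros cont_m_X) auto
  have f_le: "norm (f k r) \<le> L * (norm v * exp (L * t))" if "r \<in> {0..t}" for k r
  proof -
    have "norm ((x + e k *\<^sub>R v) - x) < d" using ev e0[of k] by (simp add: abs_of_pos)
    note E = est[OF this that]
    have "norm (m (X r (x + e k *\<^sub>R v)) - m (X r x)) \<le> L * (norm (e k *\<^sub>R v) * exp (L * r))"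
      using E L by (smt (verit, best) add_diff_cancel_left' mult_left_mono)
    also have "\<dots> \<le> L * (norm (e k *\<^sub>R v) * exp (L * t))"
      using L that by (intro mult_left_mono) (auto intro!: mult_left_mono)
    finally show ?thesis using e0[of k]
      by (simp add: f_def divide_inverse[symmetric] pos_divide_le_eq mult_ac abs_of_pos flip: divide_inverse_commute)
  qed
  have f_lim: "(\<lambda>k. f k r) \<longlonglongrightarrow> Dm (X r x) (V r)" if "r \<in> {0..t}" for r
  proof -
    have r: "r \<ge> 0" using that by simp
    have "((\<lambda>y. m (X r y)) has_derivative (\<lambda>v. Dm (X r x) (frechet_derivative (X r) (at x) v))) (at x)"
      using diff_chain_at[OF X_has_derivative[OF r, of x] Dm] by (simp add: o_def)
    from directional_derivative_sequentially[OF this elim, of v] e0 show ?thesis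
      by (simp add: f_def V_def less_imp_neq[symmetric])
  qed
  show "(\<lambda>r. Dm (X r x) (V r)) integrable_on {0..t}"
    by (rule dominated_convergence(1)[OF f_int _ f_le f_lim]) auto
  have 1: "(\<lambda>k. integral {0..t} (f k)) \<longlonglongrightarrow> integral {0..t} (\<lambda>r. Dm (X r x) (V r))"
    by (rule dominated_convergence(2)[OF f_int _ f_le f_lim]) auto
  \<comment> \<open>The forcing does not depend on the starting point and drops out of the
    difference.\<close>
  have 2: "(X t (x + e k *\<^sub>R v) - X t x) /\<^sub>R e k = v + integral {0..t} (f k)" for k
  proof -
    have "integral {0..t} (f k) = (integral {0..t} (\<lambda>r. m (X r (x + e k *\<^sub>R v))) - integral {0..t} (\<lambda>r. m (X r x))) /\<^sub>R e k"
      unfolding f_def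
      by (subst Henstock_Kurzweil_Integration.integral_diff[symmetric])
        (auto intro!: integrable_continuous_real cont_m_X)
    then show ?thesis using t e0[of k] by (simp add: X_eq[OF t] algebra_simps)
  qed
  have 3: "(\<lambda>k. v + integral {0..t} (f k)) \<longlonglongrightarrow> V t"
    using directional_derivative_sequentially[OF X_has_derivative[OF t, of x] elim, of v] e0
    by (simp add: 2 V_def less_imp_neq[symmetric])
  have 4: "(\<lambda>k. v + integral {0..t} (f k)) \<longlonglongrightarrow> v + integral {0..t} (\<lambda>r. Dm (X r x) (V r))"
    by (intro tendsto_intros 1)
  show "V t = v + integral {0..t} (\<lambda>r. Dm (X r x) (V r))"
    using LIMSEQ_unique[OF 3 4] .
qed

text \<open>Regularity is bootstrapped: as an indefinite integral \<open>V\<close> is continuous,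
  hence so is the integrand, hence the fundamental theorem of calculus gives a pointwise
  derivative.\<close>

lemma flow_derivative_has_vector_derivative:
  fixes x v :: "real^'n"
  defines "V \<equiv> \<lambda>s. frechet_derivative (X s) (at x) v"
  assumes s: "s \<in> {0..t}"
  shows "(V has_vector_derivative Dm (X s x) (V s)) (at s within {0..t})"
proof -
  have t: "t \<ge> 0" using s by simp
  let ?g = "\<lambda>r. Dm (X r x) (V r)"
  have V_eq: "V r = v + integral {0..r} ?g" if "r \<in> {0..t}" for r
    using variational_equation(2)[of r x v] that unfolding V_def by simp
  have "continuous_on {0..t} (\<lambda>r. v + integral {0..r} ?g)"
    using variational_equation(1)[OF t, of x v] unfolding V_def
    by (intro continuous_intros indefinite_integral_continuous_1)
  then have "continuous_on {0..t} V" using V_eq by (subst continuous_on_cong[OF refl V_eq]) auto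
  moreover have "continuous_on {0..t} (\<lambda>r. Dm (X r x))"
    by (rule continuous_on_compose2[OF cont_Dm cont_X_Icc]) auto
  ultimately have "continuous_on {0..t} ?g" by (intro continuous_intros)
  from integral_has_vector_derivative[OF this s]
  have "((\<lambda>r. v + integral {0..r} ?g) has_vector_derivative ?g s) (at s within {0..t})"
    by (auto intro!: derivative_eq_intros)
  then show ?thesis
    by (rule has_vector_derivative_transform[OF s, rotated]) (simp add: V_eq)
qed

text \<open>The chain rule is applied to \<open>inv (X t)\<close> after \<open>X t\<close>, which is
  the identity. Invertibility is what lets the determinant be differentiated at the identity
  matrix.\<close>

lemma flow_derivative_left_inverse:
  assumes t: "t \<ge> 0"
  shows "\<exists>N. N ** matrix (frechet_derivative (X t) (at x)) = mat 1"
proof -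
  let ?V = "frechet_derivative (X t) (at x)"
  obtain G where G: "(inv (X t) has_derivative G) (at (X t x))"
    using X_inv_diff[OF t] unfolding differentiable_def by blast
  have "(inv (X t) \<circ> X t has_derivative G \<circ> ?V) (at x)"
    by (rule diff_chain_at[OF X_has_derivative[OF t] G])
  moreover have "inv (X t) \<circ> X t = id" using X_bij[OF t] by (simp add: bij_is_inj)
  ultimately have "G \<circ> ?V = id"
    by (metis has_derivative_id has_derivative_unique id_def)
  then have "matrix G ** matrix ?V = mat 1"
    using matrix_compose[of ?V G] X_has_derivative[OF t, of x] G has_derivative_linear
    by (metis matrix_id_mat_1)
  then show ?thesis by blast
qed

text \<open>For fixed \<open>s\<close> let \<open>N\<close> be the inverse of \<open>A s\<close>.
  The matrices \<open>A r ** N\<close> pass through the identity at \<open>r = s\<close> with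
  velocity the matrix of \<open>Dm (X s x)\<close>, so their determinant has derivative
  \<open>divm (X s x)\<close> there. Multiplying by \<open>det (A s)\<close> gives a linear scalar
  equation for the determinant, solved by an integrating factor with initial value 1.\<close>

theorem liouville:
  assumes t: "t \<ge> 0"
  shows "det (matrix (frechet_derivative (X t) (at x))) = exp (integral {0..t} (\<lambda>s. divm (X s x)))"
proof -
  define A where "A s = matrix (frechet_derivative (X s) (at x))" for s
  have dA: "((\<lambda>r. A r $ i $ j) has_real_derivative (matrix (Dm (X s x)) ** A s) $ i $ j) (at s within {0..t})"
    if s: "s \<in> {0..t}" for s i j
  proof -
    have lin: "linear (Dm (X s x))" by (rule bounded_linear.linear[OF blinfun.bounded_linear_right])
    have "((\<lambda>r. frechet_derivative (X r) (at x) (axis j 1) $ i) has_vector_derivative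
        (Dm (X s x) (frechet_derivative (X s) (at x) (axis j 1))) $ i) (at s within {0..t})"
      by (rule bounded_linear.has_vector_derivative[OF bounded_linear_vec_nth
            flow_derivative_has_vector_derivative[OF s]])
    moreover have "(Dm (X s x) (frechet_derivative (X s) (at x) (axis j 1))) $ i = (matrix (Dm (X s x)) ** A s) $ i $ j"
    proof -
      have "Dm (X s x) (frechet_derivative (X s) (at x) (axis j 1)) = matrix (Dm (X s x)) *v column j (A s)"
        using matrix_vector_mul(2)[OF lin] by (simp add: A_def column_def matrix_def vec_nth_inverse)
      then show ?thesis by (simp add: matrix_vector_mult_def matrix_matrix_mult_def column_def)
    qed
    ultimately show ?thesis
      by (simp add: A_def matrix_def has_real_derivative_iff_has_vector_derivative)
  qed
  have ddet: "((\<lambda>r. det (A r)) has_real_derivative divm (X s x) * det (A s)) (at s within {0..t})"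
    if s: "s \<in> {0..t}" for s
  proof -
    obtain N where "N ** A s = mat 1" using flow_derivative_left_inverse[of s x] s by (auto simp: A_def)
    then have N: "A s ** N = mat 1" using matrix_left_right_inverse by blast
    have detN: "det N * det (A s) = 1" using \<open>N ** A s = mat 1\<close> by (metis det_I det_mul)
    have "((\<lambda>r. (A r ** N) $ i $ j) has_real_derivative matrix (Dm (X s x)) $ i $ j) (at s within {0..t})" for i j
    proof -
      have "((\<lambda>r. \<Sum>k\<in>UNIV. A r $ i $ k * N $ k $ j) has_real_derivative
         (\<Sum>k\<in>UNIV. (matrix (Dm (X s x)) ** A s) $ i $ k * N $ k $ j)) (at s within {0..t})"
        by (intro DERIV_sum DERIV_cmult_right dA s)
      moreover have "(\<Sum>k\<in>UNIV. (matrix (Dm (X s x)) ** A s) $ i $ k * N $ k $ j) = (matrix (Dm (X s x)) ** A s ** N) $ i $ j"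
        by (simp add: matrix_matrix_mult_def)
      moreover have "matrix (Dm (X s x)) ** A s ** N = matrix (Dm (X s x))"
        by (simp add: N matrix_mul_assoc[symmetric])
      moreover have "(A r ** N) $ i $ j = (\<Sum>k\<in>UNIV. A r $ i $ k * N $ k $ j)" for r
        by (simp add: matrix_matrix_mult_def)
      ultimately show ?thesis by simp
    qed
    then have "((\<lambda>r. det (A r ** N)) has_real_derivative trace (matrix (Dm (X s x)))) (at s within {0..t})"
      by (rule det_has_derivative_at_identity) (rule N)
    then have "((\<lambda>r. det (A s) * det (A r ** N)) has_real_derivative det (A s) * trace (matrix (Dm (X s x)))) (at s within {0..t})"
      by (rule DERIV_cmult)
    moreover have "det (A s) * det (A r ** N) = det (A r)" for r
      using detN by (simp add: det_mul mult_ac)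
    moreover have "trace (matrix (Dm (X s x))) = divm (X s x)"
      by (simp add: trace_def divm_def matrix_def)
    ultimately show ?thesis by (simp add: mult.commute)
  qed
  let ?I = "\<lambda>s. integral {0..s} (\<lambda>r. divm (X r x))"
  have "((\<lambda>s. det (A s) * exp (- ?I s)) has_real_derivative 0) (at s within {0..t})"
    if s: "s \<in> {0..t}" for s
    by (rule derivative_eq_intros ddet[OF s] integral_has_real_derivative[OF cont_divm_X s] order.refl refl)+
      (simp add: algebra_simps)
  then obtain c where c: "\<And>s. s \<in> {0..t} \<Longrightarrow> det (A s) * exp (- ?I s) = c"
    using has_field_derivative_zero_constant[of "{0..t}" "\<lambda>s. det (A s) * exp (- ?I s)"] by auto
  have "frechet_derivative (X 0) (at x) v = v" for v
    using variational_equation(2)[of 0 x v] by simp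
  then have "A 0 = mat 1" by (simp add: A_def matrix_def mat_def vec_eq_iff axis_def)
  then have "c = 1" using c[of 0] t by simp
  then have "det (A t) * exp (- ?I t) = 1" using c[of t] t by simp
  then show ?thesis by (simp add: A_def exp_minus field_simps)
qed

end

subsection \<open>Change of variables along the flow\<close>

context additive_flow begin

lemma cont_X_space: "t \<ge> 0 \<Longrightarrow> continuous_on S (X t)"
  using X_diff by (meson continuous_at_imp_continuous_on differentiable_imp_continuous_within)

lemma flow_divergence_integral_measurable:
  assumes t: "t \<ge> 0"
  shows "(\<lambda>x. integral {0..t} (\<lambda>s. divm (X s x))) \<in> borel_measurable borel"
proof (rule borel_measurable_LIMSEQ_real)
  show "(\<lambda>n. \<Sum>k<n. (t / real n) *\<^sub>R divm (X (t * real k / real n) x)) \<longlonglongrightarrow> integral {0..t} (\<lambda>s. divm (X s x))" for x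
    by (rule riemann_sum_tendsto[OF cont_divm_X t]) simp
  show "(\<lambda>x. \<Sum>k<n. (t / real n) *\<^sub>R divm (X (t * real k / real n) x)) \<in> borel_measurable borel" for n
    by (intro borel_measurable_continuous_onI continuous_intros
        continuous_on_compose2[OF cont_divm cont_X_space]) (auto simp: t)
qed

end

text \<open>Bridge between the gauge integral in which the volume is stated and the nonnegative
  Lebesgue integral, in which images of measures can be handled.\<close>

lemma nn_integral_compact_continuous:
  fixes u :: "'a::euclidean_space \<Rightarrow> real"
  assumes K: "compact K" and u: "continuous_on K u" and pos: "\<And>x. x \<in> K \<Longrightarrow> u x \<ge> 0"
  shows "(\<integral>\<^sup>+x. ennreal (u x) * indicator K x \<partial>lborel) = ennreal (integral K u)"
proof -
  have "integrable lborel (\<lambda>x. indicator K x *\<^sub>R u x)"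
    using borel_integrable_compact[OF K u] by (simp add: indicator_def if_distrib cong: if_cong)
  then have "set_integrable lborel K u" by (simp add: set_integrable_def)
  then have "u integrable_on K" using set_borel_integral_eq_integral by blast
  from nn_integral_has_integral_lebesgue'[OF pos integrable_integral[OF this]] show ?thesis .
qed

lemma flow_change_of_variables_wellorder:
  fixes X :: "real \<Rightarrow> real^'n::{finite,wellorder} \<Rightarrow> real^'n::{finite,wellorder}"
  assumes flow: "additive_flow m Dm w X" and t: "t \<ge> 0" and A: "compact A"
    and u: "continuous_on UNIV u" and pos: "\<And>x. u x \<ge> 0"
  shows "ennreal (integral (X t ` A) u) =
    (\<integral>\<^sup>+x. ennreal (exp (integral {0..t} (\<lambda>s. additive_flow.divm Dm (X s x))) * u (X t x)) * indicator A x \<partial>lborel)"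
proof -
  interpret additive_flow m Dm w X by (rule flow)
  \<comment> \<open>The change of variables is stated for vector-valued integrands; a scalar is
    embedded in dimension one and read off again by its only component.\<close>
  let ?f = "\<lambda>y. vec (u y) :: real^1"
  let ?J = "\<lambda>x. exp (integral {0..t} (\<lambda>s. divm (X s x)))"
  let ?b = "integral (X t ` A) ?f"
  have K: "compact (X t ` A)" by (intro compact_continuous_image cont_X_space t A)
  have "continuous_on (X t ` A) ?f"
    unfolding vec_def by (intro continuous_on_vec_lambda continuous_on_subset[OF u]) auto
  from borel_integrable_compact[OF K this]
  have "integrable lborel (\<lambda>y. indicator (X t ` A) y *\<^sub>R ?f y)"
    by (simp add: indicator_def if_distrib cong: if_cong)
  then have "set_integrable lebesgue (X t ` A) ?f"
    by (simp add: set_integrable_def integrable_completion borel_measurable_integrable)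
  then have f_int: "?f absolutely_integrable_on (X t ` A)" .
  have der: "(X t has_derivative frechet_derivative (X t) (at x)) (at x within A)" for x
    by (rule has_derivative_at_withinI[OF X_has_derivative[OF t]])
  have "inj_on (X t) A" using X_bij[OF t] by (meson bij_is_inj inj_on_subset subset_UNIV)
  from has_absolute_integral_change_of_variables_compact[OF A der this, of ?f ?b] f_int
  have 1: "(\<lambda>x. \<bar>det (matrix (frechet_derivative (X t) (at x)))\<bar> *\<^sub>R ?f (X t x)) absolutely_integrable_on A"
    and 2: "integral A (\<lambda>x. \<bar>det (matrix (frechet_derivative (X t) (at x)))\<bar> *\<^sub>R ?f (X t x)) = ?b"
    by auto
  \<comment> \<open>Liouville's formula exhibits the determinant as an exponential, so the absolute
    value disappears.\<close>
  have 3: "((\<lambda>x. ?J x *\<^sub>R ?f (X t x)) has_integral ?b) A"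
    using 1 2 by (simp add: liouville[OF t] absolutely_integrable_on_def has_integral_integral)
  have 4: "?b $ 1 = integral (X t ` A) u"
    using f_int integral_component_eq_cart[of ?f "X t ` A" 1] by (simp add: absolutely_integrable_on_def)
  have "((\<lambda>x. (?J x *\<^sub>R ?f (X t x)) $ 1) has_integral ?b $ 1) A"
    using has_integral_linear[OF 3 bounded_linear_vec_nth[of 1]] by (simp add: o_def)
  then have "((\<lambda>x. ?J x * u (X t x)) has_integral integral (X t ` A) u) A" by (simp add: 4)
  from nn_integral_has_integral_lebesgue'[OF _ this] pos show ?thesis by simp
qed

text \<open>The change of variables theorem of the library needs a well-ordered index type; every finite
  index type is in bijection with one.\<close>

typedef (overloaded) ('a::finite) idx = "{..<CARD('a)}"
  by (rule exI[of _ 0]) simp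

instantiation idx :: (finite) linorder
begin
definition less_eq_idx where "x \<le> y \<longleftrightarrow> Rep_idx x \<le> Rep_idx y"
definition less_idx where "x < y \<longleftrightarrow> Rep_idx x < Rep_idx y"
instance by standard (auto simp: less_eq_idx_def less_idx_def Rep_idx_inject)
end

instance idx :: (finite) wellorder
proof
  fix P :: "'a idx \<Rightarrow> bool" and a
  assume step: "\<And>x. (\<And>y. y < x \<Longrightarrow> P y) \<Longrightarrow> P x"
  have "\<forall>a. Rep_idx a = k \<longrightarrow> P a" for k
    by (induction k rule: less_induct) (metis less_idx_def step)
  then show "P a" by blast
qed

instance idx :: (finite) finite
proof
  have "(UNIV :: 'a idx set) \<subseteq> Abs_idx ` {..<CARD('a)}"
    by (metis Rep_idx Rep_idx_inverse imageI subsetI)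
  then show "finite (UNIV :: 'a idx set)" by (rule finite_subset) simp
qed

lemma ex_bij_idx: "\<exists>f :: 'a::finite idx \<Rightarrow> 'a. bij f"
proof -
  have "bij_betw Rep_idx (UNIV :: 'a idx set) {..<CARD('a)}"
    unfolding bij_betw_def by (metis Rep_idx_inject inj_onI type_definition.Rep_range type_definition_idx)
  moreover obtain h :: "nat \<Rightarrow> 'a" where "bij_betw h {..<CARD('a)} UNIV"
    using ex_bij_betw_nat_finite[OF finite, of "UNIV :: 'a set"] by (auto simp: atLeast0LessThan)
  ultimately show ?thesis using bij_betw_trans by blast
qed

section \<open>Transport of Lebesgue measure and of the flow along a bijection of
  coordinates\<close>

definition reindex :: "('b \<Rightarrow> 'a) \<Rightarrow> real^'a \<Rightarrow> real^'b" where
  "reindex p x = (\<chi> i. x $ p i)"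

lemma bounded_linear_reindex: "bounded_linear (reindex p)"
  unfolding reindex_def by (intro linear_conv_bounded_linear[THEN iffD1] linearI) (auto simp: vec_eq_iff)

lemma reindex_inverse:
  assumes "bij p"
  shows "reindex p (reindex (inv p) x) = x" "reindex (inv p) (reindex p y) = y"
  using assms by (auto simp: reindex_def vec_eq_iff bij_is_inj bij_is_surj surj_f_inv_f)

lemma reindex_measurable[measurable]: "reindex p \<in> borel_measurable borel"
  by (intro borel_measurable_continuous_onI linear_continuous_on bounded_linear_reindex)

text \<open>The preimage of a box is the box with relabelled sides, so volumes of boxes agree, and
  these determine Lebesgue measure.\<close>

lemma lborel_reindex:
  fixes p :: "'b::finite \<Rightarrow> 'a::finite"
  assumes p: "bij p"
  shows "lborel = distr lborel borel (reindex p :: real^'a \<Rightarrow> real^'b)"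
proof (rule lborel_eqI)
  fix l u :: "real^'b" assume lu: "\<And>b. b \<in> Basis \<Longrightarrow> l \<bullet> b \<le> u \<bullet> b"
  have lu': "l $ i \<le> u $ i" for i using lu[of "axis i 1"] by (simp add: axis_in_Basis_iff inner_axis)
  have pre: "reindex p -` box l u = box (reindex (inv p) l) (reindex (inv p) u)"
  proof -
    have "(\<forall>i. l $ i < x $ p i \<and> x $ p i < u $ i) \<longleftrightarrow> (\<forall>j. l $ inv p j < x $ j \<and> x $ j < u $ inv p j)" for x :: "real^'a"
      using p by (metis bij_inv_eq_iff)
    then show ?thesis by (auto simp: mem_box_cart reindex_def)
  qed
  have le: "reindex (inv p) l \<bullet> b \<le> reindex (inv p) u \<bullet> b" if "b \<in> Basis" for b
    using that lu' by (auto simp: Basis_vec_def inner_axis reindex_def)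
  have basis_prod: "(\<Prod>b\<in>Basis. f (v \<bullet> b)) = (\<Prod>i\<in>UNIV. f (v $ i))" for v :: "real^'c::finite" and f :: "real \<Rightarrow> real"
  proof -
    have inj: "inj (\<lambda>i. axis i (1::real) :: real^'c)" by (auto simp: inj_def axis_eq_axis)
    have B: "(Basis :: (real^'c) set) = range (\<lambda>i. axis i 1)" by (auto simp: Basis_vec_def)
    show ?thesis unfolding B prod.reindex[OF inj] by (simp add: inner_axis)
  qed
  have "emeasure (distr lborel borel (reindex p)) (box l u) = emeasure lborel (reindex p -` box l u)"
    by (simp add: emeasure_distr)
  also have "\<dots> = ennreal (\<Prod>b\<in>Basis. (reindex (inv p) u - reindex (inv p) l) \<bullet> b)"
    unfolding pre using le by (rule emeasure_lborel_box)
  also have "(\<Prod>b\<in>Basis. (reindex (inv p) u - reindex (inv p) l) \<bullet> b) = (\<Prod>i\<in>UNIV. (u - l) $ inv p i)"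
    by (subst basis_prod[of "\<lambda>x. x"]) (simp add: reindex_def)
  also have "\<dots> = (\<Prod>i\<in>UNIV. (u - l) $ i)"
    using prod.reindex_bij_betw[OF bij_imp_bij_inv[OF p]] by blast
  also have "\<dots> = (\<Prod>b\<in>Basis. (u - l) \<bullet> b)" by (subst basis_prod[of "\<lambda>x. x"]) simp
  finally show "emeasure (distr lborel borel (reindex p)) (box l u) = (\<Prod>b\<in>Basis. (u - l) \<bullet> b)" .
qed simp

text \<open>The entire flow is conjugated by the relabelling \<open>?T\<close>. The result is again
  an additive flow, now over a well-ordered index type, with conjugated drift; divergence and
  Lebesgue measure are unchanged by conjugation, so the identity can be carried back.\<close>

theorem flow_change_of_variables:
  fixes X :: "real \<Rightarrow> real^'n \<Rightarrow> real^'n"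
  assumes flow: "additive_flow m Dm w X" and t: "t \<ge> 0" and A: "compact A"
    and u: "continuous_on UNIV u" and pos: "\<And>x. u x \<ge> 0"
  shows "ennreal (integral (X t ` A) u) =
    (\<integral>\<^sup>+x. ennreal (exp (integral {0..t} (\<lambda>s. additive_flow.divm Dm (X s x))) * u (X t x)) * indicator A x \<partial>lborel)"
proof -
  interpret additive_flow m Dm w X by (rule flow)
  obtain p :: "'n idx \<Rightarrow> 'n" where p: "bij p" using ex_bij_idx by blast
  let ?T = "reindex p :: real^'n \<Rightarrow> real^'n idx" and ?S = "reindex (inv p) :: real^'n idx \<Rightarrow> real^'n"
  note [simp] = reindex_inverse[OF p]
  have T: "bounded_linear ?T" and S: "bounded_linear ?S" by (rule bounded_linear_reindex)+
  have T_cont: "continuous_on B ?T" and S_cont: "continuous_on C ?S" for B C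
    by (intro linear_continuous_on T S)+
  have bijT: "bij ?T" by (rule o_bij[of ?S]) auto
  have bijS: "bij ?S" by (rule o_bij[of ?T]) auto
  define m' where "m' = (\<lambda>y. ?T (m (?S y)))"
  define Dm' where "Dm' = (\<lambda>y. Blinfun ?T o\<^sub>L Dm (?S y) o\<^sub>L Blinfun ?S)"
  define w' where "w' = (\<lambda>t. ?T (w t))"
  define X' where "X' = (\<lambda>t y. ?T (X t (?S y)))"
  have Dm'_apply: "blinfun_apply (Dm' y) v = ?T (Dm (?S y) (?S v))" for y v
    by (simp add: Dm'_def bounded_linear_Blinfun_apply T S)
  have flow': "additive_flow m' Dm' w' X'"
  proof
    show "(m' has_derivative blinfun_apply (Dm' x)) (at x)" for x
    proof -
      have "((\<lambda>y. ?T (m (?S y))) has_derivative (\<lambda>v. ?T (Dm (?S x) (?S v)))) (at x)"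
        using diff_chain_at[OF bounded_linear_imp_has_derivative[OF S] Dm, of x]
        by (intro bounded_linear.has_derivative[OF T]) (simp add: o_def)
      then show ?thesis by (simp add: m'_def Dm'_apply[abs_def])
    qed
    show "continuous_on UNIV Dm'"
      unfolding Dm'_def
      by (intro continuous_intros continuous_on_compose2[OF cont_Dm S_cont]) auto
    show "continuous_on {0..} (\<lambda>t. X' t x)" for x
      unfolding X'_def by (rule continuous_on_compose2[OF T_cont cont_X]) auto
    show "X' t x = x + w' t + integral {0..t} (\<lambda>s. m' (X' s x))" if "t \<ge> 0" for t x
    proof -
      have "integral {0..t} (\<lambda>s. ?T (m (X s (?S x)))) = ?T (integral {0..t} (\<lambda>s. m (X s (?S x))))"
        using integral_linear[OF integrable_continuous_real[OF cont_m_X] T, of 0 t "?S x"]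
        by (simp add: o_def)
      then show ?thesis
        unfolding X'_def w'_def m'_def using that
        by (subst X_eq) (simp_all add: linear_add[OF bounded_linear.linear[OF T]])
    qed
    fix t :: real assume t: "t \<ge> 0"
    show "bij (X' t)"
      unfolding X'_def using bij_comp[OF bijS bij_comp[OF X_bij[OF t] bijT]] by (simp add: o_def)
    show "X' t differentiable (at x)" for x
      unfolding X'_def differentiable_def
      using bounded_linear.has_derivative[OF T
          diff_chain_at[OF bounded_linear_imp_has_derivative[OF S] X_has_derivative[OF t], of x]]
      unfolding o_def by blast
    have inv: "inv (X' t) = (\<lambda>y. ?T (inv (X t) (?S y)))"
      by (rule inv_unique_comp) (use X_bij[OF t] in
        \<open>auto simp: X'_def o_def fun_eq_iff bij_is_inj bij_is_surj surj_f_inv_f\<close>)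
    show "inv (X' t) differentiable (at x)" for x
    proof -
      obtain G where "(inv (X t) has_derivative G) (at (?S x))"
        using X_inv_diff[OF t] unfolding differentiable_def by blast
      from bounded_linear.has_derivative[OF T diff_chain_at[OF bounded_linear_imp_has_derivative[OF S] this]]
      show ?thesis unfolding inv differentiable_def o_def by blast
    qed
  qed
  \<comment> \<open>Invariance of the trace: relabelling only permutes its summands.\<close>
  have divm': "additive_flow.divm Dm' (?T x) = divm x" for x
  proof -
    have "inv p j = i \<longleftrightarrow> j = p i" for i j using p by (metis bij_inv_eq_iff)
    then have ax: "?S (axis i 1) = axis (p i) 1" for i
      by (simp add: reindex_def axis_def vec_eq_iff)
    have "additive_flow.divm Dm' (?T x) = (\<Sum>i\<in>UNIV. Dm x (axis (p i) 1) $ p i)"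
      unfolding additive_flow.divm_def[OF flow'] Dm'_apply by (simp add: ax) (simp add: reindex_def)
    also have "\<dots> = divm x"
      unfolding divm_def using sum.reindex_bij_betw[OF p, of "\<lambda>i. Dm x (axis i 1) $ i"] .
    finally show ?thesis .
  qed
  let ?F = "\<lambda>x. ennreal (exp (integral {0..t} (\<lambda>s. divm (X s x))) * u (X t x)) * indicator A x"
  have K: "compact (X t ` A)" by (intro compact_continuous_image cont_X_space t A)
  have u_meas[measurable]: "u \<in> borel_measurable borel" by (rule borel_measurable_continuous_onI[OF u])
  have X_meas[measurable]: "X t \<in> borel_measurable borel" by (rule borel_measurable_continuous_onI[OF cont_X_space[OF t]])
  note [measurable] = flow_divergence_integral_measurable[OF t] borel_compact[OF A] borel_compact[OF K]
  have transfer: "(\<integral>\<^sup>+y. f (?S y) \<partial>lborel) = (\<integral>\<^sup>+x. f x \<partial>lborel)" if [measurable]: "f \<in> borel_measurable borel" for f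
    by (subst lborel_reindex[OF p]) (simp add: nn_integral_distr)
  have img: "X' t ` (?T ` A) = ?T ` (X t ` A)" by (simp add: X'_def image_image)
  have uS: "continuous_on C (\<lambda>y. u (?S y))" for C
    by (rule continuous_on_compose2[OF u S_cont]) auto
  have ind: "indicator (?T ` B) y = (indicator B (?S y) :: ennreal)" for B y
    using inj_image_mem_iff[OF bij_is_inj[OF bijT], of "?S y" B] by (simp add: indicator_def)
  have "ennreal (integral (X t ` A) u) = (\<integral>\<^sup>+x. ennreal (u x) * indicator (X t ` A) x \<partial>lborel)"
    using nn_integral_compact_continuous[OF K continuous_on_subset[OF u]] pos by simp
  also have "\<dots> = (\<integral>\<^sup>+y. ennreal (u (?S y)) * indicator (X t ` A) (?S y) \<partial>lborel)"
    by (rule transfer[symmetric]) measurable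
  also have "\<dots> = (\<integral>\<^sup>+y. ennreal (u (?S y)) * indicator (?T ` (X t ` A)) y \<partial>lborel)"
    by (simp add: ind)
  also have "\<dots> = ennreal (integral (?T ` (X t ` A)) (\<lambda>y. u (?S y)))"
    by (rule nn_integral_compact_continuous[OF compact_continuous_image[OF T_cont K] uS]) (rule pos)
  also have "\<dots> = (\<integral>\<^sup>+x. ennreal (exp (integral {0..t} (\<lambda>s. additive_flow.divm Dm' (X' s x))) * u (?S (X' t x))) * indicator (?T ` A) x \<partial>lborel)"
    unfolding img[symmetric]
    by (rule flow_change_of_variables_wellorder[OF flow' t compact_continuous_image[OF T_cont A] uS]) (rule pos)
  also have "\<dots> = (\<integral>\<^sup>+y. ?F (?S y) \<partial>lborel)"
    by (simp add: X'_def divm' ind)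
  also have "\<dots> = (\<integral>\<^sup>+x. ?F x \<partial>lborel)" by (rule transfer) measurable
  finally show ?thesis .
qed

subsection \<open>Brownian increments\<close>

text \<open>Lebesgue measure is the image of a product measure indexed by the basis vectors. The
  coordinates are re-indexed by \<open>axis_index\<close> to reach that form. It is needed because
  the Gaussian density of an increment is a product over coordinates.\<close>

lemma lborel_prod_cart:
  fixes f :: "'n::finite \<Rightarrow> real \<Rightarrow> real"
  assumes f: "\<And>i. integrable lborel (f i)"
  shows "integrable lborel (\<lambda>x::real^'n. \<Prod>i\<in>UNIV. f i (x $ i))"
    and "(\<integral>x. (\<Prod>i\<in>UNIV. f i (x $ i)) \<partial>(lborel :: (real^'n) measure)) = (\<Prod>i\<in>UNIV. (\<integral>y. f i y \<partial>lborel))"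
proof -
  interpret product_sigma_finite "\<lambda>_ :: real^'n. lborel :: real measure"
    by (rule product_sigma_finite.intro) (rule sigma_finite_lborel)
  have inj: "inj (\<lambda>i. axis i (1::real) :: real^'n)" by (auto simp: inj_def axis_eq_axis)
  have B: "(Basis :: (real^'n) set) = range (\<lambda>i. axis i 1)" by (auto simp: Basis_vec_def)
  have reindex: "(\<Prod>i\<in>UNIV. g i) = (\<Prod>b\<in>(Basis :: (real^'n) set). g (axis_index b))" for g :: "'n \<Rightarrow> real"
    unfolding B prod.reindex[OF inj] by simp
  have comp: "x $ axis_index b = x \<bullet> b" if "b \<in> Basis" for x b :: "real^'n"
    using that by (auto simp: B inner_axis)
  have eq: "(\<Prod>i\<in>UNIV. f i (x $ i)) = (\<Prod>b\<in>Basis. f (axis_index b) (x \<bullet> b))" for x :: "real^'n"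
    unfolding reindex by (intro prod.cong) (auto simp: comp)
  have [measurable]: "f i \<in> borel_measurable borel" for i
    using f[of i] by (simp add: integrable_iff_bounded)
  have [measurable]: "(\<lambda>x::real^'n. \<Prod>b\<in>Basis. f (axis_index b) (x \<bullet> b)) \<in> borel_measurable borel"
    by measurable
  let ?P = "\<Pi>\<^sub>M b\<in>(Basis :: (real^'n) set). (lborel :: real measure)"
  have T[measurable]: "(\<lambda>g. \<Sum>b\<in>Basis. g b *\<^sub>R b) \<in> ?P \<rightarrow>\<^sub>M (borel :: (real^'n) measure)"
    by measurable
  have eq2: "(\<Prod>b\<in>Basis. f (axis_index b) ((\<Sum>b\<in>Basis. g b *\<^sub>R b) \<bullet> b))
      = (\<Prod>b\<in>Basis. f (axis_index b) (g b))" for g :: "real^'n \<Rightarrow> real"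
    by (intro prod.cong) (auto simp: inner_sum_left_Basis)
  show "integrable lborel (\<lambda>x::real^'n. \<Prod>i\<in>UNIV. f i (x $ i))"
    unfolding eq
    by (subst lborel_eq, subst integrable_distr_eq[OF T])
      (auto simp: eq2 intro!: product_integrable_prod f)
  show "(\<integral>x. (\<Prod>i\<in>UNIV. f i (x $ i)) \<partial>(lborel :: (real^'n) measure)) = (\<Prod>i\<in>UNIV. (\<integral>y. f i y \<partial>lborel))"
    unfolding eq
    by (subst lborel_eq, subst integral_distr[OF T])
      (auto simp: eq2 product_integral_prod[OF finite_Basis f] reindex)
qed

text \<open>Cauchy-Schwarz for the vector of squared coordinates against the vector of ones.\<close>

lemma norm_power4_le: "(norm (x::real^'n)) ^ 4 \<le> real CARD('n) * (\<Sum>i\<in>UNIV. (x $ i) ^ 4)"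
proof -
  have "(norm x) ^ 4 = (\<Sum>i\<in>UNIV. (x $ i)\<^sup>2 * 1)\<^sup>2"
    by (simp add: norm_vec_def L2_set_def sum_nonneg power4_eq_xxxx flip: power2_eq_square)
      (simp add: power2_eq_square mult.assoc[symmetric] sum_nonneg)
  also have "\<dots> \<le> (\<Sum>i\<in>UNIV. ((x $ i)\<^sup>2)\<^sup>2) * (\<Sum>i\<in>(UNIV :: 'n set). 1\<^sup>2)"
    by (rule Cauchy_Schwarz_ineq_sum)
  finally show ?thesis by (simp add: mult.commute)
qed

locale brownian_motion = prob_space M for M :: "'w measure" +
  fixes b :: "real \<Rightarrow> 'w \<Rightarrow> real^'n"
  assumes BM: "standard_BM M b"
begin

abbreviation F :: "real \<Rightarrow> 'w measure" where "F \<equiv> natural_filtration M b"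

lemma b_measurable[measurable]: "t \<ge> 0 \<Longrightarrow> b t \<in> borel_measurable M"
  and b_0: "\<omega> \<in> space M \<Longrightarrow> b 0 \<omega> = 0"
  and b_cont: "\<omega> \<in> space M \<Longrightarrow> continuous_on {0..} (\<lambda>t. b t \<omega>)"
  using BM unfolding standard_BM_def by auto

lemma space_F[simp]: "space (F t) = space M"
  unfolding natural_filtration_def by (subst space_measure_of) auto

lemma sets_F: "sets (F t) = sigma_sets (space M) (\<Union>s\<in>{0..t}. {(b s) -` B \<inter> space M | B. B \<in> sets borel})"
  unfolding natural_filtration_def by (subst sets_measure_of) auto

lemma F_subalgebra: "subalgebra M (F t)"
proof -
  have "sets (F t) \<subseteq> sets M"
    unfolding sets_F using b_measurable by (intro sets.sigma_sets_subset) (auto intro: measurable_sets)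
  then show ?thesis by (simp add: subalgebra_def)
qed

lemma F_mono: "s \<le> t \<Longrightarrow> sets (F s) \<subseteq> sets (F t)"
  unfolding sets_F by (intro sigma_sets_mono' UN_mono) auto

lemma measurable_F_mono: "f \<in> F s \<rightarrow>\<^sub>M N \<Longrightarrow> s \<le> t \<Longrightarrow> f \<in> F t \<rightarrow>\<^sub>M N"
  using F_mono[of s t] by (auto simp: measurable_def)

lemma measurable_F_M: "f \<in> F t \<rightarrow>\<^sub>M N \<Longrightarrow> f \<in> M \<rightarrow>\<^sub>M N"
  using F_subalgebra by (rule measurable_from_subalg)

lemma b_measurable_F: "0 \<le> r \<Longrightarrow> r \<le> t \<Longrightarrow> b r \<in> borel_measurable (F t)"
proof (rule measurableI)
  fix B :: "(real^'n) set" assume "0 \<le> r" "r \<le> t" "B \<in> sets borel"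
  then have "b r -` B \<inter> space M \<in> (\<Union>s\<in>{0..t}. {(b s) -` B \<inter> space M | B. B \<in> sets borel})"
    by (intro UN_I[of r]) auto
  then show "b r -` B \<inter> space (F t) \<in> sets (F t)" by (simp add: sets_F sigma_sets.Basic)
qed simp

text \<open>Brownian motion provides independence at the level of events. Preimages of Borel sets
  are stable under intersection, so the product formula extends to random variables: a coefficient
  known at time \<open>s\<close> factors out of the mean of any integrable function of the
  increment.\<close>

lemma increment_indep:
  fixes c :: "'w \<Rightarrow> real" and g :: "real^'n \<Rightarrow> real"
  assumes st: "0 \<le> s" "s < t" and c[measurable]: "c \<in> borel_measurable (F s)" and c_int: "integrable M c"
    and g[measurable]: "g \<in> borel_measurable borel" and g_int: "integrable M (\<lambda>\<omega>. g (b t \<omega> - b s \<omega>))"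
  shows "integrable M (\<lambda>\<omega>. c \<omega> * g (b t \<omega> - b s \<omega>))"
    and "(\<integral>\<omega>. c \<omega> * g (b t \<omega> - b s \<omega>) \<partial>M) = (\<integral>\<omega>. c \<omega> \<partial>M) * (\<integral>\<omega>. g (b t \<omega> - b s \<omega>) \<partial>M)"
proof -
  let ?D = "\<lambda>\<omega>. b t \<omega> - b s \<omega>"
  have D[measurable]: "?D \<in> borel_measurable M" using st by (intro borel_measurable_diff b_measurable) auto
  have cM[measurable]: "c \<in> borel_measurable M" by (rule measurable_F_M[OF c])
  have ind: "prob (A \<inter> (?D -` B \<inter> space M)) = prob A * prob (?D -` B \<inter> space M)"
    if "A \<in> sets (F s)" "B \<in> sets borel" for A B
    using BM st that unfolding standard_BM_def by blast
  have stable: "Int_stable {X -` A \<inter> space M |A. A \<in> sets (borel :: real measure)}" for X :: "'w \<Rightarrow> real"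
  proof (safe intro!: Int_stableI)
    fix A B :: "real set" assume "A \<in> sets borel" "B \<in> sets borel"
    then show "\<exists>C. (X -` A \<inter> space M) \<inter> (X -` B \<inter> space M) = X -` C \<inter> space M \<and> C \<in> sets borel"
      by (intro exI[of _ "A \<inter> B"]) auto
  qed
  have "indep_var borel c borel (\<lambda>\<omega>. g (?D \<omega>))"
    unfolding indep_var_eq
  proof (intro conjI indep_set_sigma_sets stable)
    show "indep_set {c -` A \<inter> space M |A. A \<in> sets borel} {(\<lambda>\<omega>. g (?D \<omega>)) -` A \<inter> space M |A. A \<in> sets borel}"
    proof (safe intro!: indep_setI)
      fix A B :: "real set" assume A: "A \<in> sets borel" and B: "B \<in> sets borel"
      show "c -` A \<inter> space M \<in> events" "(\<lambda>\<omega>. g (?D \<omega>)) -` A \<inter> space M \<in> events"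
        using A by (auto intro!: measurable_sets[where A=borel] measurable_sets)
      have "c -` A \<inter> space M \<in> sets (F s)" using measurable_sets[OF c A] by simp
      moreover have "g -` B \<in> sets borel" using measurable_sets[OF g B] by simp
      moreover have "(\<lambda>\<omega>. g (?D \<omega>)) -` B = ?D -` (g -` B)" by auto
      ultimately show "prob ((c -` A \<inter> space M) \<inter> ((\<lambda>\<omega>. g (?D \<omega>)) -` B \<inter> space M)) =
          prob (c -` A \<inter> space M) * prob ((\<lambda>\<omega>. g (?D \<omega>)) -` B \<inter> space M)"
        using ind by simp
    qed
  qed measurable
  from indep_var_integrable[OF this c_int g_int] indep_var_lebesgue_integral[OF this c_int g_int]
  show "integrable M (\<lambda>\<omega>. c \<omega> * g (b t \<omega> - b s \<omega>))"
    "(\<integral>\<omega>. c \<omega> * g (b t \<omega> - b s \<omega>) \<partial>M) = (\<integral>\<omega>. c \<omega> \<partial>M) * (\<integral>\<omega>. g (b t \<omega> - b s \<omega>) \<partial>M)"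
    by auto
qed

text \<open>A multi-index moment factors into one-dimensional Gaussian moments; the particular
  moments used later are choices of the exponents \<open>e\<close>.\<close>

lemma increment_moment:
  fixes e :: "'n \<Rightarrow> nat"
  assumes st: "0 \<le> s" "s < t"
  shows "integrable M (\<lambda>\<omega>. \<Prod>i\<in>UNIV. (b t \<omega> - b s \<omega>) $ i ^ e i)"
    and "(\<integral>\<omega>. (\<Prod>i\<in>UNIV. (b t \<omega> - b s \<omega>) $ i ^ e i) \<partial>M)
      = (\<Prod>i\<in>UNIV. (\<integral>y. normal_density 0 (sqrt (t - s)) y * y ^ e i \<partial>lborel))"
proof -
  have D: "distributed M lborel (\<lambda>\<omega>. b t \<omega> - b s \<omega>)
      (\<lambda>x. ennreal (\<Prod>i\<in>UNIV. normal_density 0 (sqrt (t - s)) (x $ i)))"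
    using BM st unfolding standard_BM_def by blast
  have i: "integrable lborel (\<lambda>y. normal_density 0 (sqrt (t - s)) y * y ^ e i)" for i
    using integrable_normal_moment[of "sqrt (t - s)" 0 "e i"] st by simp
  have g: "(\<lambda>x::real^'n. \<Prod>i\<in>UNIV. x $ i ^ e i) \<in> borel_measurable lborel"
    by (subst measurable_lborel2, intro borel_measurable_continuous_onI continuous_intros)
  have pos: "0 \<le> (\<Prod>i\<in>UNIV. normal_density 0 (sqrt (t - s)) (x $ i))" for x :: "real^'n"
    by (intro prod_nonneg) simp
  note P = lborel_prod_cart[of "\<lambda>i y. normal_density 0 (sqrt (t - s)) y * y ^ e i", OF i]
  show "integrable M (\<lambda>\<omega>. \<Prod>i\<in>UNIV. (b t \<omega> - b s \<omega>) $ i ^ e i)"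
    using distributed_integrable[OF D g pos] P(1) by (simp add: prod.distrib)
  show "(\<integral>\<omega>. (\<Prod>i\<in>UNIV. (b t \<omega> - b s \<omega>) $ i ^ e i) \<partial>M)
      = (\<Prod>i\<in>UNIV. (\<integral>y. normal_density 0 (sqrt (t - s)) y * y ^ e i \<partial>lborel))"
    using distributed_integral[OF D g pos] P(2) by (simp add: prod.distrib)
qed

lemma increment_moments:
  assumes st: "0 \<le> s" "s < t"
  defines "D \<equiv> \<lambda>\<omega>. b t \<omega> - b s \<omega>"
  shows "integrable M (\<lambda>\<omega>. D \<omega> $ i)" "(\<integral>\<omega>. D \<omega> $ i \<partial>M) = 0"
    and "integrable M (\<lambda>\<omega>. D \<omega> $ i * D \<omega> $ j)"
    and "(\<integral>\<omega>. D \<omega> $ i * D \<omega> $ j \<partial>M) = (if i = j then t - s else 0)"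
    and "integrable M (\<lambda>\<omega>. (D \<omega> $ i) ^ 4)" "(\<integral>\<omega>. (D \<omega> $ i) ^ 4 \<partial>M) = 3 * (t - s)\<^sup>2"
proof -
  have pos: "sqrt (t - s) > 0" using st by simp
  let ?n = "\<lambda>k. \<integral>y. normal_density 0 (sqrt (t - s)) y * y ^ k \<partial>lborel"
  have n0: "?n 0 = 1" and n1: "?n 1 = 0" and n2: "?n 2 = t - s" and n4: "?n 4 = 3 * (t - s)\<^sup>2"
    using integral_normal_moment_even[OF pos, of 0 0] integral_normal_moment_odd[OF pos, of 0 0]
      integral_normal_moment_even[OF pos, of 0 1] integral_normal_moment_even[OF pos, of 0 2] st
    by (simp_all add: fact_numeral power2_eq_square field_simps)
  have single: "(\<Prod>k\<in>UNIV. x k ^ (if k = i then n else 0)) = x i ^ n" for x :: "'n \<Rightarrow> real" and i n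
  proof -
    have "(\<Prod>k\<in>UNIV. x k ^ (if k = i then n else 0)) = (\<Prod>k\<in>UNIV. if k = i then x k ^ n else 1)"
      by (intro prod.cong) auto
    then show ?thesis by (simp add: prod.delta)
  qed
  \<comment> \<open>Coordinates with exponent 0 contribute the total mass 1 of the Gaussian
    density.\<close>
  have single': "(\<Prod>k\<in>(UNIV :: 'n set). ?n (if k = i then n else 0)) = ?n n" for i n
  proof -
    have "(\<Prod>k\<in>(UNIV :: 'n set). ?n (if k = i then n else 0)) = (\<Prod>k\<in>(UNIV :: 'n set). if k = i then ?n n else 1)"
      using n0 by (intro prod.cong) auto
    then show ?thesis by (simp add: prod.delta)
  qed
  note m = increment_moment[OF st, of "\<lambda>k. if k = i then n else 0" for n, unfolded single single']
  show "integrable M (\<lambda>\<omega>. D \<omega> $ i)" "(\<integral>\<omega>. D \<omega> $ i \<partial>M) = 0"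
    using m[of 1] n1 by (simp_all add: D_def)
  show "integrable M (\<lambda>\<omega>. (D \<omega> $ i) ^ 4)" "(\<integral>\<omega>. (D \<omega> $ i) ^ 4 \<partial>M) = 3 * (t - s)\<^sup>2"
    using m[of 4] n4 by (simp_all add: D_def)
  show "integrable M (\<lambda>\<omega>. D \<omega> $ i * D \<omega> $ j)"
    "(\<integral>\<omega>. D \<omega> $ i * D \<omega> $ j \<partial>M) = (if i = j then t - s else 0)"
  proof -
    \<comment> \<open>A sum of two unit multi-indices treats both cases at once: for
      \<open>i = j\<close> it has a single exponent 2, giving the variance, and for
      \<open>i \<noteq> j\<close> two exponents 1, each a vanishing odd moment.\<close>
    let ?e = "\<lambda>k. (if k = i then 1 else 0) + (if k = j then 1 else 0 :: nat)"
    have e: "(\<Prod>k\<in>UNIV. x k ^ ?e k) = x i * x j" for x :: "'n \<Rightarrow> real"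
      by (simp only: power_add prod.distrib single power_one_right)
    note m2 = increment_moment[OF st, of ?e, unfolded e]
    show "integrable M (\<lambda>\<omega>. D \<omega> $ i * D \<omega> $ j)" using m2(1) by (simp add: D_def)
    have "(\<Prod>k\<in>(UNIV :: 'n set). ?n (?e k)) = (if i = j then t - s else 0)"
    proof (cases "i = j")
      case True
      then have "?e k = (if k = i then 2 else 0)" for k by simp
      then show ?thesis using True by (simp only: single' n2 if_True simp_thms)
    next
      case False
      then have "?n (?e i) = 0" using n1 by simp
      then have "(\<Prod>k\<in>(UNIV :: 'n set). ?n (?e k)) = 0" by (intro prod_zero) auto
      then show ?thesis using False by simp
    qed
    then show "(\<integral>\<omega>. D \<omega> $ i * D \<omega> $ j \<partial>M) = (if i = j then t - s else 0)"
      using m2(2) by (simp add: D_def)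
  qed
qed

text \<open>The case \<open>s = t\<close> is included because the Riemann sums for \<open>S2\<close>
  begin with a zero increment.\<close>

lemma increment_norm2:
  assumes st: "0 \<le> s" "s \<le> t"
  shows "integrable M (\<lambda>\<omega>. (norm (b t \<omega> - b s \<omega>))\<^sup>2)"
    and "(\<integral>\<omega>. (norm (b t \<omega> - b s \<omega>))\<^sup>2 \<partial>M) = real CARD('n) * (t - s)"
proof -
  have eq: "(norm (b t \<omega> - b s \<omega>))\<^sup>2 = (\<Sum>i\<in>UNIV. (b t \<omega> - b s \<omega>) $ i * (b t \<omega> - b s \<omega>) $ i)" for \<omega>
    by (simp add: power2_norm_eq_inner inner_vec_def)
  have "integrable M (\<lambda>\<omega>. (norm (b t \<omega> - b s \<omega>))\<^sup>2) \<and>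
    (\<integral>\<omega>. (norm (b t \<omega> - b s \<omega>))\<^sup>2 \<partial>M) = real CARD('n) * (t - s)"
  proof (cases "s = t")
    case False
    then have lt: "s < t" using st by simp
    note m = increment_moments[OF st(1) lt]
    show ?thesis unfolding eq using m(3,4)
      by (subst Bochner_Integration.integral_sum) (auto simp del: vector_minus_component intro!: Bochner_Integration.integrable_sum)
  qed simp
  then show "integrable M (\<lambda>\<omega>. (norm (b t \<omega> - b s \<omega>))\<^sup>2)"
    "(\<integral>\<omega>. (norm (b t \<omega> - b s \<omega>))\<^sup>2 \<partial>M) = real CARD('n) * (t - s)" by auto
qed

text \<open>Each coordinate has fourth moment \<open>3 * (t - s)^2\<close>; summing the coordinates
  and comparing norms cost one factor of the dimension each.\<close>

lemma increment_norm4: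
  assumes st: "0 \<le> s" "s < t"
  shows "integrable M (\<lambda>\<omega>. (norm (b t \<omega> - b s \<omega>)) ^ 4)"
    and "(\<integral>\<omega>. (norm (b t \<omega> - b s \<omega>)) ^ 4 \<partial>M) \<le> 3 * (real CARD('n))\<^sup>2 * (t - s)\<^sup>2"
proof -
  note m = increment_moments(5,6)[OF st]
  let ?S = "\<lambda>\<omega>. real CARD('n) * (\<Sum>i\<in>UNIV. ((b t \<omega> - b s \<omega>) $ i) ^ 4)"
  have int: "integrable M ?S"
    using m(1) by (intro integrable_mult_right Bochner_Integration.integrable_sum) (auto simp del: vector_minus_component)
  have [measurable]: "b t \<in> borel_measurable M" "b s \<in> borel_measurable M" using st by auto
  show *: "integrable M (\<lambda>\<omega>. (norm (b t \<omega> - b s \<omega>)) ^ 4)"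
    by (rule Bochner_Integration.integrable_bound[OF int]) (auto intro!: order.trans[OF norm_power4_le] simp del: vector_minus_component)
  have "(\<integral>\<omega>. (norm (b t \<omega> - b s \<omega>)) ^ 4 \<partial>M) \<le> (\<integral>\<omega>. ?S \<omega> \<partial>M)"
    by (intro integral_mono * int norm_power4_le)
  also have "\<dots> = real CARD('n) * (\<Sum>i\<in>(UNIV :: 'n set). 3 * (t - s)\<^sup>2)"
    using m by (simp add: Bochner_Integration.integral_sum del: vector_minus_component)
  finally show "(\<integral>\<omega>. (norm (b t \<omega> - b s \<omega>)) ^ 4 \<partial>M) \<le> 3 * (real CARD('n))\<^sup>2 * (t - s)\<^sup>2"
    by (simp add: power2_eq_square)
qed

text \<open>The wandering of the path inside the step from \<open>t\<close> to \<open>t + h\<close>.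
  It arises when drift and divergence along the path are replaced by their values at the beginning
  of the step.\<close>

definition S2 :: "real \<Rightarrow> real \<Rightarrow> 'w \<Rightarrow> real" where
  "S2 t h \<omega> = integral {0..h} (\<lambda>r. (norm (b (t + r) \<omega> - b t \<omega>))\<^sup>2)"

lemma S2_riemann:
  assumes "t \<ge> 0" "h \<ge> 0" "\<omega> \<in> space M"
  shows "(\<lambda>n. \<Sum>k<n. (h / real n) *\<^sub>R (norm (b (t + h * real k / real n) \<omega> - b t \<omega>))\<^sup>2) \<longlonglongrightarrow> S2 t h \<omega>"
  unfolding S2_def using assms
  by (intro riemann_sum_tendsto[where f="\<lambda>r. (norm (b (t + r) \<omega> - b t \<omega>))\<^sup>2"])
    (auto intro!: continuous_intros continuous_on_compose2[OF b_cont])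

text \<open>Fatou's lemma along the Riemann sums reduces the claim to second moments of single
  increments. Bounding each elapsed time by \<open>h\<close> loses only a factor of two against the
  exact mean.\<close>

lemma S2_expectation:
  assumes t: "t \<ge> 0" and h: "h \<ge> 0"
  shows "integrable M (S2 t h)" and "(\<integral>\<omega>. S2 t h \<omega> \<partial>M) \<le> real CARD('n) * h\<^sup>2"
proof -
  let ?R = "\<lambda>n \<omega>. \<Sum>k<n. (h / real n) *\<^sub>R (norm (b (t + h * real k / real n) \<omega> - b t \<omega>))\<^sup>2"
  have [measurable]: "b t \<in> borel_measurable M" "b (t + h * real k / real n) \<in> borel_measurable M" for k n
    using t h by auto
  have R[measurable]: "?R n \<in> borel_measurable M" for n by measurable
  have lim: "\<And>\<omega>. \<omega> \<in> space M \<Longrightarrow> (\<lambda>n. ?R n \<omega>) \<longlonglongrightarrow> S2 t h \<omega>" by (rule S2_riemann[OF t h])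
  have S[measurable]: "S2 t h \<in> borel_measurable M"
    by (rule borel_measurable_LIMSEQ_real[OF lim R])
  have pos: "S2 t h \<omega> \<ge> 0" if "\<omega> \<in> space M" for \<omega>
    by (rule LIMSEQ_le_const[OF lim[OF that]]) (use h in \<open>auto intro!: sum_nonneg\<close>)
  have ER: "(\<integral>\<^sup>+\<omega>. ennreal (?R n \<omega>) \<partial>M) \<le> ennreal (real CARD('n) * h\<^sup>2)" for n
  proof -
    have int: "integrable M (?R n)"
      using t h by (intro Bochner_Integration.integrable_sum integrable_scaleR_right increment_norm2) auto
    have "(\<integral>\<^sup>+\<omega>. ennreal (?R n \<omega>) \<partial>M) = ennreal (\<integral>\<omega>. ?R n \<omega> \<partial>M)"
      using h by (intro nn_integral_eq_integral int) (auto intro!: sum_nonneg)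
    also have "(\<integral>\<omega>. ?R n \<omega> \<partial>M) = (\<Sum>k<n. (h / real n) * (real CARD('n) * (h * real k / real n)))"
      using t h by (subst Bochner_Integration.integral_sum) (auto simp: increment_norm2)
    also have "\<dots> \<le> (\<Sum>k<n. (h / real n) * (real CARD('n) * h))"
    proof (intro sum_mono mult_left_mono)
      fix k assume "k \<in> {..<n}"
      then show "h * real k / real n \<le> h" using h by (simp add: divide_le_eq mult_left_mono)
    qed (use h in auto)
    also have "\<dots> \<le> real CARD('n) * h\<^sup>2" by (simp add: power2_eq_square)
    finally show ?thesis by (simp add: ennreal_leI)
  qed
  have "(\<integral>\<^sup>+\<omega>. ennreal (S2 t h \<omega>) \<partial>M) = (\<integral>\<^sup>+\<omega>. liminf (\<lambda>n. ennreal (?R n \<omega>)) \<partial>M)"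
    by (intro nn_integral_cong lim_imp_Liminf[symmetric] tendsto_ennrealI lim) auto
  also have "\<dots> \<le> liminf (\<lambda>n. \<integral>\<^sup>+\<omega>. ennreal (?R n \<omega>) \<partial>M)"
    by (intro nn_integral_liminf) measurable
  also have "\<dots> \<le> ennreal (real CARD('n) * h\<^sup>2)"
    using ER by (intro Liminf_le) (auto intro: always_eventually)
  finally have le: "(\<integral>\<^sup>+\<omega>. ennreal (S2 t h \<omega>) \<partial>M) \<le> ennreal (real CARD('n) * h\<^sup>2)" .
  show int: "integrable M (S2 t h)"
  proof (rule integrableI_bounded)
    have "(\<integral>\<^sup>+\<omega>. ennreal (norm (S2 t h \<omega>)) \<partial>M) = (\<integral>\<^sup>+\<omega>. ennreal (S2 t h \<omega>) \<partial>M)"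
      using pos by (intro nn_integral_cong) auto
    then show "(\<integral>\<^sup>+\<omega>. ennreal (norm (S2 t h \<omega>)) \<partial>M) < \<infinity>"
      using le by (simp add: order.strict_trans1)
  qed (rule S)
  have "ennreal (\<integral>\<omega>. S2 t h \<omega> \<partial>M) \<le> ennreal (real CARD('n) * h\<^sup>2)"
    using le nn_integral_eq_integral[OF int] pos by auto
  then show "(\<integral>\<omega>. S2 t h \<omega> \<partial>M) \<le> real CARD('n) * h\<^sup>2"
    by (simp add: ennreal_le_iff)
qed

end

subsection \<open>Expansion over one time step\<close>

text \<open>A continuous Hessian gives a remainder without rate. For displacements shorter than a
  modulus \<open>d\<close> the Hessian oscillates by less than \<open>e\<close>; for longer ones the
  crude bound by its size is absorbed in a multiple of the squared length. Hence a small quadratic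
  term plus a quartic one, whose mean over a Brownian step is of order \<open>h^2\<close>.\<close>

lemma taylor2_upper:
  fixes u :: "'a::euclidean_space \<Rightarrow> real"
  assumes Du: "\<And>x. (u has_derivative blinfun_apply (Du x)) (at x)"
    and D2u: "\<And>x. (Du has_derivative blinfun_apply (D2u x)) (at x)"
    and cont: "continuous_on UNIV D2u" and K: "compact K" "convex K" and e: "e > 0"
  shows "\<exists>C\<ge>0. \<forall>x\<in>K. \<forall>y\<in>K. u y \<le> u x + Du x (y - x) + 1/2 * D2u x (y - x) (y - x)
      + e * (norm (y - x))\<^sup>2 + C * (norm (y - x)) ^ 4"
proof -
  have contK: "continuous_on K D2u" by (rule continuous_on_subset[OF cont]) simp
  then have "uniformly_continuous_on K D2u" using K(1) by (rule compact_uniformly_continuous)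
  then obtain d where d: "d > 0" "\<And>x y. \<lbrakk>x \<in> K; y \<in> K; dist y x < d\<rbrakk> \<Longrightarrow> dist (D2u y) (D2u x) < e"
    using e unfolding uniformly_continuous_on_def by metis
  have "bounded (D2u ` K)" by (intro compact_imp_bounded compact_continuous_image contK K)
  then obtain B where B: "\<And>x. x \<in> K \<Longrightarrow> norm (D2u x) \<le> B" unfolding bounded_iff by blast
  \<comment> \<open>Normalised so that \<open>C * d^2\<close> equals twice the bound on the Hessian:
    it pays for the oscillation as soon as the displacement has length at least
    \<open>d\<close>.\<close>
  define C where "C = 2 * max B 0 / d\<^sup>2"
  have C: "C \<ge> 0" by (simp add: C_def)
  have osc: "norm (D2u z - D2u x) \<le> e + C * (norm v)\<^sup>2" if "x \<in> K" "z \<in> K" "norm (z - x) \<le> norm v" for x z v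
  proof (cases "norm v < d")
    case True
    then have "norm (D2u z - D2u x) < e" using d(2)[OF that(1,2)] that(3) by (simp add: dist_norm)
    then show ?thesis using C by (simp add: add_increasing2 less_imp_le)
  next
    case False
    have "norm (D2u z - D2u x) \<le> 2 * max B 0"
      using norm_triangle_ineq4[of "D2u z" "D2u x"] B[OF that(1)] B[OF that(2)] by linarith
    also have "\<dots> \<le> C * (norm v)\<^sup>2"
    proof -
      have "d\<^sup>2 \<le> (norm v)\<^sup>2" using False d(1) by (intro power_mono) auto
      then have "C * d\<^sup>2 \<le> C * (norm v)\<^sup>2" using C by (rule mult_left_mono)
      then show ?thesis using d(1) by (simp add: C_def)
    qed
    finally show ?thesis using e by linarith
  qed
  have "u y \<le> u x + Du x (y - x) + 1/2 * D2u x (y - x) (y - x)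
      + e * (norm (y - x))\<^sup>2 + C * (norm (y - x)) ^ 4" if x: "x \<in> K" and y: "y \<in> K" for x y
  proof -
    define v where "v = y - x"
    \<comment> \<open>The successive derivatives of \<open>u\<close> along the segment, in the
      format of Taylor's theorem; the last branch is meant for index 2 and is mere filler beyond
      it.\<close>
    define g where "g = (\<lambda>(n::nat) s. if n = 0 then u (x + s *\<^sub>R v) else if n = 1 then Du (x + s *\<^sub>R v) v
       else D2u (x + s *\<^sub>R v) v v)"
    have lin: "((\<lambda>s. x + s *\<^sub>R v) has_derivative (\<lambda>s. s *\<^sub>R v)) (at s)" for s
      by (auto intro!: derivative_eq_intros)
    have g0: "((\<lambda>s. u (x + s *\<^sub>R v)) has_real_derivative Du (x + s *\<^sub>R v) v) (at s)" for s
      using diff_chain_at[OF lin Du, of s]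
      by (simp add: o_def has_field_derivative_def blinfun.scaleR_right mult.commute mult_commute_abs)
    have g1: "((\<lambda>s. Du (x + s *\<^sub>R v) v) has_real_derivative D2u (x + s *\<^sub>R v) v v) (at s)" for s
    proof -
      have "((\<lambda>s. Du (x + s *\<^sub>R v)) has_derivative (\<lambda>r. D2u (x + s *\<^sub>R v) (r *\<^sub>R v))) (at s)"
        using diff_chain_at[OF lin D2u, of s] by (simp add: o_def)
      from bounded_linear.has_derivative[OF blinfun.bounded_linear_left[of v] this]
      show ?thesis
        by (simp add: has_field_derivative_def blinfun.scaleR_right blinfun.scaleR_left mult_commute_abs)
    qed
    have "\<forall>m t. m < 2 \<and> 0 \<le> t \<and> t \<le> 1 \<longrightarrow> DERIV (g m) t :> g (Suc m) t"
      using g0 g1 by (auto simp: g_def less_2_cases_iff)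
    from Taylor_up[of 2 g "g 0" 0 1 0, OF _ _ this] obtain s where s: "0 < s" "s < 1"
      "g 0 1 = (\<Sum>m<2. g m 0 / fact m * (1 - 0) ^ m) + g 2 s / fact 2 * (1 - 0)\<^sup>2" by auto
    then have eq: "u y = u x + Du x v + 1/2 * D2u (x + s *\<^sub>R v) v v"
      by (simp add: g_def v_def numeral_2_eq_2)
    have z: "x + s *\<^sub>R v \<in> K"
    proof -
      have "x + s *\<^sub>R v = (1 - s) *\<^sub>R x + s *\<^sub>R y" by (simp add: v_def algebra_simps)
      then show ?thesis using convexD_alt[OF K(2) x y, of s] s by simp
    qed
    have "D2u (x + s *\<^sub>R v) v v - D2u x v v \<le> norm ((D2u (x + s *\<^sub>R v) - D2u x) v v)"
      by (simp add: blinfun.diff_left)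
    also have "\<dots> \<le> norm (D2u (x + s *\<^sub>R v) - D2u x) * norm v * norm v"
      by (meson norm_blinfun mult_right_mono norm_ge_zero order_trans)
    also have "\<dots> \<le> (e + C * (norm v)\<^sup>2) * norm v * norm v"
      using s by (intro mult_right_mono osc x z) (auto simp: mult_left_le_one_le)
    also have "\<dots> = e * (norm v)\<^sup>2 + C * norm v ^ 4"
      by (simp add: algebra_simps power2_eq_square power4_eq_xxxx)
    finally have "D2u (x + s *\<^sub>R v) v v \<le> D2u x v v + (e * (norm v)\<^sup>2 + C * norm v ^ 4)" by simp
    moreover have "0 \<le> e * (norm v)\<^sup>2 + C * norm v ^ 4" using e C by simp
    ultimately show ?thesis unfolding eq v_def[symmetric] by linarith
  qed
  then show ?thesis using C by blast
qed

text \<open>Two comparisons with \<open>1 / (1 - x)\<close>: it dominates \<open>exp x\<close>, and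
  it is at most the quadratic because
  \<open>(1 + x + x^2) * (1 - x) = 1 - x^3 \<ge> 1\<close>.\<close>

lemma exp_nonpos_le: "x \<le> 0 \<Longrightarrow> exp x \<le> 1 + x + x\<^sup>2" for x :: real
proof -
  assume x: "x \<le> 0"
  have "1 \<le> (1 + x + x\<^sup>2) * (1 - x)"
  proof -
    have "(1 + x + x\<^sup>2) * (1 - x) = 1 - x * x\<^sup>2" by (simp add: algebra_simps power2_eq_square)
    moreover have "x * x\<^sup>2 \<le> 0" using x by (simp add: mult_nonpos_nonneg)
    ultimately show ?thesis by linarith
  qed
  then have "1 / (1 - x) \<le> 1 + x + x\<^sup>2" using x by (simp add: pos_divide_le_eq)
  moreover have "exp x \<le> 1 / (1 - x)"
  proof -
    have "1 - x \<le> exp (- x)" using exp_ge_add_one_self[of "- x"] by simp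
    then have "exp x * (1 - x) \<le> exp x * exp (- x)" by (intro mult_left_mono) auto
    then show ?thesis using x by (simp add: pos_le_divide_eq exp_minus)
  qed
  ultimately show ?thesis by linarith
qed

text \<open>Trades a first power of the increment, whose mean is only of order
  \<open>sqrt h\<close>, for an arbitrarily small constant and a square, whose mean is of order
  \<open>h\<close>.\<close>

lemma le_add_square_div: "a \<le> k + a\<^sup>2 / k" if "k > 0" for a k :: real
proof (cases "a \<le> k")
  case False
  then have "a * k \<le> a\<^sup>2" using that by (simp add: power2_eq_square mult_left_mono)
  then have "a \<le> a\<^sup>2 / k" using that by (simp add: pos_le_divide_eq)
  then show ?thesis using that by linarith
qed (use that in \<open>simp add: add_increasing2\<close>)

text \<open>All upper bounds on \<open>K\<close> share the single constant \<open>B\<close>, and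
  \<open>c\<close> bounds \<open>u\<close> from below. Requiring \<open>B \<ge> 1\<close> lets lower
  powers of \<open>B\<close> be absorbed in \<open>B ^ 3\<close>.\<close>

locale step_bounds =
  fixes u :: "real^'n \<Rightarrow> real" and Du :: "real^'n \<Rightarrow> (real^'n) \<Rightarrow>\<^sub>L real"
    and D2u :: "real^'n \<Rightarrow> (real^'n) \<Rightarrow>\<^sub>L (real^'n) \<Rightarrow>\<^sub>L real"
    and m :: "real^'n \<Rightarrow> real^'n" and dv :: "real^'n \<Rightarrow> real" and \<sigma> :: "real^'n^'n"
    and K :: "(real^'n) set" and B c :: real
  assumes B1: "B \<ge> 1" and c0: "c > 0"
    and u_lower: "\<And>x. x \<in> K \<Longrightarrow> c \<le> u x" and u_upper: "\<And>x. x \<in> K \<Longrightarrow> u x \<le> B"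
    and Du_bound: "\<And>x. x \<in> K \<Longrightarrow> norm (Du x) \<le> B" and D2u_bound: "\<And>x. x \<in> K \<Longrightarrow> norm (D2u x) \<le> B"
    and m_bound: "\<And>x. x \<in> K \<Longrightarrow> norm (m x) \<le> B" and dv_bound: "\<And>x. x \<in> K \<Longrightarrow> \<bar>dv x\<bar> \<le> B"
    and m_lip: "\<And>x y. x \<in> K \<Longrightarrow> y \<in> K \<Longrightarrow> norm (m x - m y) \<le> B * norm (x - y)"
    and dv_lip: "\<And>x y. x \<in> K \<Longrightarrow> y \<in> K \<Longrightarrow> \<bar>dv x - dv y\<bar> \<le> B * norm (x - y)"
    and u_lip: "\<And>x y. x \<in> K \<Longrightarrow> y \<in> K \<Longrightarrow> \<bar>u x - u y\<bar> \<le> B * norm (x - y)"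
    and \<sigma>_bound: "\<And>v. norm (\<sigma> *v v) \<le> B * norm v"
    and m_cont: "continuous_on K m" and dv_cont: "continuous_on K dv"
    and dv_nonpos: "\<And>x. dv x \<le> 0"
    and taylor: "\<And>e. e > 0 \<Longrightarrow> \<exists>C\<ge>0. \<forall>x\<in>K. \<forall>y\<in>K. u y \<le> u x + Du x (y - x) + 1/2 * D2u x (y - x) (y - x)
      + e * (norm (y - x))\<^sup>2 + C * (norm (y - x)) ^ 4"
begin

text \<open>The formal expansion of \<open>u\<close> times the Jacobian of the step: second order in
  the noise \<open>v\<close>, first order in the time \<open>h\<close>. For \<open>v\<close>
  Gaussian with covariance \<open>h\<close> times the identity, its mean is \<open>u\<close> plus
  \<open>h\<close> times the operator applied to \<open>u\<close>.\<close>

definition P :: "real^'n \<Rightarrow> real^'n \<Rightarrow> real \<Rightarrow> real" where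
  "P x v h = u x + Du x (\<sigma> *v v) + 1/2 * D2u x (\<sigma> *v v) (\<sigma> *v v) + h * (Du x (m x) + dv x * u x)"

lemma Du_le: "x \<in> K \<Longrightarrow> \<bar>Du x v\<bar> \<le> B * norm v"
  using norm_blinfun[of "Du x" v] mult_right_mono[OF Du_bound norm_ge_zero[of v]] by fastforce

lemma D2u_le: "x \<in> K \<Longrightarrow> \<bar>D2u x v w\<bar> \<le> B * norm v * norm w"
proof -
  assume "x \<in> K"
  then have "norm (D2u x v) \<le> B * norm v"
    using norm_blinfun[of "D2u x" v] mult_right_mono[OF D2u_bound norm_ge_zero[of v]] by fastforce
  then show ?thesis using norm_blinfun[of "D2u x v" w] mult_right_mono[OF _ norm_ge_zero[of w]]
    by (smt (verit) real_norm_def)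
qed

text \<open>Where the polynomial is negative, the lower bound on \<open>u\<close> forces the increment to be bounded
  away from zero, so a multiple of its fourth power compensates.\<close>
lemma one_step_lower:
  obtains C h0 where "C \<ge> 0" "h0 > 0" "\<And>x v h. \<lbrakk>x \<in> K; 0 \<le> h; h \<le> h0\<rbrakk> \<Longrightarrow> 0 \<le> P x v h + C * norm v ^ 4"
proof -
  \<comment> \<open>A threshold for \<open>norm v\<close>: below it the linear and quadratic terms
    cost at most \<open>c / 4\<close> each. The other half of the lower bound \<open>c\<close> on
    \<open>u\<close> pays for the term in \<open>h\<close>, which dictates
    \<open>h \<le> c / (4 * B ^ 3)\<close>. Capping \<open>k\<close> at 1 makes squares below the
    threshold no larger than \<open>k\<close>.\<close>
  define k where "k = min 1 (c / (4 * B ^ 3))"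
  have B3: "B ^ 3 > 0" using B1 by simp
  have k: "0 < k" "k \<le> 1" "B ^ 3 * k \<le> c / 4"
  proof -
    show "0 < k" "k \<le> 1" using c0 B3 by (auto simp: k_def)
    have "B ^ 3 * k \<le> B ^ 3 * (c / (4 * B ^ 3))" using B3 by (intro mult_left_mono) (auto simp: k_def)
    then show "B ^ 3 * k \<le> c / 4" using B3 by simp
  qed
  \<comment> \<open>Above the threshold \<open>k\<close>, a first power of \<open>norm v\<close> is
    at most the fourth power over \<open>k ^ 3\<close>, and a square is at most the fourth power
    over \<open>k^2\<close>.\<close>
  define C where "C = B ^ 3 * (1 / k ^ 3 + 1 / k\<^sup>2)"
  have "0 \<le> P x v h + C * norm v ^ 4" if x: "x \<in> K" and h: "0 \<le> h" "h \<le> c / (4 * B ^ 3)" for x v h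
  proof -
    let ?a = "norm v"
    have s: "norm (\<sigma> *v v) \<le> B * ?a" by (rule \<sigma>_bound)
    have 1: "Du x (\<sigma> *v v) \<ge> - (B ^ 3 * ?a)"
    proof -
      have "B * norm (\<sigma> *v v) \<le> B * (B * ?a)" using s B1 by (intro mult_left_mono) auto
      also have "\<dots> \<le> B ^ 3 * ?a"
        using B1 mult_right_mono[of 1 B "B * (B * ?a)"] by (simp add: power3_eq_cube mult_ac)
      finally show ?thesis using Du_le[OF x, of "\<sigma> *v v"] by linarith
    qed
    have 2: "1/2 * D2u x (\<sigma> *v v) (\<sigma> *v v) \<ge> - (B ^ 3 * ?a\<^sup>2)"
    proof -
      have "B * norm (\<sigma> *v v) * norm (\<sigma> *v v) \<le> B * (B * ?a) * (B * ?a)"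
        using s B1 by (intro mult_mono) auto
      also have "\<dots> = B ^ 3 * ?a\<^sup>2" by (simp add: power3_eq_cube power2_eq_square mult_ac)
      finally show ?thesis using D2u_le[OF x, of "\<sigma> *v v" "\<sigma> *v v"] by linarith
    qed
    have 3: "h * (Du x (m x) + dv x * u x) \<ge> - (c / 2)"
    proof -
      have "\<bar>Du x (m x)\<bar> \<le> B ^ 3"
      proof -
        have "B * norm (m x) \<le> B * B" using m_bound[OF x] B1 by (intro mult_left_mono) auto
        also have "\<dots> \<le> B ^ 3" using B1 mult_left_mono[of 1 B "B * B"] by (simp add: power3_eq_cube)
        finally show ?thesis using Du_le[OF x, of "m x"] by linarith
      qed
      moreover have "\<bar>dv x * u x\<bar> \<le> B ^ 3"
      proof -
        have "\<bar>dv x\<bar> * \<bar>u x\<bar> \<le> B * B"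
          using dv_bound[OF x] u_upper[OF x] u_lower[OF x] c0 B1 by (intro mult_mono) auto
        also have "\<dots> \<le> B ^ 3" using B1 mult_left_mono[of 1 B "B * B"] by (simp add: power3_eq_cube)
        finally show ?thesis by (simp add: abs_mult)
      qed
      ultimately have "- (2 * B ^ 3) \<le> Du x (m x) + dv x * u x" by linarith
      then have "h * - (2 * B ^ 3) \<le> h * (Du x (m x) + dv x * u x)" using h by (intro mult_left_mono)
      moreover have "h * (2 * B ^ 3) \<le> c / (4 * B ^ 3) * (2 * B ^ 3)"
        using h B3 by (intro mult_right_mono) auto
      moreover have "c / (4 * B ^ 3) * (2 * B ^ 3) = c / 2" using B3 by simp
      ultimately show ?thesis by linarith
    qed
    have a1: "?a \<le> k + ?a ^ 4 / k ^ 3"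
    proof (cases "?a \<le> k")
      case False
      then have "?a * 1 \<le> ?a * (?a / k) ^ 3" using k by (intro mult_left_mono one_le_power) auto
      then show ?thesis using k by (simp add: power_divide power3_eq_cube power4_eq_xxxx)
    qed (use k in \<open>simp add: add_increasing2\<close>)
    have a2: "?a\<^sup>2 \<le> k + ?a ^ 4 / k\<^sup>2"
    proof (cases "?a \<le> k")
      case True
      then have "?a\<^sup>2 \<le> k * 1" using k by (simp only: power2_eq_square) (intro mult_mono, auto)
      then show ?thesis using k by (simp add: add_increasing2)
    next
      case False
      then have "?a\<^sup>2 * 1 \<le> ?a\<^sup>2 * (?a / k)\<^sup>2" using k by (intro mult_left_mono one_le_power) auto
      then show ?thesis using k by (simp add: power_divide power2_eq_square power4_eq_xxxx)
    qed
    have "B ^ 3 * ?a + B ^ 3 * ?a\<^sup>2 \<le> B ^ 3 * (k + ?a ^ 4 / k ^ 3) + B ^ 3 * (k + ?a ^ 4 / k\<^sup>2)"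
      using a1 a2 B3 by (intro add_mono mult_left_mono) auto
    also have "\<dots> = 2 * (B ^ 3 * k) + C * ?a ^ 4" by (simp add: C_def algebra_simps)
    also have "\<dots> \<le> c / 2 + C * ?a ^ 4" using k by linarith
    finally show ?thesis using 1 2 3 u_lower[OF x] unfolding P_def by linarith
  qed
  moreover have "C \<ge> 0" using k B3 by (simp add: C_def)
  moreover have "c / (4 * B ^ 3) > 0" using c0 B3 by simp
  ultimately show ?thesis using that by blast
qed

text \<open>A deterministic estimate for any continuous path in \<open>K\<close> driven by
  \<open>\<beta>\<close>. The errors come from freezing drift and divergence at the start, from the
  Taylor remainder, and from products of \<open>h\<close> with the increment. Those with no decay
  beyond order \<open>h\<close> receive the small factor \<open>e\<close>; the others are collected
  with \<open>C\<close>.\<close>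

lemma one_step_upper:
  assumes e: "e > 0"
  obtains C where "C \<ge> 0"
    "\<And>h \<xi> \<beta>. \<lbrakk>0 < h; h \<le> 1; continuous_on {0..h} \<xi>; continuous_on {0..h} \<beta>;
       \<And>r. r \<in> {0..h} \<Longrightarrow> \<xi> r \<in> K;
       \<And>r. r \<in> {0..h} \<Longrightarrow> \<xi> r = \<xi> 0 + \<sigma> *v \<beta> r + integral {0..r} (\<lambda>s. m (\<xi> s))\<rbrakk>
     \<Longrightarrow> u (\<xi> h) * exp (integral {0..h} (\<lambda>s. dv (\<xi> s))) \<le> P (\<xi> 0) (\<beta> h) h
        + e * (h + (norm (\<beta> h))\<^sup>2) + C * (h\<^sup>2 + norm (\<beta> h) ^ 4 + integral {0..h} (\<lambda>r. (norm (\<beta> r))\<^sup>2))"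
proof -
  \<comment> \<open>The freezing error \<open>B ^ 3 * Q\<close> occurs twice, once through the drift
    and once through the Jacobian; this \<open>k\<close> makes the \<open>k * h\<close> parts of
    both together equal to \<open>e / 2 * h\<close>. The same \<open>k\<close> serves the mixed
    terms \<open>h * a\<close>.\<close>
  define k where "k = e / (4 * B ^ 3)"
  \<comment> \<open>Squared displacements are at most \<open>2 * B^2 * (a^2 + h^2)\<close>, so the
    Taylor error becomes \<open>e / 2 * (a^2 + h^2)\<close>.\<close>
  define e1 where "e1 = e / (4 * B\<^sup>2)"
  have Bpos: "B > 0" "B ^ 3 > 0" "B\<^sup>2 > 0" using B1 by auto
  have k: "k > 0" "2 * B ^ 3 * k = e / 2" using e Bpos by (auto simp: k_def)
  have e1: "e1 > 0" "2 * B\<^sup>2 * e1 = e / 2" using e Bpos by (auto simp: e1_def)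
  obtain C1 where C1: "C1 \<ge> 0" "\<And>x y. x \<in> K \<Longrightarrow> y \<in> K \<Longrightarrow>
      u y \<le> u x + Du x (y - x) + 1/2 * D2u x (y - x) (y - x) + e1 * (norm (y - x))\<^sup>2 + C1 * (norm (y - x)) ^ 4"
    using taylor[OF e1(1)] by blast
  \<comment> \<open>The sum of all coefficients left over at \<open>h^2\<close>,
    \<open>a ^ 4\<close> and \<open>S\<close>, used for each of them; the 5 counts the terms
    \<open>B ^ 3 * h^2\<close>, two from the doubled \<open>Q\<close> and three others.\<close>
  define C where "C = 2 * B ^ 3 / k + 5 * B ^ 3 + e / 2 + 8 * C1 * B ^ 4"
  have C0: "C \<ge> 0" using k e C1 Bpos by (simp add: C_def)
  have "u (\<xi> h) * exp (integral {0..h} (\<lambda>s. dv (\<xi> s))) \<le> P (\<xi> 0) (\<beta> h) h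
        + e * (h + (norm (\<beta> h))\<^sup>2) + C * (h\<^sup>2 + norm (\<beta> h) ^ 4 + integral {0..h} (\<lambda>r. (norm (\<beta> r))\<^sup>2))"
    if h: "0 < h" "h \<le> 1" and c\<xi>: "continuous_on {0..h} \<xi>" and c\<beta>: "continuous_on {0..h} \<beta>"
      and inK: "\<And>r. r \<in> {0..h} \<Longrightarrow> \<xi> r \<in> K"
      and eq: "\<And>r. r \<in> {0..h} \<Longrightarrow> \<xi> r = \<xi> 0 + \<sigma> *v \<beta> r + integral {0..r} (\<lambda>s. m (\<xi> s))" for h \<xi> \<beta>
  proof -
    define x where "x = \<xi> 0"
    define y where "y = \<xi> h"
    define v where "v = \<sigma> *v \<beta> h"
    define a where "a = norm (\<beta> h)"
    define S where "S = integral {0..h} (\<lambda>r. (norm (\<beta> r))\<^sup>2)"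
    define I where "I = integral {0..h} (\<lambda>s. dv (\<xi> s))"
    define g where "g = integral {0..h} (\<lambda>s. m (\<xi> s))"
    \<comment> \<open>The time integral over the step of the bound in \<open>dev\<close>, without
      its factor \<open>B\<close>.\<close>
    define Q where "Q = k * h + S / k + h\<^sup>2"
    have x: "x \<in> K" and y: "y \<in> K" using inK h by (auto simp: x_def y_def)
    have a0: "a \<ge> 0" by (simp add: a_def)
    have cm: "continuous_on {0..h} (\<lambda>s. m (\<xi> s))"
      by (rule continuous_on_compose2[OF m_cont c\<xi>]) (use inK in auto)
    have cd: "continuous_on {0..h} (\<lambda>s. dv (\<xi> s))"
      by (rule continuous_on_compose2[OF dv_cont c\<xi>]) (use inK in auto)
    have cS: "continuous_on {0..h} (\<lambda>r. (norm (\<beta> r))\<^sup>2)" by (intro continuous_intros c\<beta>)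
    have S0: "S \<ge> 0" unfolding S_def by (rule integral_nonneg[OF integrable_continuous_real[OF cS]]) simp
    have Q0: "Q \<ge> 0" using k h S0 by (simp add: Q_def)
    have int_m: "norm (integral {0..r} (\<lambda>s. m (\<xi> s))) \<le> B * h" if r: "r \<in> {0..h}" for r
    proof -
      have "norm (integral {0..r} (\<lambda>s. m (\<xi> s))) \<le> B * (r - 0)"
        using r inK m_bound by (intro integral_bound continuous_on_subset[OF cm]) auto
      also have "\<dots> \<le> B * h" using r Bpos by (intro mult_left_mono) auto
      finally show ?thesis .
    qed
    have dev: "norm (\<xi> r - x) \<le> B * (k + (norm (\<beta> r))\<^sup>2 / k + h)" if r: "r \<in> {0..h}" for r
    proof -
      have "norm (\<xi> r - x) \<le> norm (\<sigma> *v \<beta> r) + norm (integral {0..r} (\<lambda>s. m (\<xi> s)))"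
        using eq[OF r] norm_triangle_ineq[of "\<sigma> *v \<beta> r" "integral {0..r} (\<lambda>s. m (\<xi> s))"] by (simp add: x_def)
      also have "\<dots> \<le> B * norm (\<beta> r) + B * h" using \<sigma>_bound[of "\<beta> r"] int_m[OF r] by linarith
      also have "\<dots> \<le> B * (k + (norm (\<beta> r))\<^sup>2 / k) + B * h"
        using le_add_square_div[OF k(1), of "norm (\<beta> r)"] Bpos by (intro add_mono mult_left_mono) auto
      finally show ?thesis by (simp add: algebra_simps)
    qed
    let ?q = "\<lambda>r. B * (B * (k + (norm (\<beta> r))\<^sup>2 / k + h))"
    have cq: "continuous_on {0..h} ?q" using k by (intro continuous_intros c\<beta>) auto
    have int_q: "integral {0..h} ?q = B\<^sup>2 * Q"
    proof -
      have i: "integral {0..h} (\<lambda>r. (norm (\<beta> r))\<^sup>2 * (1 / k) + (k + h)) = S * (1 / k) + (k + h) * h"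
        using h k integrable_continuous_real[OF cS]
        by (subst Henstock_Kurzweil_Integration.integral_add)
          (auto simp: S_def intro!: integrable_continuous_real continuous_intros c\<beta>)
      have q: "?q = (\<lambda>r. B\<^sup>2 * ((norm (\<beta> r))\<^sup>2 * (1 / k) + (k + h)))"
        by (auto simp: algebra_simps power2_eq_square)
      have "integral {0..h} ?q = B\<^sup>2 * (S * (1 / k) + (k + h) * h)"
        unfolding q i[symmetric] by (rule integral_mult_right)
      then show ?thesis by (simp add: Q_def algebra_simps power2_eq_square)
    qed
    have e_le: "norm (g - h *\<^sub>R m x) \<le> B\<^sup>2 * Q"
    proof -
      have "g - h *\<^sub>R m x = integral {0..h} (\<lambda>s. m (\<xi> s) - m x)"
        using h integrable_continuous_real[OF cm]
        by (subst Henstock_Kurzweil_Integration.integral_diff) (auto simp: g_def)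
      also have "norm \<dots> \<le> integral {0..h} ?q"
      proof (rule Henstock_Kurzweil_Integration.integral_norm_bound_integral)
        fix r assume r: "r \<in> {0..h}"
        have "norm (m (\<xi> r) - m x) \<le> B * norm (\<xi> r - x)" by (rule m_lip[OF inK[OF r] x])
        also have "\<dots> \<le> ?q r" using dev[OF r] Bpos by (intro mult_left_mono) auto
        finally show "norm (m (\<xi> r) - m x) \<le> ?q r" .
      qed (auto intro!: integrable_continuous_real continuous_intros cm cq)
      finally show ?thesis unfolding int_q .
    qed
    have I_le: "\<bar>I - h * dv x\<bar> \<le> B\<^sup>2 * Q"
    proof -
      have "I - h * dv x = integral {0..h} (\<lambda>s. dv (\<xi> s) - dv x)"
        using h integrable_continuous_real[OF cd]
        by (subst Henstock_Kurzweil_Integration.integral_diff) (auto simp: I_def)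
      also have "norm \<dots> \<le> integral {0..h} ?q"
      proof (rule Henstock_Kurzweil_Integration.integral_norm_bound_integral)
        fix r assume r: "r \<in> {0..h}"
        have "norm (dv (\<xi> r) - dv x) \<le> B * norm (\<xi> r - x)" using dv_lip[OF inK[OF r] x] by simp
        also have "\<dots> \<le> ?q r" using dev[OF r] Bpos by (intro mult_left_mono) auto
        finally show "norm (dv (\<xi> r) - dv x) \<le> ?q r" .
      qed (auto intro!: integrable_continuous_real continuous_intros cd cq)
      finally show ?thesis unfolding int_q real_norm_def .
    qed
    have I_nonpos: "I \<le> 0"
      using integral_le[OF integrable_continuous_real[OF cd] integrable_const_ivl[of 0]] dv_nonpos
      by (simp add: I_def)
    have I_abs: "\<bar>I\<bar> \<le> B * h"
      using integral_bound[OF _ cd, of B] h inK dv_bound by (simp add: I_def)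
    have g_le: "norm g \<le> B * h" using int_m[of h] h by (simp add: g_def)
    have v_le: "norm v \<le> B * a" unfolding v_def a_def by (rule \<sigma>_bound)
    have yx: "y - x = v + g" using eq[of h] h by (simp add: y_def x_def v_def g_def)
    have \<delta>_le: "norm (y - x) \<le> B * (a + h)"
      using norm_triangle_ineq[of v g] v_le g_le unfolding yx by (simp add: algebra_simps)
    have t1: "Du x (y - x) \<le> Du x v + h * Du x (m x) + B ^ 3 * Q"
    proof -
      have "Du x (y - x) = Du x v + h * Du x (m x) + Du x (g - h *\<^sub>R m x)"
        by (simp add: yx blinfun.add_right blinfun.diff_right blinfun.scaleR_right)
      moreover have "B * norm (g - h *\<^sub>R m x) \<le> B * (B\<^sup>2 * Q)" using e_le Bpos by (intro mult_left_mono) auto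
      moreover have "B * (B\<^sup>2 * Q) = B ^ 3 * Q" by (simp add: power3_eq_cube power2_eq_square)
      ultimately show ?thesis using Du_le[OF x, of "g - h *\<^sub>R m x"] by linarith
    qed
    \<comment> \<open>With \<open>y - x = v + g\<close> the bilinear form is split into
      \<open>v, v\<close>, then \<open>v, g\<close>, then \<open>g, y - x\<close>; every term other
      than the first contains the drift part \<open>g\<close> of size \<open>B * h\<close>.\<close>
    have t2: "D2u x (y - x) (y - x) \<le> D2u x v v + B ^ 3 * (2 * (h * a) + h\<^sup>2)"
    proof -
      have "D2u x (y - x) (y - x) = D2u x v v + D2u x v g + D2u x g (y - x)"
        by (simp add: yx blinfun.add_right blinfun.add_left)
      moreover have "B * norm v * norm g \<le> B * (B * a) * (B * h)"
        using v_le g_le Bpos a0 by (intro mult_mono) auto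
      moreover have "B * norm g * norm (y - x) \<le> B * (B * h) * (B * (a + h))"
        using \<delta>_le g_le Bpos h by (intro mult_mono) auto
      moreover have "B * (B * a) * (B * h) + B * (B * h) * (B * (a + h)) = B ^ 3 * (2 * (h * a) + h\<^sup>2)"
        by (simp add: power3_eq_cube power2_eq_square algebra_simps)
      ultimately show ?thesis using D2u_le[OF x, of v g] D2u_le[OF x, of g "y - x"] by linarith
    qed
    have d2: "(norm (y - x))\<^sup>2 \<le> 2 * B\<^sup>2 * (a\<^sup>2 + h\<^sup>2)"
    proof -
      have "(norm (y - x))\<^sup>2 \<le> (B * (a + h))\<^sup>2" using \<delta>_le by (intro power_mono) auto
      also have "\<dots> = B\<^sup>2 * (a + h)\<^sup>2" by (simp add: power_mult_distrib)
      also have "\<dots> \<le> B\<^sup>2 * (2 * (a\<^sup>2 + h\<^sup>2))"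
        using sum_squares_bound[of a h] by (intro mult_left_mono) (auto simp: power2_eq_square algebra_simps)
      finally show ?thesis by (simp add: algebra_simps)
    qed
    have d4: "norm (y - x) ^ 4 \<le> 8 * B ^ 4 * (a ^ 4 + h\<^sup>2)"
    proof -
      have "norm (y - x) ^ 4 = ((norm (y - x))\<^sup>2)\<^sup>2" by simp
      also have "\<dots> \<le> (2 * B\<^sup>2 * (a\<^sup>2 + h\<^sup>2))\<^sup>2" using d2 by (intro power_mono) auto
      also have "\<dots> = 4 * B ^ 4 * (a\<^sup>2 + h\<^sup>2)\<^sup>2" by (simp add: power_mult_distrib)
      also have "\<dots> \<le> 4 * B ^ 4 * (2 * (a ^ 4 + h ^ 4))"
        using sum_squares_bound[of "a\<^sup>2" "h\<^sup>2"] Bpos by (intro mult_left_mono) (auto simp: power2_eq_square power4_eq_xxxx algebra_simps)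
      also have "\<dots> \<le> 4 * B ^ 4 * (2 * (a ^ 4 + h\<^sup>2))"
        using h power_decreasing[of 2 4 h] by (intro mult_left_mono add_mono) auto
      finally show ?thesis by (simp add: algebra_simps)
    qed
    have uy: "u y \<le> u x + Du x v + h * Du x (m x) + 1/2 * D2u x v v + B ^ 3 * Q + B ^ 3 * (h * a + h\<^sup>2)
        + e / 2 * (a\<^sup>2 + h\<^sup>2) + 8 * C1 * B ^ 4 * (a ^ 4 + h\<^sup>2)"
    proof -
      have "e1 * (norm (y - x))\<^sup>2 \<le> e1 * (2 * B\<^sup>2 * (a\<^sup>2 + h\<^sup>2))"
        using d2 e1 by (intro mult_left_mono) auto
      moreover have "e1 * (2 * B\<^sup>2 * (a\<^sup>2 + h\<^sup>2)) = e / 2 * (a\<^sup>2 + h\<^sup>2)"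
        using e1(2) by (metis mult.assoc mult.commute)
      moreover have "C1 * norm (y - x) ^ 4 \<le> C1 * (8 * B ^ 4 * (a ^ 4 + h\<^sup>2))"
        using d4 C1 by (intro mult_left_mono) auto
      moreover have "C1 * (8 * B ^ 4 * (a ^ 4 + h\<^sup>2)) = 8 * C1 * B ^ 4 * (a ^ 4 + h\<^sup>2)" by simp
      moreover have "B ^ 3 * (2 * (h * a) + h\<^sup>2) \<le> 2 * (B ^ 3 * (h * a + h\<^sup>2))"
        using Bpos by (simp add: algebra_simps)
      ultimately show ?thesis using C1(2)[OF x y] t1 t2 by linarith
    qed
    \<comment> \<open>The exponent \<open>I\<close> is nonpositive, so the exponential is at most
      its quadratic polynomial. Exchanging \<open>u y\<close> for \<open>u x\<close> in the
      first-order term costs \<open>h\<close> times the displacement.\<close>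
    have ue: "u y * exp I \<le> u y + h * (dv x * u x) + B ^ 3 * (h * a + h\<^sup>2) + B ^ 3 * (Q + h\<^sup>2)"
    proof -
      have uy0: "0 \<le> u y" "u y \<le> B" using u_lower[OF y] u_upper[OF y] c0 by auto
      have "I\<^sup>2 \<le> (B * h)\<^sup>2" using I_abs by (metis abs_ge_zero power2_abs power_mono)
      then have "exp I \<le> 1 + h * dv x + B\<^sup>2 * (Q + h\<^sup>2)"
        using exp_nonpos_le[OF I_nonpos] I_le by (simp add: power_mult_distrib distrib_left)
      then have "u y * exp I \<le> u y * (1 + h * dv x + B\<^sup>2 * (Q + h\<^sup>2))" using uy0 by (intro mult_left_mono)
      also have "\<dots> = u y + h * (dv x * u x) + h * dv x * (u y - u x) + u y * (B\<^sup>2 * (Q + h\<^sup>2))"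
        by (simp add: algebra_simps)
      also have "u y * (B\<^sup>2 * (Q + h\<^sup>2)) \<le> B * (B\<^sup>2 * (Q + h\<^sup>2))"
        using uy0 Q0 by (intro mult_right_mono) auto
      also have "B * (B\<^sup>2 * (Q + h\<^sup>2)) = B ^ 3 * (Q + h\<^sup>2)" by (simp add: power3_eq_cube power2_eq_square)
      also have "h * dv x * (u y - u x) \<le> B ^ 3 * (h * a + h\<^sup>2)"
      proof -
        have "h * dv x * (u y - u x) \<le> \<bar>h * dv x\<bar> * \<bar>u y - u x\<bar>" by (metis abs_ge_self abs_mult)
        also have "\<dots> \<le> (h * B) * (B * (B * (a + h)))"
        proof (rule mult_mono)
          show "\<bar>h * dv x\<bar> \<le> h * B" using h dv_bound[OF x] by (simp add: abs_mult)
          have "B * norm (y - x) \<le> B * (B * (a + h))" using \<delta>_le Bpos by (intro mult_left_mono) auto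
          then show "\<bar>u y - u x\<bar> \<le> B * (B * (a + h))" using u_lip[OF y x] by linarith
        qed (use h Bpos in auto)
        also have "\<dots> = B ^ 3 * (h * a + h\<^sup>2)" by (simp add: power3_eq_cube power2_eq_square algebra_simps)
        finally show ?thesis .
      qed
      finally show ?thesis by simp
    qed
    \<comment> \<open>A weighted arithmetic-geometric mean inequality with weight
      \<open>k\<close>.\<close>
    have ha: "h * a \<le> k * a\<^sup>2 + h\<^sup>2 / k"
    proof -
      have "h * a * k \<le> (k * a)\<^sup>2 + h\<^sup>2"
        using sum_squares_bound[of "k * a" h] zero_le_power2[of "k * a"] zero_le_power2[of h]
          mult_nonneg_nonneg[OF mult_nonneg_nonneg[OF less_imp_le[OF k(1)] a0] less_imp_le[OF h(1)]]
        by (simp add: mult_ac)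
      then show ?thesis using k by (simp add: field_simps power2_eq_square)
    qed
    have f1: "2 * (B ^ 3 * Q) = e / 2 * h + 2 * B ^ 3 / k * S + 2 * (B ^ 3 * h\<^sup>2)"
    proof -
      have "2 * (B ^ 3 * Q) = (2 * B ^ 3 * k) * h + 2 * B ^ 3 / k * S + 2 * (B ^ 3 * h\<^sup>2)"
        by (simp add: Q_def algebra_simps)
      then show ?thesis unfolding k(2) .
    qed
    have f2: "2 * (B ^ 3 * (h * a)) \<le> e / 2 * a\<^sup>2 + 2 * B ^ 3 / k * h\<^sup>2"
    proof -
      have "2 * B ^ 3 * (h * a) \<le> 2 * B ^ 3 * (k * a\<^sup>2 + h\<^sup>2 / k)" using ha Bpos by (intro mult_left_mono) auto
      also have "\<dots> = e / 2 * a\<^sup>2 + 2 * B ^ 3 / k * h\<^sup>2"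
        unfolding k(2)[symmetric] by (simp add: algebra_simps)
      finally show ?thesis by simp
    qed
    have f3: "e / 2 * h \<le> e * h" using e h by simp
    have f4: "2 * B ^ 3 / k * S + (2 * B ^ 3 / k * h\<^sup>2 + 5 * (B ^ 3 * h\<^sup>2) + e / 2 * h\<^sup>2)
        + 8 * C1 * B ^ 4 * (a ^ 4 + h\<^sup>2) \<le> C * (h\<^sup>2 + a ^ 4 + S)"
    proof -
      have "C * (h\<^sup>2 + a ^ 4 + S) - (2 * B ^ 3 / k * S + (2 * B ^ 3 / k * h\<^sup>2 + 5 * (B ^ 3 * h\<^sup>2) + e / 2 * h\<^sup>2)
          + 8 * C1 * B ^ 4 * (a ^ 4 + h\<^sup>2))
        = (2 * B ^ 3 / k + 5 * B ^ 3 + e / 2) * a ^ 4 + (5 * B ^ 3 + e / 2 + 8 * C1 * B ^ 4) * S"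
        unfolding C_def by (simp add: algebra_simps)
      also have "\<dots> \<ge> 0" using k e C1 Bpos S0 a0 by (intro add_nonneg_nonneg mult_nonneg_nonneg) auto
      finally show ?thesis by simp
    qed
    have f5: "u y \<le> u x + Du x v + h * Du x (m x) + 1/2 * D2u x v v + B ^ 3 * Q + (B ^ 3 * (h * a) + B ^ 3 * h\<^sup>2)
        + (e / 2 * a\<^sup>2 + e / 2 * h\<^sup>2) + 8 * C1 * B ^ 4 * (a ^ 4 + h\<^sup>2)"
      using uy by (simp only: distrib_left)
    have f6: "u y * exp I \<le> u y + h * (dv x * u x) + (B ^ 3 * (h * a) + B ^ 3 * h\<^sup>2) + (B ^ 3 * Q + B ^ 3 * h\<^sup>2)"
      using ue by (simp only: distrib_left)
    \<comment> \<open>With a variable for each nonlinear expression the assembly is linear. The two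
      halves \<open>ea2\<close> stem from the mixed terms and from the Taylor remainder.\<close>
    have arith: "\<lbrakk>2 * bQ = eh2 + sk + 2 * bh; 2 * ba \<le> ea2 + hk; eh2 \<le> eh; sk + (hk + 5 * bh + ehh2) + c8 \<le> CC;
        uy \<le> ux + D1 + hm + D2 + bQ + (ba + bh) + (ea2 + ehh2) + c8; uI \<le> uy + hd + (ba + bh) + (bQ + bh)\<rbrakk>
      \<Longrightarrow> uI \<le> ux + D1 + D2 + (hm + hd) + (eh + 2 * ea2) + CC"
      for bQ eh2 sk bh ba ea2 hk eh ehh2 c8 CC uy ux D1 hm D2 uI hd :: real
      by linarith
    from arith[OF f1 f2 f3 f4 f5 f6]
    have "u y * exp I \<le> P x (\<beta> h) h + e * (h + a\<^sup>2) + C * (h\<^sup>2 + a ^ 4 + S)"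
      unfolding P_def v_def[symmetric] by (simp add: distrib_left)
    then show ?thesis by (simp add: x_def y_def a_def S_def I_def)
  qed
  then show ?thesis using that C0 by blast
qed

end

subsection \<open>Joint measurability of the flow\<close>

text \<open>The operator inequality is assumed in trace form, with the Hessian evaluated on the
  columns of \<open>\<sigma>\<close>, since this is the expression that second moments of the
  increments produce.\<close>

locale sde_flow = brownian_motion M b for M :: "'w measure" and b :: "real \<Rightarrow> 'w \<Rightarrow> real^'n" +
  fixes \<sigma> :: "real^'n^'n" and m :: "real^'n \<Rightarrow> real^'n" and Dm :: "real^'n \<Rightarrow> (real^'n) \<Rightarrow>\<^sub>L (real^'n)"
    and LD :: real and X :: "real \<Rightarrow> real^'n \<Rightarrow> 'w \<Rightarrow> real^'n"
    and u :: "real^'n \<Rightarrow> real" and Du :: "real^'n \<Rightarrow> (real^'n) \<Rightarrow>\<^sub>L real"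
    and D2u :: "real^'n \<Rightarrow> (real^'n) \<Rightarrow>\<^sub>L (real^'n) \<Rightarrow>\<^sub>L real"
    and dv :: "real^'n \<Rightarrow> real"
  assumes Dm: "\<And>x. (m has_derivative blinfun_apply (Dm x)) (at x)"
    and Dm_lip: "LD-lipschitz_on UNIV Dm"
    and dv_eq: "\<And>x. dv x = (\<Sum>i\<in>UNIV. Dm x (axis i 1) $ i)"
    and dv_nonpos: "\<And>x. dv x \<le> 0"
    and X_cont: "\<And>x \<omega>. \<omega> \<in> space M \<Longrightarrow> continuous_on {0..} (\<lambda>t. X t x \<omega>)"
    and X_eq: "\<And>t x \<omega>. t \<ge> 0 \<Longrightarrow> \<omega> \<in> space M \<Longrightarrow>
       X t x \<omega> = x + \<sigma> *v b t \<omega> + integral {0..t} (\<lambda>s. m (X s x \<omega>))"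
    and X_bij: "\<And>t \<omega>. t \<ge> 0 \<Longrightarrow> \<omega> \<in> space M \<Longrightarrow> bij (\<lambda>x. X t x \<omega>)"
    and X_diff: "\<And>t x \<omega>. t \<ge> 0 \<Longrightarrow> \<omega> \<in> space M \<Longrightarrow> (\<lambda>x. X t x \<omega>) differentiable (at x)"
    and X_inv_diff: "\<And>t x \<omega>. t \<ge> 0 \<Longrightarrow> \<omega> \<in> space M \<Longrightarrow> inv (\<lambda>x. X t x \<omega>) differentiable (at x)"
    and Du: "\<And>x. (u has_derivative blinfun_apply (Du x)) (at x)"
    and D2u: "\<And>x. (Du has_derivative blinfun_apply (D2u x)) (at x)"
    and D2u_cont: "continuous_on UNIV D2u"
    and u_pos: "\<And>x. u x > 0"
    and generator: "\<And>x. Du x (m x) + dv x * u x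
       + 1/2 * (\<Sum>i\<in>UNIV. D2u x (\<sigma> *v axis i 1) (\<sigma> *v axis i 1)) \<le> 0"
begin

lemma Dm_cont: "continuous_on S Dm"
  using lipschitz_on_continuous_on[OF Dm_lip] continuous_on_subset by blast

lemma path_flow: "\<omega> \<in> space M \<Longrightarrow> additive_flow m Dm (\<lambda>t. \<sigma> *v b t \<omega>) (\<lambda>t x. X t x \<omega>)"
  by unfold_locales (use Dm Dm_cont X_cont X_eq X_bij X_diff X_inv_diff in auto)

lemma divm_eq: "\<omega> \<in> space M \<Longrightarrow> additive_flow.divm Dm = dv"
  by (simp add: fun_eq_iff additive_flow.divm_def[OF path_flow] dv_eq)

lemma u_cont: "continuous_on S u"
  using Du by (meson continuous_at_imp_continuous_on has_derivative_continuous)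

lemma Du_cont: "continuous_on S Du"
  using D2u by (meson continuous_at_imp_continuous_on has_derivative_continuous)

lemma m_cont: "continuous_on S m"
  using Dm by (meson continuous_at_imp_continuous_on has_derivative_continuous)

lemma dv_cont: "continuous_on S dv"
  unfolding dv_eq[abs_def] by (intro continuous_intros continuous_on_component Dm_cont)

lemma [measurable]: "u \<in> borel_measurable borel" "m \<in> borel_measurable borel" "dv \<in> borel_measurable borel"
  by (intro borel_measurable_continuous_onI u_cont m_cont dv_cont)+

lemma X_cont_Icc: "\<omega> \<in> space M \<Longrightarrow> a \<ge> 0 \<Longrightarrow> continuous_on {a..t} (\<lambda>s. X s x \<omega>)"
  by (rule continuous_on_subset[OF X_cont]) auto

lemma dv_X_cont: "\<omega> \<in> space M \<Longrightarrow> a \<ge> 0 \<Longrightarrow> continuous_on {a..t} (\<lambda>s. dv (X s x \<omega>))"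
  by (rule continuous_on_compose2[OF dv_cont X_cont_Icc]) auto

lemma m_X_cont: "\<omega> \<in> space M \<Longrightarrow> a \<ge> 0 \<Longrightarrow> continuous_on {a..t} (\<lambda>s. m (X s x \<omega>))"
  by (rule continuous_on_compose2[OF m_cont X_cont_Icc]) auto

text \<open>The drift is only locally Lipschitz; precomposing it with the projection onto a ball makes the
  Euler scheme converge, and the truncation is inactive once the ball contains the path.\<close>
definition mR :: "nat \<Rightarrow> real^'n \<Rightarrow> real^'n" where
  "mR N y = m (closest_point (cball 0 (real N)) y)"

lemma mR_lipschitz: "\<exists>L. L-lipschitz_on UNIV (mR N)"
proof -
  \<comment> \<open>Any sample point will do: it only gives access to the pathwise setting, and the
    fact taken from there concerns \<open>m\<close> alone.\<close>
  obtain \<omega> where "\<omega> \<in> space M" using not_empty by blast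
  then interpret additive_flow m Dm "\<lambda>t. \<sigma> *v b t \<omega>" "\<lambda>t x. X t x \<omega>" by (rule path_flow)
  obtain L where L: "L-lipschitz_on (cball 0 (real N)) m" using m_lipschitz_on_cball by blast
  have "L-lipschitz_on UNIV (mR N)"
  proof (rule lipschitz_onI)
    fix x y :: "real^'n"
    let ?p = "closest_point (cball 0 (real N))"
    have "dist (mR N x) (mR N y) \<le> L * dist (?p x) (?p y)"
      unfolding mR_def by (intro lipschitz_onD[OF L] closest_point_in_set) auto
    also have "\<dots> \<le> L * dist x y"
      using lipschitz_on_nonneg[OF L] by (intro mult_left_mono closest_point_lipschitz) auto
    finally show "dist (mR N x) (mR N y) \<le> L * dist x y" .
  qed (rule lipschitz_on_nonneg[OF L])
  then show ?thesis by blast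
qed

lemma mR_measurable[measurable]: "mR N \<in> borel_measurable borel"
  using mR_lipschitz[of N] by (auto intro: borel_measurable_continuous_onI lipschitz_on_continuous_on)

text \<open>Only values of \<open>b\<close> at grid times in \<open>[0, t]\<close> enter, so the
  iterates are adapted as well as measurable in the starting point.\<close>

lemma euler_measurable:
  assumes t: "t \<ge> 0" and k: "k \<le> n"
  shows "(\<lambda>p. euler (mR N) (\<lambda>r. \<sigma> *v b r (snd p)) (fst p) t n k) \<in> borel_measurable (borel \<Otimes>\<^sub>M F t)"
  using k
proof (induction k)
  case (Suc k)
  have bm: "(\<lambda>p. \<sigma> *v b (t * real j / real n) (snd p)) \<in> borel_measurable (borel \<Otimes>\<^sub>M F t)" if "j \<le> n" for j
  proof -
    have "t * real j / real n \<le> t"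
      using that t by (cases "n = 0") (auto simp: divide_le_eq mult_left_mono)
    then have [measurable]: "b (t * real j / real n) \<in> borel_measurable (F t)"
      using t by (intro b_measurable_F) auto
    have [measurable]: "(\<lambda>v. \<sigma> *v v) \<in> borel_measurable borel"
      by (intro borel_measurable_continuous_onI continuous_intros)
    show ?thesis by measurable
  qed
  have [measurable]: "(\<lambda>p. euler (mR N) (\<lambda>r. \<sigma> *v b r (snd p)) (fst p) t n k) \<in> borel_measurable (borel \<Otimes>\<^sub>M F t)"
    using Suc by simp
  have [measurable]: "(\<lambda>p. \<sigma> *v b (t * real k / real n) (snd p)) \<in> borel_measurable (borel \<Otimes>\<^sub>M F t)"
    "(\<lambda>p. \<sigma> *v b (t * real (Suc k) / real n) (snd p)) \<in> borel_measurable (borel \<Otimes>\<^sub>M F t)"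
    using bm[of k] bm[of "Suc k"] Suc.prems by simp_all
  show ?case unfolding euler.simps by measurable
qed simp

text \<open>A double limit: Euler iterates for a truncated drift, then growing truncation radius.
  For each starting point and sample the outer sequence is eventually constant, since the path is
  bounded on \<open>[0, t]\<close>. As \<open>lim\<close> is a total function, measurability of the
  inner limit holds whether or not the iterates converge.\<close>

lemma X_joint_measurable:
  assumes t: "t \<ge> 0"
  shows "(\<lambda>p. X t (fst p) (snd p)) \<in> borel_measurable (borel \<Otimes>\<^sub>M F t)"
proof (rule borel_measurable_LIMSEQ_metric)
  let ?E = "\<lambda>N p n. euler (mR N) (\<lambda>r. \<sigma> *v b r (snd p)) (fst p) t n n"
  show "(\<lambda>p. lim (\<lambda>n. ?E N p n)) \<in> borel_measurable (borel \<Otimes>\<^sub>M F t)" for N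
    by (intro borel_measurable_lim_metric euler_measurable t order.refl)
  fix p :: "(real^'n) \<times> 'w" assume "p \<in> space (borel \<Otimes>\<^sub>M F t)"
  then have \<omega>: "snd p \<in> space M" by (auto simp: space_pair_measure)
  interpret additive_flow m Dm "\<lambda>t. \<sigma> *v b t (snd p)" "\<lambda>t x. X t x (snd p)" by (rule path_flow[OF \<omega>])
  obtain C where C: "\<And>r. r \<in> {0..t} \<Longrightarrow> norm (X r (fst p) (snd p)) \<le> C" using path_bounded by blast
  obtain N0 where N0: "C \<le> real N0" using real_arch_simple by blast
  have "lim (\<lambda>n. ?E N p n) = X t (fst p) (snd p)" if "N \<ge> N0" for N
  proof (rule limI)
    obtain L where L: "L-lipschitz_on UNIV (mR N)" using mR_lipschitz by blast
    have eq: "mR N (X r (fst p) (snd p)) = m (X r (fst p) (snd p))" if "r \<in> {0..t}" for r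
      using C[OF that] N0 \<open>N \<ge> N0\<close> unfolding mR_def by (subst closest_point_self) auto
    show "(\<lambda>n. ?E N p n) \<longlonglongrightarrow> X t (fst p) (snd p)"
    proof (rule euler_tendsto[OF L X_cont_Icc[OF \<omega>] t])
      show "X r (fst p) (snd p) = fst p + \<sigma> *v b r (snd p) + integral {0..r} (\<lambda>s. mR N (X s (fst p) (snd p)))"
        if "r \<in> {0..t}" for r
        using that eq X_eq[of r "fst p"]
        by (auto intro!: Henstock_Kurzweil_Integration.integral_cong)
    qed (auto simp: b_0[OF \<omega>])
  qed
  then show "(\<lambda>N. lim (\<lambda>n. ?E N p n)) \<longlonglongrightarrow> X t (fst p) (snd p)"
    by (intro tendsto_eventually eventually_sequentiallyI)
qed

lemma measurable_pair_F_mono: "f \<in> borel \<Otimes>\<^sub>M F s \<rightarrow>\<^sub>M N \<Longrightarrow> s \<le> t \<Longrightarrow> f \<in> borel \<Otimes>\<^sub>M F t \<rightarrow>\<^sub>M N"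
proof -
  assume f: "f \<in> borel \<Otimes>\<^sub>M F s \<rightarrow>\<^sub>M N" and st: "s \<le> t"
  have "(\<lambda>\<omega>. \<omega>) \<in> F t \<rightarrow>\<^sub>M F s" by (rule measurable_F_mono[OF measurable_ident_sets[OF refl] st])
  then have "(\<lambda>p. (fst p, snd p)) \<in> borel \<Otimes>\<^sub>M F t \<rightarrow>\<^sub>M borel \<Otimes>\<^sub>M F s"
    by (intro measurable_Pair measurable_fst measurable_compose[OF measurable_snd])
  from measurable_compose[OF this f] show ?thesis by simp
qed

section \<open>The Jacobian, the weighted process and the survival events\<close>

definition J :: "real \<Rightarrow> real^'n \<Rightarrow> 'w \<Rightarrow> real" where
  "J t x \<omega> = exp (integral {0..t} (\<lambda>s. dv (X s x \<omega>)))"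

definition Z :: "real \<Rightarrow> real^'n \<Rightarrow> 'w \<Rightarrow> real" where
  "Z t x \<omega> = J t x \<omega> * u (X t x \<omega>)"

lemma J_joint_measurable:
  assumes t: "t \<ge> 0"
  shows "(\<lambda>p. J t (fst p) (snd p)) \<in> borel_measurable (borel \<Otimes>\<^sub>M F t)"
proof -
  have "(\<lambda>p. integral {0..t} (\<lambda>s. dv (X s (fst p) (snd p)))) \<in> borel_measurable (borel \<Otimes>\<^sub>M F t)"
  proof (rule borel_measurable_LIMSEQ_real)
    fix p :: "(real^'n) \<times> 'w" assume "p \<in> space (borel \<Otimes>\<^sub>M F t)"
    then have \<omega>: "snd p \<in> space M" by (auto simp: space_pair_measure)
    show "(\<lambda>n. \<Sum>k<n. (t / real n) *\<^sub>R dv (X (t * real k / real n) (fst p) (snd p))) \<longlonglongrightarrow>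
       integral {0..t} (\<lambda>s. dv (X s (fst p) (snd p)))"
      by (rule riemann_sum_tendsto[OF dv_X_cont[OF \<omega>] t]) simp
  next
    fix n
    have Xk: "(\<lambda>p. X (t * real k / real n) (fst p) (snd p)) \<in> borel_measurable (borel \<Otimes>\<^sub>M F t)" if "k < n" for k
    proof (rule measurable_pair_F_mono[OF X_joint_measurable])
      show "t * real k / real n \<le> t" using that t by (simp add: divide_le_eq mult_left_mono)
    qed (use t in simp)
    have "(\<lambda>p. dv (X (t * real k / real n) (fst p) (snd p))) \<in> borel_measurable (borel \<Otimes>\<^sub>M F t)" if "k < n" for k
      by (rule measurable_compose[OF Xk[OF that]]) measurable
    then show "(\<lambda>p. \<Sum>k<n. (t / real n) *\<^sub>R dv (X (t * real k / real n) (fst p) (snd p))) \<in> borel_measurable (borel \<Otimes>\<^sub>M F t)"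
      by (intro borel_measurable_sum borel_measurable_scaleR borel_measurable_const) simp
  qed
  then show ?thesis unfolding J_def by measurable
qed

lemma Z_joint_measurable:
  assumes t: "t \<ge> 0"
  shows "(\<lambda>p. Z t (fst p) (snd p)) \<in> borel_measurable (borel \<Otimes>\<^sub>M F t)"
  unfolding Z_def
  by (intro borel_measurable_times J_joint_measurable t measurable_compose[OF X_joint_measurable[OF t]]) measurable

lemma fixed_start_measurable:
  assumes t: "t \<ge> 0"
  shows "X t x \<in> borel_measurable (F t)" "J t x \<in> borel_measurable (F t)" "Z t x \<in> borel_measurable (F t)"
  using measurable_compose[OF measurable_Pair1'[of x borel "F t"] X_joint_measurable[OF t]]
    measurable_compose[OF measurable_Pair1'[of x borel "F t"] J_joint_measurable[OF t]]
    measurable_compose[OF measurable_Pair1'[of x borel "F t"] Z_joint_measurable[OF t]]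
  by simp_all

lemma J_pos: "J t x \<omega> > 0" by (simp add: J_def)

lemma J_le_1: "\<omega> \<in> space M \<Longrightarrow> J t x \<omega> \<le> 1"
  using integral_le[OF integrable_continuous_real[OF dv_X_cont[of \<omega> 0 t x]] integrable_const_ivl[of 0]] dv_nonpos
  by (simp add: J_def)

text \<open>The event of survival up to time \<open>t\<close>. The whole past is constrained, so the
  event shrinks with time and killing is irrevocable.\<close>

definition G :: "real \<Rightarrow> real \<Rightarrow> real^'n \<Rightarrow> 'w set" where
  "G R t x = {\<omega> \<in> space M. \<forall>r\<in>{0..t}. norm (X r x \<omega>) \<le> R}"

lemma G_antimono: "s \<le> t \<Longrightarrow> G R t x \<subseteq> G R s x"
  by (auto simp: G_def)

text \<open>By continuity of the path the condition at all times follows from the condition at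
  rational times, which is a countable intersection.\<close>

lemma G_measurable:
  assumes t: "t \<ge> 0"
  shows "G R t x \<in> sets (F t)"
proof -
  have "norm (X r x \<omega>) \<le> R" if \<omega>: "\<omega> \<in> space M" and Q: "\<And>q. q \<in> {0..t} \<inter> \<rat> \<Longrightarrow> norm (X q x \<omega>) \<le> R"
    and r: "r \<in> {0..t}" for r \<omega>
  proof (cases "t = 0")
    case True
    then show ?thesis using Q[of 0] r by auto
  next
    case False
    then have t0: "t > 0" using t by simp
    show ?thesis
    proof (rule ccontr)
      assume "\<not> norm (X r x \<omega>) \<le> R"
      then have e: "norm (X r x \<omega>) - R > 0" by simp
      have "continuous_on {0..t} (\<lambda>s. norm (X s x \<omega>))" by (intro continuous_intros X_cont_Icc \<omega>) auto
      then obtain d where d: "d > 0" "\<And>q. q \<in> {0..t} \<Longrightarrow> dist q r < d \<Longrightarrow>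
          dist (norm (X q x \<omega>)) (norm (X r x \<omega>)) < norm (X r x \<omega>) - R"
        using e r unfolding continuous_on_iff by metis
      \<comment> \<open>The interval is cut to \<open>(0, t)\<close> so that the rational time stays
        admissible; it would be empty for \<open>t = 0\<close>, hence the separate case.\<close>
      have "max 0 (r - d) < min t (r + d)" using t0 d(1) r by auto
      then obtain q where q: "q \<in> \<rat>" "max 0 (r - d) < q" "q < min t (r + d)"
        using Rats_dense_in_real by blast
      then have "dist (norm (X q x \<omega>)) (norm (X r x \<omega>)) < norm (X r x \<omega>) - R"
        by (intro d(2)) (auto simp: dist_real_def)
      moreover have "norm (X q x \<omega>) \<le> R" using q by (intro Q) auto
      ultimately show False by (simp add: dist_real_def)
    qed
  qed
  then have eq: "G R t x = {\<omega> \<in> space (F t). \<forall>q\<in>{0..t} \<inter> \<rat>. norm (X q x \<omega>) \<le> R}"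
    by (auto simp: G_def)
  have cnt: "countable ({0..t} \<inter> \<rat>)" using countable_rat by (rule countable_subset[rotated]) auto
  have "X q x \<in> borel_measurable (F t)" if "q \<in> {0..t} \<inter> \<rat>" for q
    using that by (intro measurable_F_mono[OF fixed_start_measurable(1)]) auto
  then have "{\<omega> \<in> space (F t). norm (X q x \<omega>) \<le> R} \<in> sets (F t)" if "q \<in> {0..t} \<inter> \<rat>" for q
    using that by measurable
  then show ?thesis unfolding eq by (intro sets.sets_Collect_countable_All' cnt)
qed

end

subsection \<open>The killed process\<close>

text \<open>The interval is cut into equal steps shorter than \<open>h0\<close>, with error rate
  \<open>e / (t - s)\<close>, so the errors add up to \<open>e\<close>. It is essential that
  \<open>h0\<close> depends on \<open>e\<close> alone and not on the time.\<close>

lemma decreasing_of_small_increments: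
  fixes g :: "real \<Rightarrow> real"
  assumes g: "\<And>e. e > 0 \<Longrightarrow> \<exists>h0>0. \<forall>t\<ge>s. \<forall>h. 0 < h \<and> h \<le> h0 \<longrightarrow> g (t + h) \<le> g t + e * h"
    and st: "s \<le> t"
  shows "g t \<le> g s"
proof (cases "s = t")
  case False
  then have lt: "s < t" using st by simp
  show ?thesis
  proof (rule field_le_epsilon)
    fix e :: real assume "e > 0"
    then have "e / (t - s) > 0" using lt by simp
    from g[OF this] obtain h0 where h0: "h0 > 0"
      "\<And>t' h. t' \<ge> s \<Longrightarrow> 0 < h \<Longrightarrow> h \<le> h0 \<Longrightarrow> g (t' + h) \<le> g t' + e / (t - s) * h" by blast
    obtain n where n: "real n > (t - s) / h0" using reals_Archimedean2 by blast
    moreover have "(t - s) / h0 > 0" using lt h0 by simp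
    ultimately have n0: "real n > 0" by linarith
    define h where "h = (t - s) / real n"
    have h: "0 < h" "h \<le> h0" using n n0 lt h0 by (auto simp: h_def field_simps)
    have "g (s + real k * h) \<le> g s + e / (t - s) * (real k * h)" for k
    proof (induction k)
      case (Suc k)
      have "g ((s + real k * h) + h) \<le> g (s + real k * h) + e / (t - s) * h"
        using h by (intro h0) auto
      then show ?case using Suc by (simp add: algebra_simps)
    qed simp
    from this[of n] show "g t \<le> g s + e" using n0 lt by (simp add: h_def)
  qed
qed simp

context sde_flow begin

lemma bounded_on_cball:
  assumes "continuous_on UNIV f"
  obtains B where "B \<ge> 0" "\<And>x::real^'n. norm x \<le> R \<Longrightarrow> norm (f x) \<le> B"
proof -
  have "bounded (f ` cball 0 R)"
    by (intro compact_imp_bounded compact_continuous_image continuous_on_subset[OF assms]) auto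
  then obtain B where "\<And>x. x \<in> cball 0 R \<Longrightarrow> norm (f x) \<le> B" unfolding bounded_iff by blast
  then show ?thesis by (intro that[of "max B 0"]) (auto simp: le_max_iff_disj)
qed

text \<open>Here the Lipschitz derivative of the drift enters quantitatively: freezing the
  divergence along a path costs no more than a multiple of the distance travelled.\<close>

lemma dv_lipschitz: "\<bar>dv x - dv y\<bar> \<le> (real CARD('n) * LD) * norm (x - y)"
proof -
  have "\<bar>dv x - dv y\<bar> = \<bar>\<Sum>i\<in>UNIV. ((Dm x - Dm y) (axis i 1)) $ i\<bar>"
    by (simp add: dv_eq sum_subtractf blinfun.diff_left)
  also have "\<dots> \<le> (\<Sum>i\<in>UNIV. \<bar>((Dm x - Dm y) (axis i 1)) $ i\<bar>)" by (rule sum_abs)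
  also have "\<dots> \<le> (\<Sum>i\<in>(UNIV :: 'n set). LD * norm (x - y))"
  proof (rule sum_mono)
    fix i :: 'n
    have "\<bar>((Dm x - Dm y) (axis i 1)) $ i\<bar> \<le> norm ((Dm x - Dm y) (axis i 1))" by (rule component_le_norm_cart)
    also have "\<dots> \<le> norm (Dm x - Dm y) * norm (axis i (1::real))" by (rule norm_blinfun)
    also have "\<dots> \<le> LD * norm (x - y)"
      using lipschitz_onD[OF Dm_lip, of x y] by (simp add: dist_norm)
    finally show "\<bar>((Dm x - Dm y) (axis i 1)) $ i\<bar> \<le> LD * norm (x - y)" .
  qed
  finally show ?thesis by simp
qed

lemma ex_step_bounds: "\<exists>B c. step_bounds u Du D2u m dv \<sigma> (cball 0 (real N)) B c"
proof -
  let ?K = "cball 0 (real N) :: (real^'n) set"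
  obtain \<omega> where "\<omega> \<in> space M" using not_empty by blast
  then interpret additive_flow m Dm "\<lambda>t. \<sigma> *v b t \<omega>" "\<lambda>t x. X t x \<omega>" by (rule path_flow)
  obtain Lm where Lm: "Lm-lipschitz_on ?K m" using m_lipschitz_on_cball by blast
  obtain bu where bu: "bu \<ge> 0" "\<And>x. norm x \<le> real N \<Longrightarrow> norm (u x) \<le> bu" using bounded_on_cball[OF u_cont] by metis
  obtain b1 where b1: "b1 \<ge> 0" "\<And>x. norm x \<le> real N \<Longrightarrow> norm (Du x) \<le> b1" using bounded_on_cball[OF Du_cont] by metis
  obtain b2 where b2: "b2 \<ge> 0" "\<And>x. norm x \<le> real N \<Longrightarrow> norm (D2u x) \<le> b2" using bounded_on_cball[OF D2u_cont] by metis
  obtain bm where bm: "bm \<ge> 0" "\<And>x. norm x \<le> real N \<Longrightarrow> norm (m x) \<le> bm" using bounded_on_cball[OF m_cont] by metis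
  obtain bd where bd: "bd \<ge> 0" "\<And>x. norm x \<le> real N \<Longrightarrow> norm (dv x) \<le> bd" using bounded_on_cball[OF dv_cont] by metis
  define bs where "bs = onorm ((*v) \<sigma>)"
  have bs: "bs \<ge> 0" "\<And>v. norm (\<sigma> *v v) \<le> bs * norm v"
    unfolding bs_def by (auto intro!: onorm_pos_le onorm)
  have Lm0: "Lm \<ge> 0" using lipschitz_on_nonneg[OF Lm] .
  have LD0: "real CARD('n) * LD \<ge> 0" using lipschitz_on_nonneg[OF Dm_lip] by simp
  \<comment> \<open>The sum dominates each of its nonnegative summands, so one constant serves all
    bounds.\<close>
  define B where "B = 1 + bu + b1 + b2 + bm + bd + bs + Lm + real CARD('n) * LD"
  have Bge: "bu \<le> B" "b1 \<le> B" "b2 \<le> B" "bm \<le> B" "bd \<le> B" "bs \<le> B" "Lm \<le> B" "real CARD('n) * LD \<le> B" "1 \<le> B"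
    unfolding B_def using bu(1) b1(1) b2(1) bm(1) bd(1) bs(1) Lm0 LD0 by linarith+
  \<comment> \<open>The positive lower bound for \<open>u\<close> is its minimum, attained by
    compactness of the ball.\<close>
  obtain x0 where x0: "x0 \<in> ?K" "\<And>x. x \<in> ?K \<Longrightarrow> u x0 \<le> u x"
    using continuous_attains_inf[of ?K u] u_cont by auto
  have "step_bounds u Du D2u m dv \<sigma> ?K B (u x0)"
  proof
    show "1 \<le> B" by (rule Bge)
    show "0 < u x0" by (rule u_pos)
    show "u x0 \<le> u x" if "x \<in> ?K" for x using x0(2)[OF that] .
    show "u x \<le> B" if "x \<in> ?K" for x using bu(2)[of x] that Bge by auto
    show "norm (Du x) \<le> B" if "x \<in> ?K" for x using b1(2)[of x] that Bge by auto
    show "norm (D2u x) \<le> B" if "x \<in> ?K" for x using b2(2)[of x] that Bge by auto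
    show "norm (m x) \<le> B" if "x \<in> ?K" for x using bm(2)[of x] that Bge by auto
    show "\<bar>dv x\<bar> \<le> B" if "x \<in> ?K" for x using bd(2)[of x] that Bge by auto
    show "norm (m x - m y) \<le> B * norm (x - y)" if "x \<in> ?K" "y \<in> ?K" for x y
      using lipschitz_onD[OF Lm that] mult_right_mono[OF Bge(7) norm_ge_zero[of "x - y"]] by (simp add: dist_norm)
    show "\<bar>dv x - dv y\<bar> \<le> B * norm (x - y)" if "x \<in> ?K" "y \<in> ?K" for x y
      using dv_lipschitz[of x y] mult_right_mono[OF Bge(8) norm_ge_zero[of "x - y"]] by linarith
    show "\<bar>u x - u y\<bar> \<le> B * norm (x - y)" if "x \<in> ?K" "y \<in> ?K" for x y
    proof -
      have "norm (u x - u y) \<le> b1 * norm (x - y)"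
        by (rule differentiable_bound[where S="?K" and f'="\<lambda>x. blinfun_apply (Du x)"])
          (use Du b1 that in \<open>auto simp: norm_blinfun.rep_eq[symmetric] intro: has_derivative_at_withinI\<close>)
      then show ?thesis using mult_right_mono[OF Bge(2) norm_ge_zero[of "x - y"]] by simp
    qed
    show "norm (\<sigma> *v v) \<le> B * norm v" for v
      using bs(2)[of v] mult_right_mono[OF Bge(6) norm_ge_zero[of v]] by linarith
    show "\<exists>C\<ge>0. \<forall>x\<in>?K. \<forall>y\<in>?K. u y \<le> u x + Du x (y - x) + 1/2 * D2u x (y - x) (y - x)
      + e * (norm (y - x))\<^sup>2 + C * (norm (y - x)) ^ 4" if "e > 0" for e
      by (rule taylor2_upper[OF Du D2u D2u_cont compact_cball convex_cball that])
  qed (rule m_cont dv_cont dv_nonpos)+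
  then show ?thesis by blast
qed

text \<open>Everything that multiplies \<open>u\<close> at time \<open>t\<close>: the test event of
  the past, survival, and the Jacobian. For \<open>A\<close> in \<open>F t\<close> it is known at
  time \<open>t\<close>, so it can be part of a coefficient independent of the next
  increment.\<close>

definition weight :: "'w set \<Rightarrow> nat \<Rightarrow> real \<Rightarrow> real^'n \<Rightarrow> 'w \<Rightarrow> real" where
  "weight A N t x \<omega> = indicator (A \<inter> G (real N) t x) \<omega> * J t x \<omega>"

text \<open>Survival confines \<open>X t x\<close> to a ball, where the continuous \<open>q\<close>
  is bounded, and the Jacobian is at most 1; integrability therefore holds for arbitrary growth of
  \<open>q\<close>.\<close>

lemma weight_coefficient:
  fixes q :: "real^'n \<Rightarrow> real"
  assumes t: "t \<ge> 0" and A: "A \<in> sets (F t)" and q: "continuous_on UNIV q"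
  shows "(\<lambda>\<omega>. weight A N t x \<omega> * q (X t x \<omega>)) \<in> borel_measurable (F t)"
    and "integrable M (\<lambda>\<omega>. weight A N t x \<omega> * q (X t x \<omega>))"
proof -
  note [measurable] = fixed_start_measurable[OF t, of x] G_measurable[OF t, of "real N" x] A
    borel_measurable_continuous_onI[OF q]
  show meas: "(\<lambda>\<omega>. weight A N t x \<omega> * q (X t x \<omega>)) \<in> borel_measurable (F t)"
    unfolding weight_def by measurable
  obtain B where B: "B \<ge> 0" "\<And>y. norm y \<le> real N \<Longrightarrow> norm (q y) \<le> B" using bounded_on_cball[OF q] by metis
  show "integrable M (\<lambda>\<omega>. weight A N t x \<omega> * q (X t x \<omega>))"
  proof (rule integrable_const_bound[where B=B])
    show "AE \<omega> in M. norm (weight A N t x \<omega> * q (X t x \<omega>)) \<le> B"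
    proof (rule AE_I2)
      fix \<omega> assume \<omega>: "\<omega> \<in> space M"
      show "norm (weight A N t x \<omega> * q (X t x \<omega>)) \<le> B"
      proof (cases "\<omega> \<in> A \<inter> G (real N) t x")
        case True
        then have "norm (X t x \<omega>) \<le> real N" using t by (auto simp: G_def)
        then have "J t x \<omega> * norm (q (X t x \<omega>)) \<le> 1 * B"
          using B J_le_1[OF \<omega>, of t x] less_imp_le[OF J_pos[of t x \<omega>]] by (intro mult_mono) auto
        then show ?thesis using True less_imp_le[OF J_pos[of t x \<omega>]] by (simp add: weight_def abs_mult)
      qed (use B in \<open>auto simp: weight_def\<close>)
    qed
  qed (rule measurable_F_M[OF meas])
qed

lemma integral_split_shift:
  fixes f :: "real \<Rightarrow> 'a::banach"
  assumes f: "continuous_on {0..t + r} f" and "t \<ge> 0" "r \<ge> 0"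
  shows "integral {0..t + r} f = integral {0..t} f + integral {0..r} (\<lambda>q. f (t + q))"
proof -
  have "integral {0..t} f + integral {t..t + r} f = integral {0..t + r} f"
    using assms by (intro Henstock_Kurzweil_Integration.integral_combine integrable_continuous_real) auto
  moreover have "integral {0..r} (f \<circ> (+) t) = integral {0 + t..r + t} f" by (rule integral_shift_Icc_real)
  ultimately show ?thesis by (simp add: o_def add.commute)
qed

text \<open>After time \<open>t\<close> the path solves the same equation from \<open>X t x\<close>,
  driven by the increments of \<open>b\<close>, and the Jacobian is multiplicative; this is the
  format of the one-step estimates.\<close>

lemma restarted_path:
  assumes t: "t \<ge> 0" and r: "r \<ge> 0" and \<omega>: "\<omega> \<in> space M"
  shows "X (t + r) x \<omega> = X t x \<omega> + \<sigma> *v (b (t + r) \<omega> - b t \<omega>) + integral {0..r} (\<lambda>q. m (X (t + q) x \<omega>))"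
    and "J (t + r) x \<omega> = J t x \<omega> * exp (integral {0..r} (\<lambda>q. dv (X (t + q) x \<omega>)))"
proof -
  show "X (t + r) x \<omega> = X t x \<omega> + \<sigma> *v (b (t + r) \<omega> - b t \<omega>) + integral {0..r} (\<lambda>q. m (X (t + q) x \<omega>))"
    using X_eq[OF _ \<omega>, of "t + r" x] X_eq[OF t \<omega>, of x] t r
      integral_split_shift[OF m_X_cont[OF \<omega>, of 0 "t + r" x] t r]
    by (simp add: matrix_vector_mult_diff_distrib)
  show "J (t + r) x \<omega> = J t x \<omega> * exp (integral {0..r} (\<lambda>q. dv (X (t + q) x \<omega>)))"
    using integral_split_shift[OF dv_X_cont[OF \<omega>, of 0 "t + r" x] t r] by (simp add: J_def exp_add)
qed

lemma matrix_vector_basis_expansion: "\<sigma> *v v = (\<Sum>i\<in>UNIV. v $ i *\<^sub>R (\<sigma> *v axis i 1))"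
  by (subst basis_expansion[of v, symmetric])
    (simp add: linear_sum[OF matrix_vector_mul_linear] scalar_mult_eq_scaleR linear_cmul[OF matrix_vector_mul_linear])

text \<open>The first-order term integrates to zero and the second-order one to the trace term, because the
  coefficients are known at time \<open>t\<close> and the increment is independent of the past.\<close>
lemma expected_quadratic_le:
  assumes t: "t \<ge> 0" and h: "h > 0" and A: "A \<in> sets (F t)"
    and bounds: "step_bounds u Du D2u m dv \<sigma> (cball 0 (real N)) B c"
  shows "integrable M (\<lambda>\<omega>. weight A N t x \<omega> * step_bounds.P u Du D2u m dv \<sigma> (X t x \<omega>) (b (t + h) \<omega> - b t \<omega>) h)"
    and "(\<integral>\<omega>. weight A N t x \<omega> * step_bounds.P u Du D2u m dv \<sigma> (X t x \<omega>) (b (t + h) \<omega> - b t \<omega>) h \<partial>M)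
      \<le> (\<integral>\<omega>. weight A N t x \<omega> * u (X t x \<omega>) \<partial>M)"
proof -
  note cont = Du_cont m_cont dv_cont u_cont
  interpret step_bounds u Du D2u m dv \<sigma> "cball 0 (real N)" B c by (rule bounds)
  let ?D = "\<lambda>\<omega>. b (t + h) \<omega> - b t \<omega>" and ?w = "weight A N t x" and ?X = "X t x"
  let ?p = "\<lambda>i y. Du y (\<sigma> *v axis i 1)" and ?q = "\<lambda>i j y. D2u y (\<sigma> *v axis i 1) (\<sigma> *v axis j 1)"
  let ?k = "\<lambda>y. Du y (m y) + dv y * u y"
  have cp: "continuous_on UNIV (?p i)" for i by (intro continuous_intros Du_cont)
  have cq: "continuous_on UNIV (?q i j)" for i j by (intro continuous_intros D2u_cont)
  have ck: "continuous_on UNIV ?k" by (intro continuous_intros cont)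
  note coef = weight_coefficient[OF t A, where N=N and x=x]
  have st: "0 \<le> t" "t < t + h" using t h by auto
  note mom = increment_moments[OF st]
  have h1: "has_bochner_integral M (\<lambda>\<omega>. (?w \<omega> * ?p i (?X \<omega>)) * ?D \<omega> $ i) 0" for i
    using increment_indep[OF st coef[OF cp], of "\<lambda>v. v $ i"] mom(1,2)[of i]
    by (simp add: has_bochner_integral_iff del: vector_minus_component)
  have h2: "has_bochner_integral M (\<lambda>\<omega>. (?w \<omega> * ?q i j (?X \<omega>)) * (?D \<omega> $ i * ?D \<omega> $ j))
      (if i = j then h * (\<integral>\<omega>. ?w \<omega> * ?q i i (?X \<omega>) \<partial>M) else 0)" for i j
    using increment_indep[OF st coef[OF cq], of "\<lambda>v. v $ i * v $ j"] mom(3,4)[of i j]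
    by (simp add: has_bochner_integral_iff del: vector_minus_component)
  have h0: "has_bochner_integral M (\<lambda>\<omega>. ?w \<omega> * u (?X \<omega>)) (\<integral>\<omega>. ?w \<omega> * u (?X \<omega>) \<partial>M)"
    using coef(2)[OF u_cont] by (simp add: has_bochner_integral_iff)
  have h3: "has_bochner_integral M (\<lambda>\<omega>. ?w \<omega> * ?k (?X \<omega>)) (\<integral>\<omega>. ?w \<omega> * ?k (?X \<omega>) \<partial>M)"
    using coef(2)[OF ck] by (simp add: has_bochner_integral_iff)
  \<comment> \<open>Carrying integrand and value together yields integrability and the mean of the
    expanded polynomial in one derivation.\<close>
  have total: "has_bochner_integral M (\<lambda>\<omega>. ?w \<omega> * u (?X \<omega>) + (\<Sum>i\<in>UNIV. (?w \<omega> * ?p i (?X \<omega>)) * ?D \<omega> $ i)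
      + 1/2 * (\<Sum>i\<in>UNIV. \<Sum>j\<in>UNIV. (?w \<omega> * ?q i j (?X \<omega>)) * (?D \<omega> $ i * ?D \<omega> $ j)) + h * (?w \<omega> * ?k (?X \<omega>)))
    ((\<integral>\<omega>. ?w \<omega> * u (?X \<omega>) \<partial>M) + (\<Sum>i\<in>(UNIV :: 'n set). 0)
      + 1/2 * (\<Sum>i\<in>UNIV. \<Sum>j\<in>UNIV. if i = j then h * (\<integral>\<omega>. ?w \<omega> * ?q i i (?X \<omega>) \<partial>M) else 0)
      + h * (\<integral>\<omega>. ?w \<omega> * ?k (?X \<omega>) \<partial>M))"
    by (intro has_bochner_integral_add has_bochner_integral_sum has_bochner_integral_mult_right h0 h1 h2 h3)
  have P_expand: "?w \<omega> * P (?X \<omega>) (?D \<omega>) h = ?w \<omega> * u (?X \<omega>) + (\<Sum>i\<in>UNIV. (?w \<omega> * ?p i (?X \<omega>)) * ?D \<omega> $ i)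
      + 1/2 * (\<Sum>i\<in>UNIV. \<Sum>j\<in>UNIV. (?w \<omega> * ?q i j (?X \<omega>)) * (?D \<omega> $ i * ?D \<omega> $ j)) + h * (?w \<omega> * ?k (?X \<omega>))" for \<omega>
  proof -
    let ?v = "?D \<omega>" and ?y = "?X \<omega>"
    have e1: "Du ?y (\<sigma> *v ?v) = (\<Sum>i\<in>UNIV. ?p i ?y * ?v $ i)"
      by (subst matrix_vector_basis_expansion) (simp add: blinfun.sum_right blinfun.scaleR_right mult.commute del: vector_minus_component)
    have e2: "D2u ?y (\<sigma> *v ?v) (\<sigma> *v ?v) = (\<Sum>i\<in>UNIV. \<Sum>j\<in>UNIV. ?q i j ?y * (?v $ i * ?v $ j))"
    proof -
      have left: "D2u ?y (\<sigma> *v ?v) w = (\<Sum>i\<in>UNIV. ?v $ i * D2u ?y (\<sigma> *v axis i 1) w)" for w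
        by (subst matrix_vector_basis_expansion)
          (simp add: blinfun.sum_right blinfun.sum_left blinfun.scaleR_right blinfun.scaleR_left del: vector_minus_component)
      have right: "D2u ?y z (\<sigma> *v ?v) = (\<Sum>j\<in>UNIV. ?v $ j * D2u ?y z (\<sigma> *v axis j 1))" for z
        by (subst matrix_vector_basis_expansion)
          (simp add: blinfun.sum_right blinfun.scaleR_right del: vector_minus_component)
      show ?thesis unfolding left unfolding right by (simp add: sum_distrib_left mult_ac del: vector_minus_component)
    qed
    show ?thesis unfolding P_def e1 e2
      by (simp add: distrib_left sum_distrib_left mult_ac del: vector_minus_component)
  qed
  show "integrable M (\<lambda>\<omega>. ?w \<omega> * P (?X \<omega>) (?D \<omega>) h)"
    using total unfolding P_expand has_bochner_integral_iff by blast
  have gen_int: "integrable M (\<lambda>\<omega>. ?w \<omega> * ?k (?X \<omega>))" "\<And>i. integrable M (\<lambda>\<omega>. ?w \<omega> * ?q i i (?X \<omega>))"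
    by (rule coef(2)[OF ck], rule coef(2)[OF cq])
  have "(\<integral>\<omega>. ?w \<omega> * P (?X \<omega>) (?D \<omega>) h \<partial>M) = (\<integral>\<omega>. ?w \<omega> * u (?X \<omega>) \<partial>M)
      + h * (1/2 * (\<Sum>i\<in>UNIV. (\<integral>\<omega>. ?w \<omega> * ?q i i (?X \<omega>) \<partial>M)) + (\<integral>\<omega>. ?w \<omega> * ?k (?X \<omega>) \<partial>M))"
    using total unfolding P_expand has_bochner_integral_iff by (simp add: sum_distrib_left distrib_left)
  also have "1/2 * (\<Sum>i\<in>UNIV. (\<integral>\<omega>. ?w \<omega> * ?q i i (?X \<omega>) \<partial>M)) + (\<integral>\<omega>. ?w \<omega> * ?k (?X \<omega>) \<partial>M)
      = (\<integral>\<omega>. 1/2 * (\<Sum>i\<in>UNIV. ?w \<omega> * ?q i i (?X \<omega>)) + ?w \<omega> * ?k (?X \<omega>) \<partial>M)"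
    using gen_int by (subst Bochner_Integration.integral_add) (auto simp: Bochner_Integration.integral_sum)
  also have "\<dots> = (\<integral>\<omega>. ?w \<omega> * (?k (?X \<omega>) + 1/2 * (\<Sum>i\<in>UNIV. ?q i i (?X \<omega>))) \<partial>M)"
    by (simp add: distrib_left sum_distrib_left mult_ac add_ac)
  also have "\<dots> \<le> 0"
  proof -
    have "0 \<le> - (?w \<omega> * (?k (?X \<omega>) + 1/2 * (\<Sum>i\<in>UNIV. ?q i i (?X \<omega>))))" for \<omega>
    proof -
      have "0 \<le> ?w \<omega>" using J_pos[of t x \<omega>] by (simp add: weight_def)
      then have "?w \<omega> * (?k (?X \<omega>) + 1/2 * (\<Sum>i\<in>UNIV. ?q i i (?X \<omega>))) \<le> 0"
        using generator[of "?X \<omega>"] by (rule mult_nonneg_nonpos)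
      then show ?thesis by linarith
    qed
    then have "0 \<le> (\<integral>\<omega>. - (?w \<omega> * (?k (?X \<omega>) + 1/2 * (\<Sum>i\<in>UNIV. ?q i i (?X \<omega>)))) \<partial>M)"
      by (rule Bochner_Integration.integral_nonneg)
    then show ?thesis unfolding Bochner_Integration.integral_minus by linarith
  qed
  finally show "(\<integral>\<omega>. ?w \<omega> * P (?X \<omega>) (?D \<omega>) h \<partial>M) \<le> (\<integral>\<omega>. ?w \<omega> * u (?X \<omega>) \<partial>M)"
    using h by (simp add: mult_nonneg_nonpos)
qed

text \<open>The step \<open>h0\<close> is chosen before \<open>t\<close> and \<open>A\<close>, which
  allows summation over a partition. The comparison is pointwise in the sample, with an error of
  mean at most \<open>e * h\<close>.\<close>

lemma killed_step:
  assumes e: "e > 0"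
  shows "\<exists>h0>0. \<forall>t\<ge>0. \<forall>h. \<forall>A\<in>sets (F t). 0 < h \<and> h \<le> h0 \<longrightarrow>
    (\<integral>\<omega>. weight A N (t + h) x \<omega> * u (X (t + h) x \<omega>) \<partial>M) \<le> (\<integral>\<omega>. weight A N t x \<omega> * u (X t x \<omega>) \<partial>M) + e * h"
proof -
  obtain B c where bounds: "step_bounds u Du D2u m dv \<sigma> (cball 0 (real N)) B c" using ex_step_bounds by blast
  interpret step_bounds u Du D2u m dv \<sigma> "cball 0 (real N)" B c by (rule bounds)
  let ?d = "real CARD('n)"
  \<comment> \<open>The mean of \<open>h\<close> plus the squared increment is
    \<open>(1 + ?d) * h\<close>, so this part of the error contributes
    \<open>e / 2 * h\<close>.\<close>
  define e' where "e' = e / 2 / (1 + ?d)"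
  have e': "e' > 0" using e by (simp add: e'_def add_pos_nonneg)
  obtain C1 h1 where C1: "C1 \<ge> 0" "h1 > 0"
    "\<And>x v h. \<lbrakk>x \<in> cball 0 (real N); 0 \<le> h; h \<le> h1\<rbrakk> \<Longrightarrow> 0 \<le> P x v h + C1 * norm v ^ 4"
    using one_step_lower by metis
  obtain C2 where C2: "C2 \<ge> 0" and upper:
    "\<And>h \<xi> \<beta>. \<lbrakk>0 < h; h \<le> 1; continuous_on {0..h} \<xi>; continuous_on {0..h} \<beta>;
       \<And>r. r \<in> {0..h} \<Longrightarrow> \<xi> r \<in> cball 0 (real N);
       \<And>r. r \<in> {0..h} \<Longrightarrow> \<xi> r = \<xi> 0 + \<sigma> *v \<beta> r + integral {0..r} (\<lambda>s. m (\<xi> s))\<rbrakk>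
     \<Longrightarrow> u (\<xi> h) * exp (integral {0..h} (\<lambda>s. dv (\<xi> s))) \<le> P (\<xi> 0) (\<beta> h) h
        + e' * (h + (norm (\<beta> h))\<^sup>2) + C2 * (h\<^sup>2 + norm (\<beta> h) ^ 4 + integral {0..h} (\<lambda>r. (norm (\<beta> r))\<^sup>2))"
    using one_step_upper[OF e'] by metis
  define C where "C = C1 + C2"
  \<comment> \<open>Bounds the mean of the remaining error by \<open>D * h^2\<close>: the three
    summands come from \<open>h^2\<close>, from the fourth moment and from
    \<open>S2\<close>.\<close>
  define D where "D = C * (1 + 3 * ?d\<^sup>2 + ?d)"
  have C0: "C \<ge> 0" using C1 C2 by (simp add: C_def)
  have D0: "D \<ge> 0" using C0 by (simp add: D_def)
  \<comment> \<open>The last bound gives \<open>D * h \<le> e / 2\<close>; \<open>D + 1\<close>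
    avoids division by zero.\<close>
  define h0 where "h0 = min (min 1 h1) (e / 2 / (D + 1))"
  have h0: "h0 > 0" using C1 e D0 by (simp add: h0_def)
  have "(\<integral>\<omega>. weight A N (t + h) x \<omega> * u (X (t + h) x \<omega>) \<partial>M) \<le> (\<integral>\<omega>. weight A N t x \<omega> * u (X t x \<omega>) \<partial>M) + e * h"
    if t: "t \<ge> 0" and A: "A \<in> sets (F t)" and h: "0 < h" "h \<le> h0" for t h A
  proof -
    have hs: "h \<le> 1" "h \<le> h1" "h \<le> e / 2 / (D + 1)" using h by (auto simp: h0_def)
    let ?b = "\<lambda>\<omega>. b (t + h) \<omega> - b t \<omega>"
    let ?err = "\<lambda>\<omega>. e' * (h + (norm (?b \<omega>))\<^sup>2) + C * (h\<^sup>2 + norm (?b \<omega>) ^ 4 + S2 t h \<omega>)"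
    have S2_nonneg: "S2 t h \<omega> \<ge> 0" if \<omega>: "\<omega> \<in> space M" for \<omega>
      unfolding S2_def using t \<omega>
      by (intro integral_nonneg integrable_continuous_real)
        (auto intro!: continuous_intros continuous_on_compose2[OF b_cont])
    have pointwise: "weight A N (t + h) x \<omega> * u (X (t + h) x \<omega>) \<le> weight A N t x \<omega> * P (X t x \<omega>) (?b \<omega>) h + ?err \<omega>"
      if \<omega>: "\<omega> \<in> space M" for \<omega>
    proof -
      have Jpos: "J t x \<omega> > 0" and J1: "J t x \<omega> \<le> 1" using J_pos J_le_1[OF \<omega>] by auto
      have err1: "?err \<omega> \<ge> C1 * norm (?b \<omega>) ^ 4" and err2: "?err \<omega> \<ge> 0"
        and err3: "?err \<omega> \<ge> e' * (h + (norm (?b \<omega>))\<^sup>2) + C2 * (h\<^sup>2 + norm (?b \<omega>) ^ 4 + S2 t h \<omega>)"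
      proof -
        have a: "0 \<le> e' * (h + (norm (?b \<omega>))\<^sup>2)" using e' h by simp
        have "0 \<le> h\<^sup>2 + S2 t h \<omega>" using S2_nonneg[OF \<omega>] by simp
        then have b: "C1 * norm (?b \<omega>) ^ 4 \<le> C1 * (h\<^sup>2 + norm (?b \<omega>) ^ 4 + S2 t h \<omega>)"
          using C1 by (intro mult_left_mono) auto
        have c: "0 \<le> C1 * norm (?b \<omega>) ^ 4" using C1 by simp
        have d: "0 \<le> C2 * (h\<^sup>2 + norm (?b \<omega>) ^ 4 + S2 t h \<omega>)" using C2 S2_nonneg[OF \<omega>] by simp
        have "C * (h\<^sup>2 + norm (?b \<omega>) ^ 4 + S2 t h \<omega>) = C1 * (h\<^sup>2 + norm (?b \<omega>) ^ 4 + S2 t h \<omega>)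
            + C2 * (h\<^sup>2 + norm (?b \<omega>) ^ 4 + S2 t h \<omega>)" by (simp only: C_def distrib_right)
        then show "?err \<omega> \<ge> C1 * norm (?b \<omega>) ^ 4" "?err \<omega> \<ge> 0"
          "?err \<omega> \<ge> e' * (h + (norm (?b \<omega>))\<^sup>2) + C2 * (h\<^sup>2 + norm (?b \<omega>) ^ 4 + S2 t h \<omega>)"
          using a b c d by linarith+
      qed
      \<comment> \<open>Without survival up to \<open>t\<close> both killed values vanish. If the
        path stays in the ball, the upper estimate applies. If it leaves during the step, the left
        side is 0 and the polynomial must not be too negative, which is what the lower estimate
        provides.\<close>
      consider (out) "\<omega> \<notin> A \<inter> G (real N) t x" | (stay) "\<omega> \<in> A" "\<omega> \<in> G (real N) (t + h) x"
        | (leave) "\<omega> \<in> A" "\<omega> \<in> G (real N) t x" "\<omega> \<notin> G (real N) (t + h) x" by blast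
      then show ?thesis
      proof cases
        case out
        then have "\<omega> \<notin> A \<inter> G (real N) (t + h) x" using G_antimono[of t "t + h"] h by auto
        then show ?thesis using out err2 by (simp add: weight_def)
      next
        case leave
        then have "norm (X t x \<omega>) \<le> real N" using t by (auto simp: G_def)
        then have "0 \<le> P (X t x \<omega>) (?b \<omega>) h + C1 * norm (?b \<omega>) ^ 4" using h hs by (intro C1(3)) auto
        then have "0 \<le> J t x \<omega> * (P (X t x \<omega>) (?b \<omega>) h + C1 * norm (?b \<omega>) ^ 4)" using Jpos by simp
        moreover have "J t x \<omega> * (C1 * norm (?b \<omega>) ^ 4) \<le> 1 * (C1 * norm (?b \<omega>) ^ 4)"
          using J1 C1 by (intro mult_right_mono) auto
        ultimately have "0 \<le> J t x \<omega> * P (X t x \<omega>) (?b \<omega>) h + ?err \<omega>"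
          using err1 by (simp only: distrib_left mult_1)
        then show ?thesis using leave by (simp add: weight_def)
      next
        case stay
        then have Gt: "\<omega> \<in> G (real N) t x" using G_antimono[of t "t + h"] h by auto
        let ?e3 = "e' * (h + (norm (?b \<omega>))\<^sup>2) + C2 * (h\<^sup>2 + norm (?b \<omega>) ^ 4 + S2 t h \<omega>)"
        have "u (X (t + h) x \<omega>) * exp (integral {0..h} (\<lambda>s. dv (X (t + s) x \<omega>))) \<le> P (X (t + 0) x \<omega>) (?b \<omega>) h
          + e' * (h + (norm (?b \<omega>))\<^sup>2) + C2 * (h\<^sup>2 + norm (?b \<omega>) ^ 4 + integral {0..h} (\<lambda>r. (norm (b (t + r) \<omega> - b t \<omega>))\<^sup>2))"
        proof (rule upper[of h "\<lambda>r. X (t + r) x \<omega>" "\<lambda>r. b (t + r) \<omega> - b t \<omega>"])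
          show "continuous_on {0..h} (\<lambda>r. X (t + r) x \<omega>)"
            using t by (intro continuous_on_compose2[OF X_cont[OF \<omega>]] continuous_intros) auto
          show "continuous_on {0..h} (\<lambda>r. b (t + r) \<omega> - b t \<omega>)"
            using t by (intro continuous_intros continuous_on_compose2[OF b_cont[OF \<omega>]]) auto
          show "X (t + r) x \<omega> \<in> cball 0 (real N)" if "r \<in> {0..h}" for r
            using stay(2) that t by (auto simp: G_def)
          show "X (t + r) x \<omega> = X (t + 0) x \<omega> + \<sigma> *v (b (t + r) \<omega> - b t \<omega>) + integral {0..r} (\<lambda>s. m (X (t + s) x \<omega>))"
            if "r \<in> {0..h}" for r using restarted_path(1)[OF t _ \<omega>, of r x] that by simp
        qed (use h hs in auto)
        then have "u (X (t + h) x \<omega>) * exp (integral {0..h} (\<lambda>s. dv (X (t + s) x \<omega>))) \<le> P (X t x \<omega>) (?b \<omega>) h + ?e3"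
          by (simp add: S2_def)
        then have "J t x \<omega> * (u (X (t + h) x \<omega>) * exp (integral {0..h} (\<lambda>s. dv (X (t + s) x \<omega>))))
            \<le> J t x \<omega> * (P (X t x \<omega>) (?b \<omega>) h + ?e3)" using Jpos by (intro mult_left_mono) auto
        also have "\<dots> = J t x \<omega> * P (X t x \<omega>) (?b \<omega>) h + J t x \<omega> * ?e3" by (simp only: distrib_left)
        also have "J t x \<omega> * ?e3 \<le> 1 * ?e3"
          using J1 e' C2 h S2_nonneg[OF \<omega>] by (intro mult_right_mono) auto
        finally have "J (t + h) x \<omega> * u (X (t + h) x \<omega>) \<le> J t x \<omega> * P (X t x \<omega>) (?b \<omega>) h + ?err \<omega>"
          using restarted_path(2)[OF t _ \<omega>, of h x] h err3 by (simp add: mult_ac)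
        then show ?thesis using stay Gt by (simp add: weight_def)
      qed
    qed
    have st: "0 \<le> t" "t \<le> t + h" "t < t + h" using t h by auto
    note n2 = increment_norm2[OF st(1,2)] and n4 = increment_norm4[OF st(1,3)]
    note s2 = S2_expectation[OF t less_imp_le[OF h(1)]]
    have err_int: "integrable M ?err"
      using n2(1) n4(1) s2(1) by simp
    have err_le: "(\<integral>\<omega>. ?err \<omega> \<partial>M) \<le> e * h"
    proof -
      have "(\<integral>\<omega>. ?err \<omega> \<partial>M) = e' * (h + (\<integral>\<omega>. (norm (?b \<omega>))\<^sup>2 \<partial>M))
          + C * (h\<^sup>2 + (\<integral>\<omega>. norm (?b \<omega>) ^ 4 \<partial>M) + (\<integral>\<omega>. S2 t h \<omega> \<partial>M))"
        using n2(1) n4(1) s2(1) by (simp add: prob_space)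
      also have "\<dots> \<le> e' * (h + ?d * h) + C * (h\<^sup>2 + 3 * ?d\<^sup>2 * h\<^sup>2 + ?d * h\<^sup>2)"
        using n2(2) n4(2) s2(2) e' C0 by (intro add_mono mult_left_mono) auto
      also have "\<dots> = e' * (1 + ?d) * h + D * h * h"
        by (simp add: D_def algebra_simps power2_eq_square)
      also have "e' * (1 + ?d) = e / 2"
        unfolding e'_def by (intro nonzero_eq_divide_eq[THEN iffD1]) (auto simp: add_nonneg_eq_0_iff)
      also have "D * h * h \<le> e / 2 * h"
      proof -
        have "D * h \<le> (D + 1) * (e / 2 / (D + 1))" using hs D0 h by (intro mult_mono) auto
        also have "\<dots> = e / 2"
          using D0 by (subst mult.commute) (intro nonzero_eq_divide_eq[THEN iffD1], auto)
        finally show ?thesis using h by (intro mult_right_mono) auto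
      qed
      finally show ?thesis by simp
    qed
    have A': "A \<in> sets (F (t + h))" using A F_mono[of t "t + h"] h by auto
    have th: "t + h \<ge> 0" using t h by simp
    have "(\<integral>\<omega>. weight A N (t + h) x \<omega> * u (X (t + h) x \<omega>) \<partial>M)
        \<le> (\<integral>\<omega>. weight A N t x \<omega> * P (X t x \<omega>) (?b \<omega>) h + ?err \<omega> \<partial>M)"
      using pointwise
      by (intro integral_mono weight_coefficient(2)[OF th A' u_cont] Bochner_Integration.integrable_add
          expected_quadratic_le(1)[OF t h(1) A bounds] err_int)
    also have "\<dots> = (\<integral>\<omega>. weight A N t x \<omega> * P (X t x \<omega>) (?b \<omega>) h \<partial>M) + (\<integral>\<omega>. ?err \<omega> \<partial>M)"
      by (intro Bochner_Integration.integral_add expected_quadratic_le(1)[OF t h(1) A bounds] err_int)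
    also have "\<dots> \<le> (\<integral>\<omega>. weight A N t x \<omega> * u (X t x \<omega>) \<partial>M) + e * h"
      by (intro add_mono expected_quadratic_le(2)[OF t h(1) A bounds] err_le)
    finally show ?thesis .
  qed
  then show ?thesis using h0 by blast
qed

text \<open>The monotonicity argument runs only over times after \<open>s\<close>, where an event of
  \<open>F s\<close> remains an event of the current past.\<close>

lemma killed_supermartingale:
  assumes st: "0 \<le> s" "s \<le> t" and A: "A \<in> sets (F s)"
  shows "(\<integral>\<omega>. weight A N t x \<omega> * u (X t x \<omega>) \<partial>M) \<le> (\<integral>\<omega>. weight A N s x \<omega> * u (X s x \<omega>) \<partial>M)"
proof (rule decreasing_of_small_increments[where g="\<lambda>t. \<integral>\<omega>. weight A N t x \<omega> * u (X t x \<omega>) \<partial>M" and s=s and t=t])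
  fix e :: real assume "e > 0"
  from killed_step[OF this, of N x] obtain h0 where h0: "h0 > 0" "\<And>t h A. \<lbrakk>t \<ge> 0; A \<in> sets (F t); 0 < h; h \<le> h0\<rbrakk> \<Longrightarrow>
    (\<integral>\<omega>. weight A N (t + h) x \<omega> * u (X (t + h) x \<omega>) \<partial>M) \<le> (\<integral>\<omega>. weight A N t x \<omega> * u (X t x \<omega>) \<partial>M) + e * h"
    by blast
  show "\<exists>h0>0. \<forall>t\<ge>s. \<forall>h. 0 < h \<and> h \<le> h0 \<longrightarrow>
    (\<integral>\<omega>. weight A N (t + h) x \<omega> * u (X (t + h) x \<omega>) \<partial>M) \<le> (\<integral>\<omega>. weight A N t x \<omega> * u (X t x \<omega>) \<partial>M) + e * h"
  proof (intro exI[of _ h0] conjI allI impI)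
    fix r h assume "s \<le> r" "0 < h \<and> h \<le> h0"
    then show "(\<integral>\<omega>. weight A N (r + h) x \<omega> * u (X (r + h) x \<omega>) \<partial>M)
        \<le> (\<integral>\<omega>. weight A N r x \<omega> * u (X r x \<omega>) \<partial>M) + e * h"
      using st A F_mono[of s r] by (intro h0(2)) auto
  qed (rule h0)
qed (rule st)

text \<open>Formulated with extended nonnegative integrals because integrability of \<open>Z\<close>
  is not known here. A path is bounded on \<open>[0, t]\<close>, so its killed values coincide with
  \<open>Z\<close> for all large radii.\<close>

lemma Z_supermartingale:
  assumes st: "0 \<le> s" "s \<le> t" and A: "A \<in> sets (F s)"
  shows "(\<integral>\<^sup>+\<omega>. ennreal (Z t x \<omega>) * indicator A \<omega> \<partial>M) \<le> (\<integral>\<^sup>+\<omega>. ennreal (Z s x \<omega>) * indicator A \<omega> \<partial>M)"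
proof -
  let ?f = "\<lambda>N r \<omega>. weight A N r x \<omega> * u (X r x \<omega>)"
  have t: "t \<ge> 0" using st by simp
  have At: "A \<in> sets (F t)" using A F_mono[OF st(2)] by auto
  have f_nonneg: "0 \<le> ?f N r \<omega>" for N r \<omega>
    using J_pos[of r x \<omega>] u_pos[of "X r x \<omega>"] by (simp add: weight_def)
  have f_le: "ennreal (?f N r \<omega>) \<le> ennreal (Z r x \<omega>) * indicator A \<omega>" for N r \<omega>
    using J_pos[of r x \<omega>] u_pos[of "X r x \<omega>"] by (auto simp: weight_def Z_def indicator_def)
  have lim: "(\<lambda>N. ennreal (?f N t \<omega>)) \<longlonglongrightarrow> ennreal (Z t x \<omega>) * indicator A \<omega>" if \<omega>: "\<omega> \<in> space M" for \<omega>
  proof -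
    interpret additive_flow m Dm "\<lambda>t. \<sigma> *v b t \<omega>" "\<lambda>t x. X t x \<omega>" by (rule path_flow[OF \<omega>])
    obtain C where C: "\<And>r. r \<in> {0..t} \<Longrightarrow> norm (X r x \<omega>) \<le> C" using path_bounded by blast
    obtain N0 where N0: "C \<le> real N0" using real_arch_simple by blast
    have "ennreal (?f N t \<omega>) = ennreal (Z t x \<omega>) * indicator A \<omega>" if "N \<ge> N0" for N
    proof -
      have "norm (X r x \<omega>) \<le> real N" if "r \<in> {0..t}" for r
        using C[OF that] N0 \<open>N \<ge> N0\<close> by simp
      then have "\<omega> \<in> G (real N) t x" using \<omega> by (simp add: G_def)
      then show ?thesis by (simp add: weight_def Z_def indicator_def)
    qed
    then show ?thesis by (intro tendsto_eventually eventually_sequentiallyI)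
  qed
  have nn: "(\<integral>\<^sup>+\<omega>. ennreal (?f N r \<omega>) \<partial>M) = ennreal (\<integral>\<omega>. ?f N r \<omega> \<partial>M)" if "r \<ge> 0" "A \<in> sets (F r)" for N r
    by (intro nn_integral_eq_integral weight_coefficient(2)[OF that u_cont] AE_I2 f_nonneg)
  have bound: "(\<integral>\<^sup>+\<omega>. ennreal (?f N t \<omega>) \<partial>M) \<le> (\<integral>\<^sup>+\<omega>. ennreal (Z s x \<omega>) * indicator A \<omega> \<partial>M)" for N
  proof -
    have "(\<integral>\<^sup>+\<omega>. ennreal (?f N t \<omega>) \<partial>M) \<le> (\<integral>\<^sup>+\<omega>. ennreal (?f N s \<omega>) \<partial>M)"
      unfolding nn[OF t At] nn[OF st(1) A] by (intro ennreal_leI killed_supermartingale st A)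
    also have "\<dots> \<le> (\<integral>\<^sup>+\<omega>. ennreal (Z s x \<omega>) * indicator A \<omega> \<partial>M)" by (intro nn_integral_mono f_le)
    finally show ?thesis .
  qed
  have "(\<integral>\<^sup>+\<omega>. ennreal (Z t x \<omega>) * indicator A \<omega> \<partial>M) = (\<integral>\<^sup>+\<omega>. liminf (\<lambda>N. ennreal (?f N t \<omega>)) \<partial>M)"
    by (intro nn_integral_cong lim_imp_Liminf[symmetric] lim) auto
  also have "\<dots> \<le> liminf (\<lambda>N. \<integral>\<^sup>+\<omega>. ennreal (?f N t \<omega>) \<partial>M)"
    by (intro nn_integral_liminf measurable_compose[OF measurable_F_M[OF weight_coefficient(1)[OF t At u_cont]]]) measurable
  also have "\<dots> \<le> (\<integral>\<^sup>+\<omega>. ennreal (Z s x \<omega>) * indicator A \<omega> \<partial>M)"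
    using bound by (intro Liminf_le) (auto intro: always_eventually)
  finally show ?thesis .
qed

end

subsection \<open>The volume integral\<close>

text \<open>The inequality is tested on the very set where it fails, which belongs to
  \<open>F\<close> because both sides are \<open>F\<close>-measurable. There the excess is
  nonnegative with nonpositive integral, hence zero almost everywhere.\<close>

lemma (in prob_space) real_cond_exp_le:
  fixes f g :: "'a \<Rightarrow> real"
  assumes sub: "subalgebra M F" and f: "integrable M f" "\<And>\<omega>. \<omega> \<in> space M \<Longrightarrow> f \<omega> \<ge> 0"
    and g: "integrable M g" "\<And>\<omega>. \<omega> \<in> space M \<Longrightarrow> g \<omega> \<ge> 0" and gF: "g \<in> borel_measurable F"
    and le: "\<And>A. A \<in> sets F \<Longrightarrow>
      (\<integral>\<^sup>+\<omega>. ennreal (f \<omega>) * indicator A \<omega> \<partial>M) \<le> (\<integral>\<^sup>+\<omega>. ennreal (g \<omega>) * indicator A \<omega> \<partial>M)"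
  shows "AE \<omega> in M. real_cond_exp M F f \<omega> \<le> g \<omega>"
proof -
  interpret finite_measure_subalgebra M F by unfold_locales (rule sub)
  let ?e = "real_cond_exp M F f"
  define A where "A = {\<omega> \<in> space F. g \<omega> < ?e \<omega>}"
  have AF: "A \<in> sets F" unfolding A_def using gF by measurable
  have AM: "A \<in> sets M" using AF sub by (auto simp: subalgebra_def)
  have e_int: "integrable M ?e" by (rule real_cond_exp_int(1)[OF f(1)])
  have ind: "integrable M (\<lambda>\<omega>. indicator A \<omega> * k \<omega>)" if "integrable M k" for k :: "'a \<Rightarrow> real"
    using integrable_mult_indicator[OF AM that] by simp
  note i = ind[OF f(1)] ind[OF g(1)] ind[OF e_int]
  have nn: "(\<integral>\<^sup>+\<omega>. ennreal (k \<omega>) * indicator A \<omega> \<partial>M) = ennreal (\<integral>\<omega>. indicator A \<omega> * k \<omega> \<partial>M)"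
    if "integrable M (\<lambda>\<omega>. indicator A \<omega> * k \<omega>)" "\<And>\<omega>. \<omega> \<in> space M \<Longrightarrow> k \<omega> \<ge> 0" for k
  proof -
    have "(\<integral>\<^sup>+\<omega>. ennreal (k \<omega>) * indicator A \<omega> \<partial>M) = (\<integral>\<^sup>+\<omega>. ennreal (indicator A \<omega> * k \<omega>) \<partial>M)"
      by (intro nn_integral_cong) (auto simp: indicator_def)
    also have "\<dots> = ennreal (\<integral>\<omega>. indicator A \<omega> * k \<omega> \<partial>M)"
      using that by (intro nn_integral_eq_integral) auto
    finally show ?thesis .
  qed
  have "(\<integral>\<omega>. indicator A \<omega> * ?e \<omega> \<partial>M) = (\<integral>\<omega>. indicator A \<omega> * f \<omega> \<partial>M)"
    using real_cond_exp_intA[OF f(1) AF] by (simp add: set_lebesgue_integral_def)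
  also have "\<dots> \<le> (\<integral>\<omega>. indicator A \<omega> * g \<omega> \<partial>M)"
  proof -
    have "ennreal (\<integral>\<omega>. indicator A \<omega> * f \<omega> \<partial>M) \<le> ennreal (\<integral>\<omega>. indicator A \<omega> * g \<omega> \<partial>M)"
      using le[OF AF] nn[of f, OF i(1) f(2)] nn[of g, OF i(2) g(2)] by simp
    moreover have "0 \<le> (\<integral>\<omega>. indicator A \<omega> * g \<omega> \<partial>M)"
      by (intro integral_nonneg_AE AE_I2) (simp add: g(2))
    ultimately show ?thesis by (simp add: ennreal_le_iff)
  qed
  finally have le0: "(\<integral>\<omega>. indicator A \<omega> * ?e \<omega> - indicator A \<omega> * g \<omega> \<partial>M) \<le> 0"
    using i by simp
  have nonneg: "0 \<le> indicator A \<omega> * ?e \<omega> - indicator A \<omega> * g \<omega>" for \<omega>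
    by (auto simp: A_def indicator_def)
  then have "(\<integral>\<omega>. indicator A \<omega> * ?e \<omega> - indicator A \<omega> * g \<omega> \<partial>M) = 0"
    using le0 Bochner_Integration.integral_nonneg[OF nonneg] by (intro order.antisym) auto
  then have "AE \<omega> in M. indicator A \<omega> * ?e \<omega> - indicator A \<omega> * g \<omega> = 0"
    using nonneg i by (subst (asm) integral_nonneg_eq_0_iff_AE) auto
  then show ?thesis
  proof (rule AE_mp, intro AE_I2 impI)
    fix \<omega> assume "\<omega> \<in> space M" "indicator A \<omega> * ?e \<omega> - indicator A \<omega> * g \<omega> = 0"
    then show "?e \<omega> \<le> g \<omega>" using sub by (auto simp: A_def indicator_def subalgebra_def split: if_splits)
  qed
qed

context sde_flow begin

definition Y :: "(real^'n) set \<Rightarrow> real \<Rightarrow> 'w \<Rightarrow> real" where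
  "Y K t \<omega> = integral ((\<lambda>x. X t x \<omega>) ` K) u"

lemma Y_nonneg: "Y K t \<omega> \<ge> 0"
  unfolding Y_def using u_pos
  \<comment> \<open>On a domain where \<open>u\<close> is not integrable the gauge integral has the
    default value 0, so nonnegativity holds for every \<open>K\<close> and every sample.\<close>
  by (cases "u integrable_on (\<lambda>x. X t x \<omega>) ` K")
    (auto intro!: Henstock_Kurzweil_Integration.integral_nonneg simp: not_integrable_integral less_imp_le)

lemma Y_eq:
  assumes t: "t \<ge> 0" and \<omega>: "\<omega> \<in> space M" and K: "compact K"
  shows "ennreal (Y K t \<omega>) = (\<integral>\<^sup>+x. ennreal (Z t x \<omega>) * indicator K x \<partial>lborel)"
  using flow_change_of_variables[OF path_flow[OF \<omega>] t K u_cont] less_imp_le[OF u_pos]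
  by (simp add: Y_def Z_def J_def divm_eq[OF \<omega>])

text \<open>A parameter integral of a function jointly measurable with respect to
  \<open>F t\<close>. The representation of \<open>Y\<close> holds at every sample point, so
  \<open>Y\<close> is adapted to the natural filtration itself, without null sets added.\<close>

lemma Y_measurable:
  assumes t: "t \<ge> 0" and K: "compact K"
  shows "Y K t \<in> borel_measurable (F t)"
proof -
  have [measurable]: "K \<in> sets borel" using K by (rule borel_compact)
  have Zm: "(\<lambda>p. Z t (fst p) (snd p)) \<in> borel_measurable (borel \<Otimes>\<^sub>M F t)" by (rule Z_joint_measurable[OF t])
  have "(\<lambda>p. (snd p, fst p)) \<in> F t \<Otimes>\<^sub>M lborel \<rightarrow>\<^sub>M borel \<Otimes>\<^sub>M F t" by measurable
  from measurable_compose[OF this Zm]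
  have [measurable]: "(\<lambda>p. Z t (snd p) (fst p)) \<in> borel_measurable (F t \<Otimes>\<^sub>M lborel)" by simp
  have "(\<lambda>\<omega>. \<integral>\<^sup>+x. ennreal (Z t x \<omega>) * indicator K x \<partial>lborel) \<in> borel_measurable (F t)"
    by (rule lborel.borel_measurable_nn_integral) (simp add: case_prod_beta')
  then have meas: "(\<lambda>\<omega>. enn2real (\<integral>\<^sup>+x. ennreal (Z t x \<omega>) * indicator K x \<partial>lborel)) \<in> borel_measurable (F t)"
    by measurable
  have eq: "enn2real (\<integral>\<^sup>+x. ennreal (Z t x \<omega>) * indicator K x \<partial>lborel) = Y K t \<omega>" if "\<omega> \<in> space (F t)" for \<omega>
    using that Y_nonneg by (simp add: Y_eq[OF t _ K, symmetric])
  show ?thesis by (rule measurable_cong[THEN iffD1, OF _ meas]) (rule eq)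
qed

lemma Y_supermartingale_nn:
  assumes st: "0 \<le> s" "s \<le> t" and A: "A \<in> sets (F s)" and K: "compact K"
  shows "(\<integral>\<^sup>+\<omega>. ennreal (Y K t \<omega>) * indicator A \<omega> \<partial>M) \<le> (\<integral>\<^sup>+\<omega>. ennreal (Y K s \<omega>) * indicator A \<omega> \<partial>M)"
proof -
  interpret pair_sigma_finite "lborel :: (real^'n) measure" M by unfold_locales
  have AM[measurable]: "A \<in> sets M" using A F_subalgebra by (auto simp: subalgebra_def)
  have [measurable]: "K \<in> sets borel" using K by (rule borel_compact)
  have tonelli: "(\<integral>\<^sup>+\<omega>. ennreal (Y K r \<omega>) * indicator A \<omega> \<partial>M)
      = (\<integral>\<^sup>+x. (\<integral>\<^sup>+\<omega>. ennreal (Z r x \<omega>) * indicator A \<omega> \<partial>M) * indicator K x \<partial>lborel)" if r: "r \<ge> 0" for r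
  proof -
    have id: "(\<lambda>\<omega>. \<omega>) \<in> M \<rightarrow>\<^sub>M F r" by (rule measurable_F_M[OF measurable_ident_sets[OF refl]])
    have "(\<lambda>p. (fst p, snd p)) \<in> lborel \<Otimes>\<^sub>M M \<rightarrow>\<^sub>M borel \<Otimes>\<^sub>M F r"
      by (intro measurable_Pair measurable_compose[OF measurable_snd id]) (simp add: measurable_fst'')
    from measurable_compose[OF this Z_joint_measurable[OF r]]
    have Zm[measurable]: "(\<lambda>p. Z r (fst p) (snd p)) \<in> borel_measurable (lborel \<Otimes>\<^sub>M M)" by simp
    have [measurable]: "Z r x \<in> borel_measurable M" for x by (rule measurable_F_M[OF fixed_start_measurable(3)[OF r]])
    have "(\<integral>\<^sup>+\<omega>. ennreal (Y K r \<omega>) * indicator A \<omega> \<partial>M)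
      = (\<integral>\<^sup>+\<omega>. (\<integral>\<^sup>+x. ennreal (Z r x \<omega>) * indicator K x * indicator A \<omega> \<partial>lborel) \<partial>M)"
    proof (rule nn_integral_cong)
      fix \<omega> assume \<omega>: "\<omega> \<in> space M"
      have "(\<lambda>x. Z r x \<omega>) \<in> borel_measurable lborel"
        using measurable_compose[OF measurable_Pair2'[OF \<omega>] Zm] by simp
      then have [measurable]: "(\<lambda>x. Z r x \<omega>) \<in> borel_measurable borel" by simp
      show "ennreal (Y K r \<omega>) * indicator A \<omega> = (\<integral>\<^sup>+x. ennreal (Z r x \<omega>) * indicator K x * indicator A \<omega> \<partial>lborel)"
        unfolding Y_eq[OF r \<omega> K] by (rule nn_integral_multc[symmetric]) measurable
    qed
    also have "\<dots> = (\<integral>\<^sup>+x. (\<integral>\<^sup>+\<omega>. ennreal (Z r x \<omega>) * indicator K x * indicator A \<omega> \<partial>M) \<partial>lborel)"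
      by (rule Fubini') (simp add: case_prod_beta')
    also have "\<dots> = (\<integral>\<^sup>+x. (\<integral>\<^sup>+\<omega>. ennreal (Z r x \<omega>) * indicator A \<omega> \<partial>M) * indicator K x \<partial>lborel)"
      by (intro nn_integral_cong) (subst nn_integral_multc[symmetric], auto simp: mult_ac)
    finally show ?thesis .
  qed
  show ?thesis
    unfolding tonelli[OF st(1)] tonelli[OF order.trans[OF st]]
    by (intro nn_integral_mono mult_right_mono Z_supermartingale st A) auto
qed

text \<open>The supermartingale inequality on the whole space compares the mean with that at time 0,
  where the flow is the identity and the volume integral is a constant.\<close>

lemma Y_integrable:
  assumes t: "t \<ge> 0" and K: "compact K"
  shows "integrable M (Y K t)"
proof (rule integrableI_bounded)
  show "Y K t \<in> borel_measurable M" by (rule measurable_F_M[OF Y_measurable[OF t K]])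
  have Y0: "Y K 0 \<omega> = integral K u" if "\<omega> \<in> space M" for \<omega>
    using that by (simp add: Y_def X_eq b_0)
  have sp: "space M \<in> sets (F 0)" using sets.top[of "F 0"] by simp
  have "(\<integral>\<^sup>+\<omega>. ennreal (norm (Y K t \<omega>)) \<partial>M) = (\<integral>\<^sup>+\<omega>. ennreal (Y K t \<omega>) * indicator (space M) \<omega> \<partial>M)"
    by (intro nn_integral_cong) (auto simp: Y_nonneg)
  also have "\<dots> \<le> (\<integral>\<^sup>+\<omega>. ennreal (Y K 0 \<omega>) * indicator (space M) \<omega> \<partial>M)"
    by (rule Y_supermartingale_nn[OF order.refl t sp K])
  also have "\<dots> = (\<integral>\<^sup>+\<omega>. ennreal (integral K u) \<partial>M)" by (intro nn_integral_cong) (simp add: Y0)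
  also have "\<dots> < \<infinity>" by (simp add: emeasure_space_1)
  finally show "(\<integral>\<^sup>+\<omega>. ennreal (norm (Y K t \<omega>)) \<partial>M) < \<infinity>" .
qed

lemma Y_supermartingale:
  assumes K: "compact K"
  shows "supermartingale M F (Y K)"
  unfolding supermartingale_def
proof (intro conjI allI impI)
  fix s t :: real assume st: "0 \<le> s \<and> s \<le> t"
  show "AE \<omega> in M. real_cond_exp M (F s) (Y K t) \<omega> \<le> Y K s \<omega>"
    using st by (intro real_cond_exp_le F_subalgebra Y_integrable Y_nonneg Y_measurable Y_supermartingale_nn K) auto
qed (use Y_measurable Y_integrable K in auto)

end

section \<open>Gradient, divergence and the operator in terms of derivatives\<close>

lemma grad_eq:
  assumes "(f has_derivative f') (at x)"
  shows "grad f x = (\<chi> i. f' (axis i 1))"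
  using frechet_derivative_at[OF assms] by (simp add: grad_def)

lemma divergence_eq:
  assumes "(f has_derivative f') (at x)"
  shows "divergence f x = (\<Sum>i\<in>UNIV. f' (axis i 1) $ i)"
  using frechet_derivative_at[OF assms] by (simp add: divergence_def)

text \<open>Passing from a functional to its coordinate vector is bounded linear, so the gradient
  can be differentiated directly from the second derivative.\<close>

lemma bounded_linear_blinfun_to_vec: "bounded_linear (\<lambda>f :: (real^'n) \<Rightarrow>\<^sub>L real. \<chi> i. f (axis i 1))"
proof (rule bounded_linear_intro[where K="real CARD('n)"])
  fix f :: "(real^'n) \<Rightarrow>\<^sub>L real"
  have "norm (\<chi> i. f (axis i 1)) \<le> (\<Sum>i\<in>UNIV. \<bar>f (axis i 1)\<bar>)"
    using norm_le_l1_cart[of "\<chi> i. f (axis i 1)"] by simp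
  also have "\<dots> \<le> (\<Sum>i\<in>(UNIV :: 'n set). norm f)"
    by (intro sum_mono) (metis mult.right_neutral norm_axis_1 norm_blinfun real_norm_def)
  finally show "norm (\<chi> i. f (axis i 1)) \<le> norm f * real CARD('n)" by (simp add: mult.commute)
qed (auto simp: vec_eq_iff blinfun.add_left blinfun.scaleR_left)

text \<open>The diffusion matrix is constant, so the divergence term pairs
  \<open>\<sigma> ** transpose \<sigma>\<close> with the Hessian. Expanding the matrix product and
  summing over the common index last gives the Hessian on the columns of
  \<open>\<sigma>\<close>.\<close>

lemma L_sharp_eq:
  fixes u :: "real^'n \<Rightarrow> real" and \<sigma> :: "real^'n^'n"
  assumes Du: "\<And>x. (u has_derivative blinfun_apply (Du x)) (at x)"
    and D2u: "\<And>x. (Du has_derivative blinfun_apply (D2u x)) (at x)"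
  shows "L_sharp (\<sigma> ** transpose \<sigma>) m u x = Du x (m x) + divergence m x * u x
     + 1/2 * (\<Sum>i\<in>UNIV. D2u x (\<sigma> *v axis i 1) (\<sigma> *v axis i 1))"
proof -
  let ?a = "\<sigma> ** transpose \<sigma>"
  have vec: "v = (\<Sum>i\<in>UNIV. v $ i *\<^sub>R axis i 1)" for v :: "real^'n"
    using basis_expansion[of v] by (simp add: scalar_mult_eq_scaleR)
  have gu: "grad u y = (\<chi> i. Du y (axis i 1))" for y by (rule grad_eq[OF Du])
  have 1: "m x \<bullet> grad u x = Du x (m x)"
    by (subst (2) vec) (simp add: gu inner_vec_def blinfun.sum_right blinfun.scaleR_right)
  have "((\<lambda>y. ?a *v (\<chi> i. Du y (axis i 1))) has_derivative
      (\<lambda>v. ?a *v (\<chi> i. D2u x v (axis i 1)))) (at x)"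
    by (intro bounded_linear.has_derivative[OF matrix_vector_mul_bounded_linear]
        bounded_linear.has_derivative[OF bounded_linear_blinfun_to_vec] D2u)
  from divergence_eq[OF this]
  have "divergence (\<lambda>y. ?a *v grad u y) x = (\<Sum>i\<in>UNIV. \<Sum>k\<in>UNIV. ?a $ i $ k * D2u x (axis i 1) (axis k 1))"
    by (simp add: gu matrix_vector_mult_def)
  also have "\<dots> = (\<Sum>i\<in>UNIV. \<Sum>k\<in>UNIV. \<Sum>j\<in>UNIV. \<sigma> $ i $ j * \<sigma> $ k $ j * D2u x (axis i 1) (axis k 1))"
    by (simp add: matrix_matrix_mult_def transpose_def sum_distrib_right)
  also have "\<dots> = (\<Sum>j\<in>UNIV. \<Sum>i\<in>UNIV. \<Sum>k\<in>UNIV. \<sigma> $ i $ j * \<sigma> $ k $ j * D2u x (axis i 1) (axis k 1))"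
    by (subst sum.swap[of _ _ "UNIV :: 'n set"]) (rule sum.swap)
  also have "\<dots> = (\<Sum>j\<in>UNIV. D2u x (\<sigma> *v axis j 1) (\<sigma> *v axis j 1))"
  proof (intro sum.cong refl)
    fix j
    have col: "\<sigma> *v axis j 1 = (\<Sum>i\<in>UNIV. \<sigma> $ i $ j *\<^sub>R axis i 1)"
      by (subst vec) (simp add: matrix_vector_mult_basis column_def)
    have left: "D2u x (\<sigma> *v axis j 1) z = (\<Sum>i\<in>UNIV. \<sigma> $ i $ j * D2u x (axis i 1) z)" for z
      unfolding col by (simp add: blinfun.sum_right blinfun.sum_left blinfun.scaleR_right blinfun.scaleR_left)
    have right: "D2u x y (\<sigma> *v axis j 1) = (\<Sum>k\<in>UNIV. \<sigma> $ k $ j * D2u x y (axis k 1))" for y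
      unfolding col by (simp add: blinfun.sum_right blinfun.scaleR_right)
    show "(\<Sum>i\<in>UNIV. \<Sum>k\<in>UNIV. \<sigma> $ i $ j * \<sigma> $ k $ j * D2u x (axis i 1) (axis k 1))
        = D2u x (\<sigma> *v axis j 1) (\<sigma> *v axis j 1)"
      unfolding left unfolding right by (simp add: sum_distrib_left mult_ac)
  qed
  finally show ?thesis by (simp add: L_sharp_def 1)
qed

theorem theorem4p2:
  fixes M :: "'w measure"
    and b :: "real \<Rightarrow> 'w \<Rightarrow> real^'n"
    and \<sigma> :: "real^'n^'n"
    and m :: "real^'n \<Rightarrow> real^'n"
    and \<psi> :: "real^'n \<Rightarrow> real"
    and lc :: real
    and X :: "real \<Rightarrow> real^'n \<Rightarrow> 'w \<Rightarrow> real^'n"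
    and u :: "real^'n \<Rightarrow> real"
    and A :: "(real^'n) set"
  assumes dim: "CARD('n) \<ge> 2"
    and BM: "standard_BM M b"
    and sigma_sym: "transpose \<sigma> = \<sigma>"
    and sigma_pd: "\<forall>v. v \<noteq> 0 \<longrightarrow> v \<bullet> (\<sigma> *v v) > 0"
    and m_C11: "C11 m"
    and psi_pos: "\<forall>x. \<psi> x > 0"
    and psi_diff: "\<forall>x. (\<lambda>y. ln (\<psi> y)) differentiable (at x)"
    and m_psi: "\<forall>x. m x = - ((\<sigma> ** transpose \<sigma>) *v grad (\<lambda>y. ln (\<psi> y)) x)"
    and psi_int: "((\<lambda>x. 1 / (\<psi> x)\<^sup>2) has_integral 1) UNIV"
    and lc_pos: "lc > 0"
    and div_m: "\<forall>x. divergence m x \<le> - lc"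
    and X_cont: "\<forall>x. \<forall>\<omega>\<in>space M. continuous_on {0..} (\<lambda>t. X t x \<omega>)"
    and X_eq: "\<forall>t\<ge>0. \<forall>x. \<forall>\<omega>\<in>space M.
                 X t x \<omega> = x + \<sigma> *v b t \<omega> + integral {0..t} (\<lambda>s. m (X s x \<omega>))"
    and X_diffeo: "\<forall>t\<ge>0. \<forall>\<omega>\<in>space M. bij (\<lambda>x. X t x \<omega>) \<and>
                 (\<forall>x. (\<lambda>x. X t x \<omega>) differentiable (at x)) \<and>
                 (\<forall>y. (inv (\<lambda>x. X t x \<omega>)) differentiable (at y))"
    and u_C2: "C2 u"
    and u_pos: "\<forall>x. u x > 0"
    and u_super: "\<forall>x. L_sharp (\<sigma> ** transpose \<sigma>) m u x \<le> 0"
    and A_compact: "compact A"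
  shows "supermartingale M (natural_filtration M b) (\<lambda>t \<omega>. integral ((\<lambda>x. X t x \<omega>) ` A) u)
         \<and> (\<forall>t\<ge>0. \<forall>\<omega>\<in>space M. integral ((\<lambda>x. X t x \<omega>) ` A) u \<ge> 0)"
proof -
  interpret prob_space M using BM by (simp add: standard_BM_def)
  obtain Dm LD where Dm: "\<And>x. (m has_derivative blinfun_apply (Dm x)) (at x)" and LD: "LD-lipschitz_on UNIV Dm"
    using m_C11 unfolding C11_def by blast
  obtain Du D2u where Du: "\<And>x. (u has_derivative blinfun_apply (Du x)) (at x)"
    and D2u: "\<And>x. (Du has_derivative blinfun_apply (D2u x)) (at x)" and D2u_cont: "continuous_on UNIV D2u"
    using u_C2 unfolding C2_def by blast
  \<comment> \<open>The bound \<open>- lc\<close> on the divergence makes it nonpositive, which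
    keeps the Jacobian at most 1; the supersolution property is translated into trace form.\<close>
  interpret sde_flow M b \<sigma> m Dm LD X u Du D2u "divergence m"
  proof
    show "divergence m x = (\<Sum>i\<in>UNIV. Dm x (axis i 1) $ i)" for x by (rule divergence_eq[OF Dm])
    show "divergence m x \<le> 0" for x using div_m lc_pos by (smt (verit))
    show "Du x (m x) + divergence m x * u x
       + 1/2 * (\<Sum>i\<in>UNIV. D2u x (\<sigma> *v axis i 1) (\<sigma> *v axis i 1)) \<le> 0" for x
      using u_super unfolding L_sharp_eq[OF Du D2u] by blast
  qed (use BM Dm LD X_cont X_eq X_diffeo Du D2u D2u_cont u_pos in blast)+
  show ?thesis
    using Y_supermartingale[OF A_compact] Y_nonneg[of A] unfolding Y_def[abs_def] by blast
qed

end
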